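(* The border rank of the Kronecker product $T_{\mathrm{Leit},5}\boxtimes W\in\mathbb{C}^{10}\otimes\mathbb{C}^{10}\otimes\mathbb{C}^{10}$ is equal to $12$, where $T_{\mathrm{Leit},5}\in\mathbb{C}^5\otimes\mathbb{C}^5\otimes\mathbb{C}^5$ is $$T_{\mathrm{Leit},5}=a_1\otimes(b_1\otimes c_1+b_2\otimes c_2+b_3\otimes c_3+b_4\otimes c_4+b_5\otimes c_5)+a_2\otimes(b_1\otimes c_3+b_3\otimes c_5)+a_3\otimes b_1\otimes c_4+a_4\otimes b_2\otimes c_4+a_5\otimes b_2\otimes c_5$$ (with $(a_i),(b_i),(c_i)$ bases of the three copies of $\mathbb{C}^5$), and $W\in\mathbb{C}^2\otimes\mathbb{C}^2\otimes\mathbb{C}^2$ is $$W=a_1\otimes b_1\otimes c_2+a_1\otimes b_2\otimes c_1+a_2\otimes b_1\otimes c_1$$ (with $(a_i),(b_i),(c_i)$ bases of the three copies of $\mathbb{C}^2$).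
   Context: All vector spaces are over $\mathbb{C}$. For $T_1\in A_1\otimes B_1\otimes C_1$ and $T_2\in A_2\otimes B_2\otimes C_2$, the Kronecker product $T_1\boxtimes T_2\in (A_1\otimes A_2)\otimes(B_1\otimes B_2)\otimes(C_1\otimes C_2)$ is the tensor product $T_1\otimes T_2$ regarded as a three-factor tensor. The border rank of a nonzero tensor $T\in A\otimes B\otimes C$ is the smallest integer $r$ such that $T$ lies in the Zariski closure of the set of tensors of the form $\sum_{i=1}^r a_i\otimes b_i\otimes c_i$ with $a_i\in A$, $b_i\in B$, $c_i\in C$. *)

theory Defs
  imports "HOL-Analysis.Analysis"
begin

text \<open>
  A tensor in \<open>\<complex>\<^sup>A \<otimes> \<complex>\<^sup>B \<otimes> \<complex>\<^sup>C\<close>, for finite index types \<open>'a\<close>, \<open>'b\<close>, \<open>'c\<close>, is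
  represented by its array of coordinates in the standard bases.  In \<open>complex^'c^'b^'a\<close> the
  outermost index is the one of the first factor, so the coordinates are \<open>T $ i $ j $ k\<close>
  with \<open>i :: 'a\<close>, \<open>j :: 'b\<close>, \<open>k :: 'c\<close>.
\<close>

type_synonym ('a, 'b, 'c) tensor3 = "complex^'c^'b^'a"

definition simple_tensor ::
    "complex^'a \<Rightarrow> complex^'b \<Rightarrow> complex^'c \<Rightarrow> ('a, 'b, 'c) tensor3" where
  "simple_tensor x y z = (\<chi> i j k. x $ i * y $ j * z $ k)"

text \<open>
  The identification of \<open>\<complex>\<^sup>m \<otimes> \<complex>\<^sup>n\<close> with \<open>\<complex>\<^sup>m\<^sup>n\<close> uses pairs as indices.
\<close>

definition kronecker ::
    "('a::finite, 'b::finite, 'c::finite) tensor3 \<Rightarrow> ('d::finite, 'e::finite, 'f::finite) tensor3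
      \<Rightarrow> ('a \<times> 'd, 'b \<times> 'e, 'c \<times> 'f) tensor3"
    (infixl \<open>\<boxtimes>\<close> 70) where
  "S \<boxtimes> T = (\<chi> i j k. S $ fst i $ fst j $ fst k * T $ snd i $ snd j $ snd k)"

inductive_set polynomial_functions :: "(('a::finite, 'b::finite, 'c::finite) tensor3 \<Rightarrow> complex) set" where
  const: "(\<lambda>_. z) \<in> polynomial_functions"
| coord: "(\<lambda>T. T $ i $ j $ k) \<in> polynomial_functions"
| add: "p \<in> polynomial_functions \<Longrightarrow> q \<in> polynomial_functions
    \<Longrightarrow> (\<lambda>T. p T + q T) \<in> polynomial_functions"
| mult: "p \<in> polynomial_functions \<Longrightarrow> q \<in> polynomial_functions
    \<Longrightarrow> (\<lambda>T. p T * q T) \<in> polynomial_functions"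

definition zariski_closed :: "('a::finite, 'b::finite, 'c::finite) tensor3 set \<Rightarrow> bool" where
  "zariski_closed Z \<longleftrightarrow> (\<exists>P \<subseteq> polynomial_functions. Z = {T. \<forall>p \<in> P. p T = 0})"

definition zariski_closure :: "('a::finite, 'b::finite, 'c::finite) tensor3 set \<Rightarrow> ('a, 'b, 'c) tensor3 set" where
  "zariski_closure S = zariski_closed hull S"

definition rank_at_most :: "nat \<Rightarrow> ('a::finite, 'b::finite, 'c::finite) tensor3 set" where
  "rank_at_most r = {\<Sum>i<r. simple_tensor (x i) (y i) (z i) | x y z. True}"

definition border_rank :: "('a::finite, 'b::finite, 'c::finite) tensor3 \<Rightarrow> nat" where
  "border_rank T = (LEAST r. T \<in> zariski_closure (rank_at_most r))"

text \<open>
  Bases are families indexed by \<open>1, \<dots>, n\<close>; values outside this range are irrelevant.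
  Linear independence and span in the \<open>vec\<close> interpretation are over \<open>\<complex>\<close>,
  whereas the unqualified constants would be over the reals.
\<close>

definition is_basis :: "(nat \<Rightarrow> complex^'n) \<Rightarrow> bool" where
  "is_basis v \<longleftrightarrow> inj_on v {1..CARD('n)} \<and> vec.independent (v ` {1..CARD('n)})
     \<and> vec.span (v ` {1..CARD('n)}) = UNIV"

definition T_Leit5 ::
    "(nat \<Rightarrow> complex^5) \<Rightarrow> (nat \<Rightarrow> complex^5) \<Rightarrow> (nat \<Rightarrow> complex^5) \<Rightarrow> (5, 5, 5) tensor3" where
  "T_Leit5 a b c =
     (\<Sum>i=1..5. simple_tensor (a 1) (b i) (c i))
     + simple_tensor (a 2) (b 1) (c 3) + simple_tensor (a 2) (b 3) (c 5)
     + simple_tensor (a 3) (b 1) (c 4)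
     + simple_tensor (a 4) (b 2) (c 4)
     + simple_tensor (a 5) (b 2) (c 5)"

definition W_tensor ::
    "(nat \<Rightarrow> complex^2) \<Rightarrow> (nat \<Rightarrow> complex^2) \<Rightarrow> (nat \<Rightarrow> complex^2) \<Rightarrow> (2, 2, 2) tensor3" where
  "W_tensor a b c =
     simple_tensor (a 1) (b 1) (c 2) + simple_tensor (a 1) (b 2) (c 1)
     + simple_tensor (a 2) (b 1) (c 1)"

end

theory Submission
  imports Defs "HOL-Library.Poly_Mapping" "HOL-Computational_Algebra.Computational_Algebra"
begin

text \<open>
  Upper bound: \<open>T\<^sub>L\<^sub>e\<^sub>i\<^sub>t\<^sub>,\<^sub>5\<close> is a limit of tensors of rank 6 and \<open>W\<close> a limit of tensors of rank 2.

  Lower bound: suppose the product lies in the closure of the tensors of rank at most 11.  Over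
  the function field \<open>K\<close> of the parameters of a rank 11 decomposition, with a place \<open>r : V \<rightarrow> \<complex>\<close>,
  the tensor lifts to an integral tensor, which one extends by one dimension in each factor to a
  tensor \<open>\<Sum>\<^sub>k a\<^sub>k \<otimes> b\<^sub>k \<otimes> c\<^sub>k\<close> of size \<open>11 \<times> 11 \<times> 11\<close> with \<open>a\<close>, \<open>b\<close>, \<open>c\<close> bases.  Its slices commute
  relative to the slice of the unit, and this determines the residue of the extended tensor up
  to a column \<open>p\<close> and a row \<open>q\<close>.  The linear equations that express that multiplication by a
  generator acts diagonally on the slices, to first order around the unit tensor, have a
  396-dimensional family of solutions over \<open>K\<close>.  A solution for which 395 chosen coordinates
  vanish can be scaled to be integral with nonzero residue.  But the residue equations, together
  with the vanishing of the chosen coordinates, force everything to be zero.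
\<close>

section \<open>Places\<close>

text \<open>With eleven rank-one terms and bases in all three factors, the slices form a commutative
  algebra with one slice as unit. The ten given slices commute but are not closed under products:
  with x the slice of a_2, both x^2 and \<epsilon> x^2 lie outside their span, and only one
  dimension is added. The way out for the limit is that the corner c0 of the unit slice lies in the
  maximal ideal, so that products carry the denominator c0. The new slice becomes \<epsilon> x^2,
  while x^2 survives only as c0 x^2, whose residue is the product of p and q. Hence x has no
  integral multiplication operator, and the linear equations use the five generators \<epsilon>,
  \<epsilon> x and the slices of a_3, a_4, a_5. The dimension is 396 = 341 + 55: the tangent space
  of the orbit of the unit tensor has dimension 3 * 121 - 22, and five generators have 11
  eigenvalues each. A solution space can only grow under specialization, so 395 conditions must
  leave a nonzero residue solution. At most 337 of them are normalizations, at most 58 come from a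
  search.\<close>

definition partial_hom :: "('k::field \<times> complex) set \<Rightarrow> bool" where
  "partial_hom G \<longleftrightarrow> (1, 1) \<in> G
     \<and> (\<forall>a c b d. (a, c) \<in> G \<longrightarrow> (b, d) \<in> G \<longrightarrow> (a + b, c + d) \<in> G \<and> (a * b, c * d) \<in> G)
     \<and> (\<forall>a c. (a, c) \<in> G \<longrightarrow> (- a, - c) \<in> G)
     \<and> (\<forall>c. (0, c) \<in> G \<longrightarrow> c = 0)"

context
  fixes G :: "('k::field \<times> complex) set"
  assumes G: "partial_hom G"
begin

lemma ph_one: "(1, 1) \<in> G"
  and ph_add: "(a, c) \<in> G \<Longrightarrow> (b, d) \<in> G \<Longrightarrow> (a + b, c + d) \<in> G"
  and ph_mult: "(a, c) \<in> G \<Longrightarrow> (b, d) \<in> G \<Longrightarrow> (a * b, c * d) \<in> G"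
  and ph_minus: "(a, c) \<in> G \<Longrightarrow> (- a, - c) \<in> G"
  and ph_inj0: "(0, c) \<in> G \<Longrightarrow> c = 0"
  using G unfolding partial_hom_def by blast+

lemma ph_zero: "(0, 0) \<in> G"
  using ph_add[OF ph_one ph_minus[OF ph_one]] by simp

lemma ph_diff: "(a, c) \<in> G \<Longrightarrow> (b, d) \<in> G \<Longrightarrow> (a - b, c - d) \<in> G"
  using ph_add[of a c "- b" "- d"] ph_minus by simp

lemma ph_fun: "(a, c) \<in> G \<Longrightarrow> (a, d) \<in> G \<Longrightarrow> c = d"
  using ph_diff[of a c a d] ph_inj0 by force

lemma ph_power: "(a, c) \<in> G \<Longrightarrow> (a ^ n, c ^ n) \<in> G"
  by (induction n) (auto intro: ph_one ph_mult)

lemma ph_sum: "(\<And>i. i \<in> I \<Longrightarrow> (a i, c i) \<in> G) \<Longrightarrow> (\<Sum>i\<in>I. a i, \<Sum>i\<in>I. c i) \<in> G"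
  by (induction I rule: infinite_finite_induct) (auto intro: ph_zero ph_add)

text \<open>The homomorphism induced on polynomial rings, again as a graph. Evaluating its two sides
  at \<open>x\<close> and at \<open>z\<close> adjoins \<open>x\<close> with prescribed image
  \<open>z\<close>.\<close>

definition PM :: "('k poly \<times> complex poly) set" where
  "PM = {(f, g). \<forall>i. (coeff f i, coeff g i) \<in> G}"

lemma PM_add: "(f, g) \<in> PM \<Longrightarrow> (f', g') \<in> PM \<Longrightarrow> (f + f', g + g') \<in> PM"
  by (auto simp: PM_def intro: ph_add)

lemma PM_diff: "(f, g) \<in> PM \<Longrightarrow> (f', g') \<in> PM \<Longrightarrow> (f - f', g - g') \<in> PM"
  by (auto simp: PM_def intro: ph_diff)

lemma PM_minus: "(f, g) \<in> PM \<Longrightarrow> (- f, - g) \<in> PM"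
  by (auto simp: PM_def intro: ph_minus)

lemma PM_mult: "(f, g) \<in> PM \<Longrightarrow> (f', g') \<in> PM \<Longrightarrow> (f * f', g * g') \<in> PM"
  by (auto simp: PM_def coeff_mult intro!: ph_sum ph_mult)

lemma PM_monom: "(a, c) \<in> G \<Longrightarrow> (monom a n, monom c n) \<in> PM"
  by (auto simp: PM_def ph_zero)

lemma partial_hom_adjoin:
  assumes "\<And>f g. (f, g) \<in> PM \<Longrightarrow> poly f x = 0 \<Longrightarrow> poly g z = 0"
  shows "partial_hom {(poly f x, poly g z) | f g. (f, g) \<in> PM}"
  unfolding partial_hom_def
proof (intro conjI allI impI)
  show "(1, 1) \<in> {(poly f x, poly g z) | f g. (f, g) \<in> PM}"
    using PM_monom[OF ph_one, of 0] by (force simp: monom_0)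
  fix a c assume "(a, c) \<in> {(poly f x, poly g z) | f g. (f, g) \<in> PM}"
  then obtain f g where fg: "(f, g) \<in> PM" "a = poly f x" "c = poly g z" by blast
  show "(- a, - c) \<in> {(poly f x, poly g z) | f g. (f, g) \<in> PM}"
    using PM_minus[OF fg(1)] fg by force
  fix b d assume "(b, d) \<in> {(poly f x, poly g z) | f g. (f, g) \<in> PM}"
  then obtain f' g' where fg': "(f', g') \<in> PM" "b = poly f' x" "d = poly g' z" by blast
  show "(a + b, c + d) \<in> {(poly f x, poly g z) | f g. (f, g) \<in> PM}"
    using PM_add[OF fg(1) fg'(1)] fg fg' by force
  show "(a * b, c * d) \<in> {(poly f x, poly g z) | f g. (f, g) \<in> PM}"
    using PM_mult[OF fg(1) fg'(1)] fg fg' by force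
next
  fix c assume "(0, c) \<in> {(poly f x, poly g z) | f g. (f, g) \<in> PM}"
  then show "c = 0" using assms by force
qed

text \<open>An element of nonzero image is itself nonzero, so its powers can be inverted in the
  field. For a maximal graph this makes every element of nonzero image a unit of the domain.\<close>

lemma partial_hom_localize:
  assumes "(a, c) \<in> G" "c \<noteq> 0"
  shows "partial_hom {(b * inverse a ^ n, d * inverse c ^ n) | b d n. (b, d) \<in> G}"
    (is "partial_hom ?L")
proof -
  have a0: "a \<noteq> 0" using assms ph_inj0 by metis
  have LI: "(b, d) \<in> G \<Longrightarrow> u = b * inverse a ^ n \<Longrightarrow> v = d * inverse c ^ n \<Longrightarrow> (u, v) \<in> ?L" for b d n u v
    by blast
  show ?thesis
    unfolding partial_hom_def
  proof (intro conjI allI impI)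
    show "(1, 1) \<in> ?L" by (rule LI[OF ph_one, of _ 0]) auto
    fix u v assume "(u, v) \<in> ?L"
    then obtain b d n where 1: "(b, d) \<in> G" "u = b * inverse a ^ n" "v = d * inverse c ^ n" by blast
    show "(- u, - v) \<in> ?L" using 1 by (intro LI[OF ph_minus[OF 1(1)], of _ n]) auto
    fix u' v' assume "(u', v') \<in> ?L"
    then obtain b' d' n' where 2: "(b', d') \<in> G" "u' = b' * inverse a ^ n'" "v' = d' * inverse c ^ n'" by blast
    show "(u + u', v + v') \<in> ?L"
      using 1 2 a0 assms(2)
      by (intro LI[of "b * a ^ n' + b' * a ^ n" "d * c ^ n' + d' * c ^ n" _ "n + n'"])
         (auto intro!: ph_add ph_mult ph_power assms simp: field_simps power_add)
    show "(u * u', v * v') \<in> ?L"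
      using 1 2 by (intro LI[OF ph_mult[OF 1(1) 2(1)], of _ "n + n'"]) (auto simp: power_add)
  next
    fix v assume "(0, v) \<in> ?L"
    then obtain b d n where "(b, d) \<in> G" "0 = b * inverse a ^ n" "v = d * inverse c ^ n" by blast
    then show "v = 0" using a0 ph_inj0 by auto
  qed
qed

end

text \<open>Homomorphisms are kept as graphs for the sake of this step: extension is inclusion, and
  the union of a chain is its upper bound in Zorn's lemma.\<close>

lemma partial_hom_Union:
  assumes "C \<in> chains {G. partial_hom G \<and> G0 \<subseteq> G}" "C \<noteq> {}"
  shows "partial_hom (\<Union>C)"
proof -
  have ph: "\<And>G. G \<in> C \<Longrightarrow> partial_hom G" using assms(1) by (auto simp: chains_def)
  have ch: "\<And>G H. G \<in> C \<Longrightarrow> H \<in> C \<Longrightarrow> G \<subseteq> H \<or> H \<subseteq> G"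
    using assms(1) by (auto simp: chains_def chain_subset_def)
  have two: "\<exists>G\<in>C. p \<in> G \<and> q \<in> G" if "p \<in> \<Union>C" "q \<in> \<Union>C" for p q
    using that ch by (meson UnionE in_mono)
  show ?thesis
    unfolding partial_hom_def
  proof (intro conjI allI impI)
    show "(1, 1) \<in> \<Union>C" using assms(2) ph ph_one by blast
    fix a c assume *: "(a, c) \<in> \<Union>C"
    then show "(- a, - c) \<in> \<Union>C" using ph ph_minus by blast
    fix b d assume "(b, d) \<in> \<Union>C"
    from two[OF * this] obtain G where "G \<in> C" "(a, c) \<in> G" "(b, d) \<in> G" by blast
    then show "(a + b, c + d) \<in> \<Union>C" "(a * b, c * d) \<in> \<Union>C"
      using ph[of G] ph_add[of G] ph_mult[of G] by blast+
  next
    fix c assume "(0, c) \<in> \<Union>C"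
    then show "c = 0" using ph ph_inj0 by blast
  qed
qed

text \<open>
  A maximal partial homomorphism into an algebraically closed field is defined on a valuation ring
  (Chevalley's extension theorem).
\<close>

lemma place_exists:
  fixes G0 :: "('k::field \<times> complex) set"
  assumes "partial_hom G0"
  obtains G where "G0 \<subseteq> G" "partial_hom G" "\<And>x. x \<notin> Domain G \<Longrightarrow> (inverse x, 0) \<in> G"
proof -
  let ?A = "{G. partial_hom G \<and> G0 \<subseteq> G}"
  have "\<exists>M\<in>?A. \<forall>X\<in>?A. M \<subseteq> X \<longrightarrow> X = M"
  proof (rule Zorn_Lemma2, intro ballI)
    fix C assume C: "C \<in> chains ?A"
    show "\<exists>U\<in>?A. \<forall>X\<in>C. X \<subseteq> U"
    proof (cases "C = {}")
      case True then show ?thesis using assms by auto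
    next
      case False
      then have "G0 \<subseteq> \<Union>C" using C by (auto simp: chains_def)
      then show ?thesis using partial_hom_Union[OF C False] by blast
    qed
  qed
  then obtain M where M: "partial_hom M" "G0 \<subseteq> M"
    and max: "\<And>X. partial_hom X \<Longrightarrow> M \<subseteq> X \<Longrightarrow> X = M" by (metis (no_types, lifting) mem_Collect_eq subset_trans)
  note one = ph_one[OF M(1)] and add = ph_add[OF M(1)] and mult = ph_mult[OF M(1)]
    and zero = ph_zero[OF M(1)] and inj0 = ph_inj0[OF M(1)] and diff = ph_diff[OF M(1)]
  have inv: "(inverse a, inverse c) \<in> M" if "(a, c) \<in> M" "c \<noteq> 0" for a c
  proof -
    let ?L = "{(b * inverse a ^ n, d * inverse c ^ n) | b d n. (b, d) \<in> M}"
    have "M \<subseteq> ?L"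
    proof
      fix p assume "p \<in> M"
      then have "(fst p, snd p) \<in> M" by simp
      then have "(fst p * inverse a ^ 0, snd p * inverse c ^ 0) \<in> ?L" by blast
      then show "p \<in> ?L" by simp
    qed
    then have "?L = M" using max partial_hom_localize[OF M(1) that] by blast
    moreover have "(1 * inverse a ^ 1, 1 * inverse c ^ 1) \<in> ?L" using one by blast
    ultimately show ?thesis by simp
  qed
  \<comment> \<open>These are the relations of \<open>x\<close> congruent to 1 modulo the maximal
    ideal: the constant coefficient has residue 1, all others have residue 0.\<close>
  define R where "R x f \<longleftrightarrow> poly f x = 0 \<and> (f, 1) \<in> PM M" for x :: 'k and f
  have dich: "\<exists>f. R x f" if x: "x \<notin> Domain M" for x
  proof -
    define I where "I = {g. \<exists>f. (f, g) \<in> PM M \<and> poly f x = 0}"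
    \<comment> \<open>A common root \<open>z\<close> of the residues of all relations of
      \<open>x\<close> would allow the extension that sends \<open>x\<close> to \<open>z\<close>,
      against maximality.\<close>
    have notgood: "\<exists>g\<in>I. poly g z \<noteq> 0" for z
    proof (rule ccontr)
      assume "\<not> ?thesis"
      then have g: "\<And>f g. (f, g) \<in> PM M \<Longrightarrow> poly f x = 0 \<Longrightarrow> poly g z = 0" by (auto simp: I_def)
      let ?L = "{(poly f x, poly g z) | f g. (f, g) \<in> PM M}"
      have "M \<subseteq> ?L"
      proof
        fix p assume "p \<in> M"
        then show "p \<in> ?L"
          using PM_monom[OF M(1), of "fst p" "snd p" 0] by (cases p) (force simp: monom_0)
      qed
      moreover have "partial_hom ?L" by (rule partial_hom_adjoin[OF M(1)]) (rule g)
      ultimately have "?L = M" by (intro max)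
      moreover have "(poly (monom 1 1) x, poly (monom 1 1) z) \<in> ?L"
        using PM_monom[OF M(1) one, of 1] by blast
      ultimately show False using x by (auto simp: poly_monom)
    qed
    then obtain g1 where "g1 \<in> I" "g1 \<noteq> 0" by (metis poly_0)
    then obtain g0 where g0: "g0 \<in> I" "g0 \<noteq> 0"
      and min: "\<And>g. g \<in> I \<Longrightarrow> g \<noteq> 0 \<Longrightarrow> degree g0 \<le> degree g"
      using ex_has_least_nat[of "\<lambda>g. g \<in> I \<and> g \<noteq> 0" g1 degree] by blast
    obtain f0 where f0: "(f0, g0) \<in> PM M" "poly f0 x = 0" using g0 by (auto simp: I_def)
    have lc: "(coeff f0 (degree g0), lead_coeff g0) \<in> M" using f0 by (auto simp: PM_def[OF M(1)])
    have ilc: "(inverse (coeff f0 (degree g0)), inverse (lead_coeff g0)) \<in> M"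
      using inv[OF lc] g0 by auto
    \<comment> \<open>The leading coefficient of \<open>g0\<close> is the residue of a unit of the
      domain, so each step of the division by \<open>g0\<close> lifts to relations of
      \<open>x\<close>.\<close>
    have dvd: "g0 dvd g" if "g \<in> I" for g
      using that
    proof (induction "degree g" arbitrary: g rule: less_induct)
      case less
      show ?case
      proof (cases "g = 0")
        case False
        then have le: "degree g0 \<le> degree g" using min less by blast
        obtain f where f: "(f, g) \<in> PM M" "poly f x = 0" using less by (auto simp: I_def)
        define k where "k = degree g - degree g0"
        define q where "q = monom (lead_coeff g * inverse (lead_coeff g0)) k"
        define q' where "q' = monom (coeff f (degree g) * inverse (coeff f0 (degree g0))) k"
        have "(q', q) \<in> PM M" unfolding q_def q'_def
          using f ilc by (intro PM_monom[OF M(1)] mult) (auto simp: PM_def[OF M(1)])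
        then have "(f - q' * f0, g - q * g0) \<in> PM M"
          by (intro PM_diff[OF M(1)] PM_mult[OF M(1)] f f0)
        then have mem: "g - q * g0 \<in> I" using f f0 by (force simp: I_def)
        have q: "q \<noteq> 0" "degree (q * g0) = degree g"
          using False g0 le by (auto simp: q_def degree_mult_eq degree_monom_eq k_def monom_eq_0_iff)
        have "coeff (q * g0) (degree g) = lead_coeff g"
          using g0 le by (simp add: q_def coeff_monom_mult k_def)
        note q = q this
        have "g - q * g0 = 0 \<or> degree (g - q * g0) < degree g"
        proof -
          have "coeff (g - q * g0) (degree g) = 0" using q by simp
          moreover have "degree (g - q * g0) \<le> degree g" using q by (simp add: degree_diff_le)
          ultimately show ?thesis
            by (metis leading_coeff_0_iff le_neq_implies_less)
        qed
        then have "g0 dvd g - q * g0" using less(1)[OF _ mem] by auto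
        then show ?thesis using dvd_diffD1 dvd_triv_right by (metis diff_add_cancel dvd_add)
      qed auto
    qed
    \<comment> \<open>A root of the common divisor \<open>g0\<close> would be a common root. Here
      the complex numbers have to be algebraically closed.\<close>
    have "degree g0 = 0"
    proof (rule ccontr)
      assume "degree g0 \<noteq> 0"
      then obtain z where "poly g0 z = 0"
        using fundamental_theorem_of_algebra[of g0] constant_degree[of g0] by auto
      then show False using notgood[of z] dvd by (metis dvdE mult_zero_left poly_mult)
    qed
    then obtain c where c: "g0 = [:c:]" "c \<noteq> 0" using g0(2) by (metis degree_eq_zeroE pCons_0_0)
    have "(coeff f0 0, c) \<in> M" using f0 c by (auto simp: PM_def[OF M(1)] dest: spec[of _ 0])
    from inv[OF this c(2)]
    have "(monom (inverse (coeff f0 0)) 0 * f0, monom (inverse c) 0 * g0) \<in> PM M"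
      by (intro PM_mult[OF M(1)] PM_monom[OF M(1)] f0)
    moreover have "monom (inverse c) 0 * g0 = 1" using c by (simp add: monom_0 one_pCons)
    ultimately show ?thesis unfolding R_def using f0(2)
      by (intro exI[of _ "monom (inverse (coeff f0 0)) 0 * f0"]) simp
  qed
  have c0: "(coeff f 0, 1) \<in> M" and ci: "i \<noteq> 0 \<Longrightarrow> (coeff f i, 0) \<in> M" if "R x f" for x f i
  proof -
    have "\<And>j. (coeff f j, coeff 1 j) \<in> M" using that by (auto simp: R_def PM_def[OF M(1)])
    from this[of 0] this[of i] show "(coeff f 0, 1) \<in> M" "i \<noteq> 0 \<Longrightarrow> (coeff f i, 0) \<in> M" by auto
  qed
  \<comment> \<open>Multiplied by a power of \<open>x\<close>, the relation \<open>h\<close> of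
    \<open>inverse x\<close> becomes the reversed polynomial, with unit leading coefficient
    \<open>b\<close> and all other coefficients of residue 0. As \<open>coeff f n\<close> has
    residue 0, cancelling the top term of \<open>f\<close> by a multiple of it leaves a relation of
    the same kind and of smaller degree.\<close>
  have no: False
    if x: "x \<noteq> 0" and f: "R x f" and h: "R (inverse x) h" and le: "degree h \<le> degree f"
      and min: "\<And>f'. R x f' \<Longrightarrow> degree f \<le> degree f'" for x f h
  proof -
    define n where "n = degree f"
    define m where "m = degree h"
    define b where "b = coeff h 0"
    have b: "(b, 1) \<in> M" using c0[OF h] by (simp add: b_def)
    then have ib: "(inverse b, 1) \<in> M" and b0: "b \<noteq> 0" using inv[of b 1] inj0[of 1] by auto
    have n0: "n \<noteq> 0"
    proof
      assume "n = 0"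
      then obtain a where "f = [:a:]" unfolding n_def using degree_eq_zeroE by blast
      then show False using f c0[OF f] inj0[of 1] by (auto simp: R_def)
    qed
    have an: "(coeff f n * inverse b, 0) \<in> M" using mult[OF ci[OF f n0] ib] by simp
    define q where "q = monom (coeff f n * inverse b) (n - m)"
    have coe: "\<exists>c. (coeff (reflect_poly h) i, c) \<in> M" for i
    proof -
      have "\<exists>c. (coeff h j, c) \<in> M" for j using c0[OF h] ci[OF h] by (cases "j = 0") blast+
      then show ?thesis using zero by (auto simp: coeff_reflect_poly)
    qed
    then obtain cc where cc: "\<And>i. (coeff (reflect_poly h) i, cc i) \<in> M" by metis
    have coe2: "(coeff (q * reflect_poly h) i, 0) \<in> M" for i
    proof -
      have "coeff (q * reflect_poly h) i
        = (if n - m \<le> i then coeff f n * inverse b * coeff (reflect_poly h) (i - (n - m)) else 0)"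
        by (simp add: q_def coeff_monom_mult)
      then show ?thesis using mult[OF an cc] zero by auto
    qed
    have "R x (f - q * reflect_poly h)"
      unfolding R_def
    proof
      show "poly (f - q * reflect_poly h) x = 0"
        using f h x by (simp add: R_def poly_reflect_poly_nz)
      show "(f - q * reflect_poly h, 1) \<in> PM M"
        unfolding PM_def[OF M(1)]
      proof safe
        fix i
        have "(coeff f i - coeff (q * reflect_poly h) i, coeff 1 i - 0) \<in> M"
          using f coe2 by (intro diff) (auto simp: R_def PM_def[OF M(1)])
        then show "(coeff (f - q * reflect_poly h) i, coeff 1 i) \<in> M" by simp
      qed
    qed
    from min[OF this] have "n \<le> degree (f - q * reflect_poly h)" by (simp add: n_def)
    moreover have "degree (q * reflect_poly h) \<le> n"
    proof -
      have "degree (q * reflect_poly h) \<le> degree q + degree (reflect_poly h)" by (rule degree_mult_le)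
      also have "\<dots> \<le> (n - m) + m"
        unfolding m_def by (intro add_mono) (auto simp: q_def degree_monom_le degree_reflect_poly_le m_def)
      finally show ?thesis using le by (simp add: n_def m_def)
    qed
    then have "degree (f - q * reflect_poly h) \<le> n" by (simp add: degree_diff_le n_def)
    moreover have "coeff (f - q * reflect_poly h) n = 0"
      using le b0 by (simp add: q_def coeff_monom_mult n_def m_def coeff_reflect_poly b_def)
    ultimately have "f - q * reflect_poly h = 0" by (metis leading_coeff_0_iff le_antisym)
    then show False using n0 \<open>n \<le> degree (f - q * reflect_poly h)\<close> by simp
  qed
  show ?thesis
  proof (rule that[OF M(2) M(1)])
    fix x assume x: "x \<notin> Domain M"
    then have x0: "x \<noteq> 0" using zero by blast
    have "inverse x \<in> Domain M"
    proof (rule ccontr)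
      assume ix: "inverse x \<notin> Domain M"
      obtain f where f: "R x f" and fm: "\<And>f'. R x f' \<Longrightarrow> degree f \<le> degree f'"
        using dich[OF x] ex_has_least_nat[of "R x" _ degree] by blast
      obtain h where h: "R (inverse x) h" and hm: "\<And>f'. R (inverse x) f' \<Longrightarrow> degree h \<le> degree f'"
        using dich[OF ix] ex_has_least_nat[of "R (inverse x)" _ degree] by blast
      show False
      proof (cases "degree h \<le> degree f")
        case True then show ?thesis using no[OF x0 f h] fm by blast
      next
        case False
        then show ?thesis using no[of "inverse x" h f] x0 f h hm by auto
      qed
    qed
    then obtain c where c: "(inverse x, c) \<in> M" by blast
    have "c = 0" using inv[OF c] x by force
    then show "(inverse x, 0) \<in> M" using c by simp
  qed
qed

section \<open>Linear algebra over a field with a place\<close>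

lemma hom_system:
  fixes M :: "'j \<Rightarrow> 'i \<Rightarrow> 'k::field"
  assumes "finite J" "finite I" "card J < card I"
  shows "\<exists>x. (\<exists>i\<in>I. x i \<noteq> 0) \<and> (\<forall>j\<in>J. (\<Sum>i\<in>I. M j i * x i) = 0)"
  using assms
proof (induction J arbitrary: I M rule: finite_induct)
  case empty
  then have "I \<noteq> {}" by auto
  then show ?case by (intro exI[of _ "\<lambda>_. 1"]) auto
next
  case (insert j J)
  show ?case
  proof (cases "\<forall>i\<in>I. M j i = 0")
    case True
    have "card J < card I" using insert by simp
    from insert.IH[OF insert.prems(1) this, of M] obtain x where
      "\<exists>i\<in>I. x i \<noteq> 0" "\<forall>j\<in>J. (\<Sum>i\<in>I. M j i * x i) = 0" by blast
    moreover have "(\<Sum>i\<in>I. M j i * x i) = 0" using True by (intro sum.neutral) auto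
    ultimately show ?thesis by (intro exI[of _ x]) simp
  next
    case False
    then obtain i0 where i0: "i0 \<in> I" "M j i0 \<noteq> 0" by blast
    let ?I = "I - {i0}"
    \<comment> \<open>Equation \<open>j\<close> is solved for the unknown \<open>i0\<close> and
      substituted into the others.\<close>
    let ?M = "\<lambda>j' i. M j' i - M j' i0 * M j i / M j i0"
    have "card J < card ?I" using insert i0 by auto
    from insert.IH[OF _ this, of ?M] insert.prems(1)
    obtain x where x: "\<exists>i\<in>?I. x i \<noteq> 0" "\<And>j'. j' \<in> J \<Longrightarrow> (\<Sum>i\<in>?I. ?M j' i * x i) = 0" by blast
    define s where "s = (\<Sum>i\<in>?I. M j i * x i)"
    define y where "y = x(i0 := - s / M j i0)"
    have y: "(\<Sum>i\<in>I. M j' i * y i) = M j' i0 * (- s / M j i0) + (\<Sum>i\<in>?I. M j' i * x i)" for j'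
    proof -
      have "(\<Sum>i\<in>I. M j' i * y i) = M j' i0 * y i0 + (\<Sum>i\<in>?I. M j' i * y i)"
        by (rule sum.remove) (use insert i0 in auto)
      also have "(\<Sum>i\<in>?I. M j' i * y i) = (\<Sum>i\<in>?I. M j' i * x i)"
        by (rule sum.cong) (auto simp: y_def)
      finally show ?thesis by (simp add: y_def)
    qed
    show ?thesis
    proof (intro exI[of _ y] conjI ballI)
      show "\<exists>i\<in>I. y i \<noteq> 0" using x(1) by (auto simp: y_def)
      fix j' assume "j' \<in> insert j J"
      then consider "j' = j" | "j' \<in> J" by blast
      then show "(\<Sum>i\<in>I. M j' i * y i) = 0"
      proof cases
        case 1 then show ?thesis using y[of j] i0 by (simp add: s_def)
      next
        case 2
        have "0 = (\<Sum>i\<in>?I. M j' i * x i) - (\<Sum>i\<in>?I. M j' i0 / M j i0 * (M j i * x i))"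
          using x(2)[OF 2] by (simp add: algebra_simps sum_subtractf)
        also have "(\<Sum>i\<in>?I. M j' i0 / M j i0 * (M j i * x i)) = M j' i0 / M j i0 * s"
          by (simp add: s_def sum_distrib_left)
        finally show ?thesis using y[of j'] by (simp add: algebra_simps)
      qed
    qed
  qed
qed

text \<open>The target \<open>\<mu>\<close> is joined to the vectors as one more unknown,
  \<open>None\<close>. The system then has a nontrivial solution, and independence forbids that the
  coefficient of \<open>\<mu>\<close> is zero.\<close>

lemma basis_spans:
  fixes a :: "'n::finite \<Rightarrow> 'n \<Rightarrow> 'k::field"
  assumes "\<And>\<kappa>. (\<And>k. (\<Sum>g\<in>UNIV. \<kappa> g * a g k) = 0) \<Longrightarrow> \<kappa> = (\<lambda>_. 0)"
  obtains n where "\<And>k. \<mu> k = (\<Sum>g\<in>UNIV. n g * a g k)"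
proof -
  let ?M = "\<lambda>k g. case g of None \<Rightarrow> \<mu> k | Some g \<Rightarrow> a g k"
  have "card (UNIV :: 'n set) < card (UNIV :: 'n option set)" by (simp add: card_UNIV_option)
  from hom_system[OF _ _ this, of ?M] obtain x where
    x: "\<exists>i. x i \<noteq> 0" "\<And>k. (\<Sum>i\<in>UNIV. ?M k i * x i) = 0" by auto
  have eq: "\<mu> k * x None + (\<Sum>g\<in>UNIV. x (Some g) * a g k) = 0" for k
    using x(2)[of k] by (simp add: UNIV_option_conv sum.reindex mult.commute)
  have "x None \<noteq> 0"
  proof
    assume 0: "x None = 0"
    then have "(\<lambda>g. x (Some g)) = (\<lambda>_. 0)" using eq by (intro assms) simp
    then have "x i = 0" for i using 0 by (cases i) (auto simp: fun_eq_iff)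
    then show False using x(1) by blast
  qed
  then have "\<mu> k = (\<Sum>g\<in>UNIV. (- x (Some g) / x None) * a g k)" for k
  proof -
    have "(\<Sum>g\<in>UNIV. (- x (Some g) / x None) * a g k) = - (\<Sum>g\<in>UNIV. x (Some g) * a g k) / x None"
      by (simp add: sum_divide_distrib sum_negf)
    also have "(\<Sum>g\<in>UNIV. x (Some g) * a g k) = - (\<mu> k * x None)"
      using eq[of k] by (simp add: add_eq_0_iff)
    also have "- (- (\<mu> k * x None)) / x None = \<mu> k" using \<open>x None \<noteq> 0\<close> by simp
    finally show ?thesis by simp
  qed
  then show ?thesis by (rule that[of "\<lambda>g. - x (Some g) / x None"])
qed

section \<open>Valuation rings with complex residues: scaling, and lifting of independence\<close>

locale place =
  fixes V :: "'k::field set" and r :: "'k \<Rightarrow> complex"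
  assumes V_1[simp]: "1 \<in> V" and r_1[simp]: "r 1 = 1"
    and V_add[simp]: "x \<in> V \<Longrightarrow> y \<in> V \<Longrightarrow> x + y \<in> V"
    and r_add[simp]: "x \<in> V \<Longrightarrow> y \<in> V \<Longrightarrow> r (x + y) = r x + r y"
    and V_mult[simp]: "x \<in> V \<Longrightarrow> y \<in> V \<Longrightarrow> x * y \<in> V"
    and r_mult[simp]: "x \<in> V \<Longrightarrow> y \<in> V \<Longrightarrow> r (x * y) = r x * r y"
    and V_minus[simp]: "x \<in> V \<Longrightarrow> - x \<in> V"
    and V_notin: "x \<notin> V \<Longrightarrow> inverse x \<in> V \<and> r (inverse x) = 0"
    and r_surj: "\<exists>v\<in>V. r v = c"
begin

lemma V_0[simp]: "0 \<in> V" using V_add[OF V_1 V_minus[OF V_1]] by simp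

lemma r_0[simp]: "r 0 = 0" using r_add[OF V_0 V_0] by simp

lemma r_minus[simp]: "x \<in> V \<Longrightarrow> r (- x) = - r x"
  using r_add[of x "- x"] by (simp add: eq_neg_iff_add_eq_0 add.commute)

lemma V_diff[simp]: "x \<in> V \<Longrightarrow> y \<in> V \<Longrightarrow> x - y \<in> V"
  using V_add[of x "- y"] by simp

lemma r_diff[simp]: "x \<in> V \<Longrightarrow> y \<in> V \<Longrightarrow> r (x - y) = r x - r y"
  using r_add[of x "- y"] by simp

lemma V_sum[simp, intro]: "(\<And>i. i \<in> I \<Longrightarrow> f i \<in> V) \<Longrightarrow> sum f I \<in> V"
  by (induction I rule: infinite_finite_induct) auto

lemma r_sum[simp]: "(\<And>i. i \<in> I \<Longrightarrow> f i \<in> V) \<Longrightarrow> r (sum f I) = (\<Sum>i\<in>I. r (f i))"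
  by (induction I rule: infinite_finite_induct) auto

lemma V_inverse: "x \<in> V \<Longrightarrow> r x \<noteq> 0 \<Longrightarrow> inverse x \<in> V"
  and r_inverse: "x \<in> V \<Longrightarrow> r x \<noteq> 0 \<Longrightarrow> r (inverse x) = inverse (r x)"
proof -
  assume x: "x \<in> V" "r x \<noteq> 0"
  have x0: "x \<noteq> 0" using x by auto
  show *: "inverse x \<in> V"
  proof (rule ccontr)
    assume "inverse x \<notin> V"
    from V_notin[OF this] show False using x by simp
  qed
  have "r x * r (inverse x) = 1" using r_mult[OF x(1) *] x0 by simp
  then show "r (inverse x) = inverse (r x)" by (simp add: inverse_unique)
qed

text \<open>Divide by an entry of least valuation. Such an entry is found one index at a time,
  because of a quotient and its inverse at least one is integral.\<close>

lemma scale: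
  assumes "finite I" "i1 \<in> I" "v i1 \<noteq> 0"
  obtains s where "s \<noteq> 0" "\<And>i. i \<in> I \<Longrightarrow> s * v i \<in> V" "\<exists>i\<in>I. r (s * v i) \<noteq> 0"
proof -
  have "\<exists>i0\<in>I. v i0 \<noteq> 0 \<and> (\<forall>i\<in>I. v i / v i0 \<in> V)"
    using assms
  proof (induction I arbitrary: i1 rule: finite_induct)
    case (insert j I)
    show ?case
    proof (cases "\<exists>i\<in>I. v i \<noteq> 0")
      case True
      then obtain i0 where i0: "i0 \<in> I" "v i0 \<noteq> 0" "\<forall>i\<in>I. v i / v i0 \<in> V" using insert.IH by blast
      show ?thesis
      proof (cases "v j / v i0 \<in> V")
        case True then show ?thesis using i0 by auto
      next
        case False
        then have nz: "v j \<noteq> 0" by auto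
        have 1: "v i0 / v j \<in> V" using V_notin[OF False] by simp
        have "(v i / v i0) * (v i0 / v j) \<in> V" if "i \<in> I" for i using i0 that 1 by (intro V_mult) auto
        then have "\<forall>i\<in>I. v i / v j \<in> V" using i0 by simp
        then show ?thesis using nz by (intro bexI[of _ j]) auto
      qed
    next
      case False
      then show ?thesis using insert.prems by (intro bexI[of _ j]) auto
    qed
  qed auto
  then obtain i0 where i0: "i0 \<in> I" "v i0 \<noteq> 0" "\<forall>i\<in>I. v i / v i0 \<in> V" by blast
  show ?thesis
  proof (rule that[of "inverse (v i0)"])
    show "\<exists>i\<in>I. r (inverse (v i0) * v i) \<noteq> 0" using i0 by (intro bexI[of _ i0]) auto
  qed (use i0 in \<open>auto simp: divide_inverse mult.commute\<close>)
qed

text \<open>If some coefficient is not integral, then the factor that makes all of them integral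
  with a nonzero residue has residue 0 itself. Scaling the integral sum by it gives a nontrivial
  relation between the residues.\<close>

lemma integral_coeffs:
  fixes w :: "'i::finite \<Rightarrow> 'd \<Rightarrow> 'k"
  assumes w: "\<And>i d. w i d \<in> V"
    and ind: "\<And>\<mu>. (\<And>d. (\<Sum>i\<in>UNIV. \<mu> i * r (w i d)) = 0) \<Longrightarrow> \<mu> = (\<lambda>_. 0)"
    and int: "\<And>d. (\<Sum>i\<in>UNIV. \<kappa> i * w i d) \<in> V"
  shows "\<kappa> i \<in> V"
proof (rule ccontr)
  assume i: "\<kappa> i \<notin> V"
  then have "\<kappa> i \<noteq> 0" by auto
  then obtain s where s: "s \<noteq> 0" "\<And>i. s * \<kappa> i \<in> V" "\<exists>i. r (s * \<kappa> i) \<noteq> 0"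
    using scale[of UNIV i \<kappa>] by auto
  have "(s * \<kappa> i) * inverse (\<kappa> i) = s" using \<open>\<kappa> i \<noteq> 0\<close> by (simp add: mult.assoc)
  moreover have "(s * \<kappa> i) * inverse (\<kappa> i) \<in> V" "r ((s * \<kappa> i) * inverse (\<kappa> i)) = 0"
    using V_notin[OF i] s(2)[of i] V_mult r_mult by auto
  ultimately have s0: "s \<in> V" "r s = 0" by metis+
  have "(\<lambda>i. r (s * \<kappa> i)) = (\<lambda>_. 0)"
  proof (rule ind)
    fix d
    have "(\<Sum>i\<in>UNIV. r (s * \<kappa> i) * r (w i d)) = r (\<Sum>i\<in>UNIV. (s * \<kappa> i) * w i d)"
      using s w by simp
    also have "(\<Sum>i\<in>UNIV. (s * \<kappa> i) * w i d) = s * (\<Sum>i\<in>UNIV. \<kappa> i * w i d)"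
      by (simp add: sum_distrib_left mult.assoc)
    finally show "(\<Sum>i\<in>UNIV. r (s * \<kappa> i) * r (w i d)) = 0" using s0 int by simp
  qed
  then show False using s(3) by (auto simp: fun_eq_iff)
qed

lemma residue_independent:
  fixes w :: "'i::finite \<Rightarrow> 'd \<Rightarrow> 'k"
  assumes w: "\<And>i d. w i d \<in> V"
    and ind: "\<And>\<mu>. (\<And>d. (\<Sum>i\<in>UNIV. \<mu> i * r (w i d)) = 0) \<Longrightarrow> \<mu> = (\<lambda>_. 0)"
    and zero: "\<And>d. (\<Sum>i\<in>UNIV. \<kappa> i * w i d) = 0"
  shows "\<kappa> = (\<lambda>_. 0)"
proof (rule ccontr)
  assume "\<kappa> \<noteq> (\<lambda>_. 0)"
  then obtain i where "\<kappa> i \<noteq> 0" by auto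
  then obtain s where s: "s \<noteq> 0" "\<And>i. s * \<kappa> i \<in> V" "\<exists>i. r (s * \<kappa> i) \<noteq> 0"
    using scale[of UNIV i \<kappa>] by auto
  have "(\<lambda>i. r (s * \<kappa> i)) = (\<lambda>_. 0)"
  proof (rule ind)
    fix d
    have "(\<Sum>i\<in>UNIV. r (s * \<kappa> i) * r (w i d)) = r (\<Sum>i\<in>UNIV. (s * \<kappa> i) * w i d)"
      using s w by simp
    also have "(\<Sum>i\<in>UNIV. (s * \<kappa> i) * w i d) = s * (\<Sum>i\<in>UNIV. \<kappa> i * w i d)"
      by (simp add: sum_distrib_left mult.assoc)
    finally show "(\<Sum>i\<in>UNIV. r (s * \<kappa> i) * r (w i d)) = 0" using zero by simp
  qed
  then show False using s(3) by (auto simp: fun_eq_iff)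
qed

text \<open>The \<open>w k\<close> are one more in number than the slices. Asking a combination
  \<open>t\<close> of them to vanish at one pivot per slice leaves a nonzero solution, which is
  scaled to be integral with nonzero residue.\<close>

lemma extend_slices:
  fixes w :: "'m::finite option \<Rightarrow> 'd::finite \<Rightarrow> 'k" and \<alpha> :: "'m \<Rightarrow> 'm option \<Rightarrow> 'k" and \<pi> :: "'m \<Rightarrow> 'd"
  assumes ind: "\<And>\<kappa>. (\<And>d. (\<Sum>k\<in>UNIV. \<kappa> k * w k d) = 0) \<Longrightarrow> \<kappa> = (\<lambda>_. 0)"
    and int: "\<And>i d. (\<Sum>k\<in>UNIV. \<alpha> i k * w k d) \<in> V"
    and piv: "\<And>i i'. r (\<Sum>k\<in>UNIV. \<alpha> i k * w k (\<pi> i')) = (if i = i' then 1 else 0)"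
  obtains t where "\<And>d. (\<Sum>k\<in>UNIV. t k * w k d) \<in> V" "\<exists>d. r (\<Sum>k\<in>UNIV. t k * w k d) \<noteq> 0"
    "\<And>i. (\<Sum>k\<in>UNIV. t k * w k (\<pi> i)) = 0"
    "\<And>\<kappa>. (\<And>k. (\<Sum>g\<in>UNIV. \<kappa> g * (case g of None \<Rightarrow> t k | Some i \<Rightarrow> \<alpha> i k)) = 0) \<Longrightarrow> \<kappa> = (\<lambda>_. 0)"
proof -
  have "card (UNIV :: 'm set) < card (UNIV :: 'm option set)" by (simp add: card_UNIV_option)
  from hom_system[OF _ _ this, of "\<lambda>i k. w k (\<pi> i)"]
  obtain t0 where t0: "\<exists>k. t0 k \<noteq> 0" "\<And>i. (\<Sum>k\<in>UNIV. t0 k * w k (\<pi> i)) = 0"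
    by (auto simp: mult.commute)
  obtain d1 where "(\<Sum>k\<in>UNIV. t0 k * w k d1) \<noteq> 0" using ind[of t0] t0(1) by (auto simp: fun_eq_iff)
  then obtain s where s: "s \<noteq> 0" "\<And>d. s * (\<Sum>k\<in>UNIV. t0 k * w k d) \<in> V"
    "\<exists>d. r (s * (\<Sum>k\<in>UNIV. t0 k * w k d)) \<noteq> 0"
    using scale[of UNIV d1 "\<lambda>d. \<Sum>k\<in>UNIV. t0 k * w k d"] by auto
  define t where "t k = s * t0 k" for k
  have t: "(\<Sum>k\<in>UNIV. t k * w k d) = s * (\<Sum>k\<in>UNIV. t0 k * w k d)" for d
    by (simp add: t_def sum_distrib_left mult.assoc)
  show ?thesis
  proof (rule that[of t])
    fix \<kappa> assume z: "\<And>k. (\<Sum>g\<in>UNIV. \<kappa> g * (case g of None \<Rightarrow> t k | Some i \<Rightarrow> \<alpha> i k)) = 0"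
    then have z': "\<kappa> None * t k + (\<Sum>i\<in>UNIV. \<kappa> (Some i) * \<alpha> i k) = 0" for k
      by (simp add: UNIV_option_conv sum.reindex)
    have e: "\<kappa> None * (\<Sum>k\<in>UNIV. t k * w k d) + (\<Sum>i\<in>UNIV. \<kappa> (Some i) * (\<Sum>k\<in>UNIV. \<alpha> i k * w k d)) = 0" for d
    proof -
      have "(\<Sum>i\<in>UNIV. \<kappa> (Some i) * (\<Sum>k\<in>UNIV. \<alpha> i k * w k d))
          = (\<Sum>k\<in>UNIV. (\<Sum>i\<in>UNIV. \<kappa> (Some i) * \<alpha> i k) * w k d)"
        unfolding sum_distrib_left sum_distrib_right by (subst sum.swap) (simp add: mult.assoc)
      moreover have "\<kappa> None * (\<Sum>k\<in>UNIV. t k * w k d) = (\<Sum>k\<in>UNIV. \<kappa> None * t k * w k d)"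
        by (simp add: sum_distrib_left mult.assoc)
      ultimately show ?thesis using z' by (simp flip: sum.distrib distrib_right)
    qed
    \<comment> \<open>At the pivots the new slice vanishes and the old ones reduce to the identity
      matrix, so the old coefficients go first.\<close>
    have "(\<lambda>i. \<kappa> (Some i)) = (\<lambda>_. 0)"
    proof (rule residue_independent[of "\<lambda>i d. \<Sum>k\<in>UNIV. \<alpha> i k * w k (\<pi> d)"])
      fix \<mu> :: "'m \<Rightarrow> complex"
      assume "\<And>d. (\<Sum>i\<in>UNIV. \<mu> i * r (\<Sum>k\<in>UNIV. \<alpha> i k * w k (\<pi> d))) = 0"
      then have "(\<Sum>i\<in>UNIV. \<mu> i * (if i = d then 1 else 0)) = 0" for d by (simp only: piv)
      then show "\<mu> = (\<lambda>_. 0)" by (simp add: fun_eq_iff if_distrib[of "(*) _"] cong: if_cong)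
    qed (use int e t t0 in \<open>auto simp: add_eq_0_iff\<close>)
    then have s0: "\<kappa> (Some i) = 0" for i by (auto simp: fun_eq_iff)
    have "\<kappa> None = 0"
    proof (rule ccontr)
      assume "\<kappa> None \<noteq> 0"
      then have "(\<Sum>k\<in>UNIV. t k * w k d) = 0" for d using e[of d] s0 by simp
      then have "s * (\<Sum>k\<in>UNIV. t0 k * w k d) = 0" for d using t by metis
      then show False using s(3) by (metis r_0)
    qed
    then have "\<kappa> g = 0" for g using s0 by (cases g) auto
    then show "\<kappa> = (\<lambda>_. 0)" by auto
  qed (use s t t0 in auto)
qed

end

section \<open>A generic tensor of rank at most 11 specializing to a tensor in the closure\<close>

type_synonym mpoly = "(nat \<Rightarrow>\<^sub>0 nat) \<Rightarrow>\<^sub>0 complex"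

definition monom_val :: "(nat \<Rightarrow> complex) \<Rightarrow> (nat \<Rightarrow>\<^sub>0 nat) \<Rightarrow> complex" where
  "monom_val x m = (\<Prod>v\<in>Poly_Mapping.keys m. x v ^ Poly_Mapping.lookup m v)"

definition mpoly_val :: "(nat \<Rightarrow> complex) \<Rightarrow> mpoly \<Rightarrow> complex" where
  "mpoly_val x p = (\<Sum>m\<in>Poly_Mapping.keys p. Poly_Mapping.lookup p m * monom_val x m)"

lemma monom_val_superset:
  "finite S \<Longrightarrow> Poly_Mapping.keys m \<subseteq> S \<Longrightarrow> monom_val x m = (\<Prod>v\<in>S. x v ^ Poly_Mapping.lookup m v)"
  unfolding monom_val_def by (rule prod.mono_neutral_left) (auto simp: in_keys_iff)

lemma mpoly_val_superset:
  "finite S \<Longrightarrow> Poly_Mapping.keys p \<subseteq> S \<Longrightarrow> mpoly_val x p = (\<Sum>m\<in>S. Poly_Mapping.lookup p m * monom_val x m)"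
  unfolding mpoly_val_def by (rule sum.mono_neutral_left) (auto simp: in_keys_iff)

lemma monom_val_add: "monom_val x (m + n) = monom_val x m * monom_val x n"
proof -
  let ?S = "Poly_Mapping.keys m \<union> Poly_Mapping.keys n"
  have "monom_val x (m + n) = (\<Prod>v\<in>?S. x v ^ Poly_Mapping.lookup (m + n) v)"
    by (rule monom_val_superset) (simp_all add: Poly_Mapping.keys_add)
  also have "\<dots> = monom_val x m * monom_val x n"
    using monom_val_superset[of ?S m x] monom_val_superset[of ?S n x]
    by (simp add: lookup_add power_add prod.distrib)
  finally show ?thesis .
qed

lemma mpoly_val_add: "mpoly_val x (p + q) = mpoly_val x p + mpoly_val x q"
proof -
  let ?S = "Poly_Mapping.keys p \<union> Poly_Mapping.keys q"
  have "mpoly_val x (p + q) = (\<Sum>m\<in>?S. Poly_Mapping.lookup (p + q) m * monom_val x m)"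
    by (rule mpoly_val_superset) (simp_all add: Poly_Mapping.keys_add)
  also have "\<dots> = mpoly_val x p + mpoly_val x q"
    using mpoly_val_superset[of ?S p x] mpoly_val_superset[of ?S q x]
    by (simp add: lookup_add algebra_simps sum.distrib)
  finally show ?thesis .
qed

lemma mpoly_val_zero [simp]: "mpoly_val x 0 = 0"
  by (simp add: mpoly_val_def)

lemma mpoly_val_sum: "mpoly_val x (sum f I) = (\<Sum>i\<in>I. mpoly_val x (f i))"
  by (induction I rule: infinite_finite_induct) (auto simp: mpoly_val_add)

lemma mpoly_val_single: "mpoly_val x (Poly_Mapping.single m c) = c * monom_val x m"
  by (cases "c = 0") (auto simp: mpoly_val_def)

lemma mpoly_expand:
  fixes p :: mpoly
  shows "p = (\<Sum>m\<in>Poly_Mapping.keys p. Poly_Mapping.single m (Poly_Mapping.lookup p m))"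
proof (rule poly_mapping_eqI)
  fix k
  show "Poly_Mapping.lookup p k
    = Poly_Mapping.lookup (\<Sum>m\<in>Poly_Mapping.keys p. Poly_Mapping.single m (Poly_Mapping.lookup p m)) k"
    by (auto simp: lookup_sum lookup_single when_def in_keys_iff)
qed

lemma mpoly_val_mult: "mpoly_val x (p * q) = mpoly_val x p * mpoly_val x q"
proof -
  have "p * q = (\<Sum>m\<in>Poly_Mapping.keys p. \<Sum>n\<in>Poly_Mapping.keys q.
      Poly_Mapping.single (m + n) (Poly_Mapping.lookup p m * Poly_Mapping.lookup q n))"
    by (subst mpoly_expand[of p], subst mpoly_expand[of q]) (simp add: sum_product mult_single)
  then have "mpoly_val x (p * q) = (\<Sum>m\<in>Poly_Mapping.keys p. \<Sum>n\<in>Poly_Mapping.keys q.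
      Poly_Mapping.lookup p m * Poly_Mapping.lookup q n * (monom_val x m * monom_val x n))"
    by (simp add: mpoly_val_sum mpoly_val_single monom_val_add)
  then show ?thesis
    by (simp add: mpoly_val_def[of x p] mpoly_val_def[of x q] sum_product algebra_simps)
qed

lemma mpoly_val_one [simp]: "mpoly_val x 1 = 1"
  unfolding single_one[symmetric] mpoly_val_single by (simp add: monom_val_def)

lemma mpoly_val_minus: "mpoly_val x (- p) = - mpoly_val x p"
  using mpoly_val_add[of x p "- p"] by (simp add: eq_neg_iff_add_eq_0 add.commute)

lemma mpoly_val_prod: "mpoly_val x (prod f I) = (\<Prod>i\<in>I. mpoly_val x (f i))"
  by (induction I rule: infinite_finite_induct) (auto simp: mpoly_val_mult)

definition mvar :: "nat \<Rightarrow> mpoly" where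
  "mvar v = Poly_Mapping.single (Poly_Mapping.single v 1) 1"

lemma mpoly_val_mvar [simp]: "mpoly_val x (mvar v) = x v"
  by (simp add: mvar_def mpoly_val_single monom_val_def)

lemma mpoly_val_det: "mpoly_val x (det (A :: mpoly^'n^'n)) = det (\<chi> i j. mpoly_val x (A $ i $ j))"
proof -
  have "mpoly_val x (of_int (sign p)) = of_int (sign p)" for p :: "'n \<Rightarrow> 'n"
    by (simp add: sign_def mpoly_val_minus)
  then show ?thesis
    by (simp add: det_def mpoly_val_sum mpoly_val_mult mpoly_val_prod)
qed

lemma to_fract_prod: "to_fract (prod f A) = prod (\<lambda>x. to_fract (f x)) A"
  by (induction A rule: infinite_finite_induct) simp_all

lemma to_fract_det: "to_fract (det (A :: 'a::idom^'n^'n)) = det (\<chi> i j. to_fract (A $ i $ j))"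
proof -
  have "to_fract (of_int (sign p) :: 'a) = of_int (sign p)" for p :: "'n \<Rightarrow> 'n"
    by (simp add: sign_def)
  then show ?thesis
    by (simp add: det_def to_fract_prod)
qed

lemma det_nonzero_ker:
  fixes A :: "'k::field^'n^'n"
  assumes "det A \<noteq> 0" "\<And>l. (\<Sum>k\<in>UNIV. \<kappa> k * A $ k $ l) = 0"
  shows "\<kappa> = (\<lambda>_. 0)"
proof -
  have "transpose A *v (\<chi> k. \<kappa> k) = 0"
    using assms(2) by (simp add: vec_eq_iff matrix_vector_mult_def transpose_def mult.commute)
  moreover have "invertible (transpose A)" using assms(1) by (simp add: invertible_det_nz)
  then have "\<forall>x. transpose A *v x = 0 \<longrightarrow> x = 0"
    using matrix_left_invertible_ker invertible_left_inverse by blast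
  ultimately have "(\<chi> k. \<kappa> k) = 0" by blast
  then show ?thesis by (auto simp: vec_eq_iff)
qed

text \<open>Syntax instead of functions, because the same polynomial is evaluated over the function
  field and over the complex numbers.\<close>

datatype 'i pexp = Const complex | Var 'i 'i 'i | Add "'i pexp" "'i pexp" | Mult "'i pexp" "'i pexp"

primrec pexp_val :: "(complex \<Rightarrow> 'k::comm_ring_1) \<Rightarrow> ('i \<Rightarrow> 'i \<Rightarrow> 'i \<Rightarrow> 'k) \<Rightarrow> 'i pexp \<Rightarrow> 'k" where
  "pexp_val h t (Const c) = h c"
| "pexp_val h t (Var g i j) = t g i j"
| "pexp_val h t (Add e e') = pexp_val h t e + pexp_val h t e'"
| "pexp_val h t (Mult e e') = pexp_val h t e * pexp_val h t e'"

definition mconst :: "complex \<Rightarrow> mpoly" where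
  "mconst c = Poly_Mapping.single 0 c"

lemma mconst_simps: "mconst 0 = 0" "mconst 1 = 1" "mconst (a + b) = mconst a + mconst b"
    "mconst (a * b) = mconst a * mconst b" "mconst (- a) = - mconst a" "mpoly_val x (mconst a) = a"
  by (auto simp: mconst_def single_add mult_single mpoly_val_single monom_val_def single_uminus)

text \<open>\<open>'i option\<close> indexes the rank-one terms, so the hypothesis says that
  \<open>\<tau>\<close> lies in the closure of the tensors of rank at most one more than the size of
  \<open>'i\<close>. The place extends the specialization of the generic such tensor to
  \<open>\<tau>\<close>, whereas nothing is said about the images of the parameters
  themselves.\<close>

lemma place_of_closure:
  fixes \<tau> :: "'i::{finite,countable} \<Rightarrow> 'i \<Rightarrow> 'i \<Rightarrow> complex"
  assumes \<tau>: "\<And>e. (\<And>x y z :: 'i option \<Rightarrow> 'i \<Rightarrow> complex.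
        pexp_val id (\<lambda>g i j. \<Sum>k\<in>UNIV. x k g * y k i * z k j) e = 0) \<Longrightarrow> pexp_val id \<tau> e = 0"
    and card: "CARD('i) > 1"
  obtains V :: "mpoly fract set" and r \<alpha> \<beta> \<gamma> where "place V r"
    "\<And>g i j. (\<Sum>k\<in>UNIV. \<alpha> k g * \<beta> k i * \<gamma> k j) \<in> V"
    "\<And>g i j. r (\<Sum>k\<in>UNIV. \<alpha> k g * \<beta> k i * \<gamma> k j) = \<tau> g i j"
    "\<And>k g. \<alpha> (k :: 'i option) g \<noteq> 0"
    "\<And>\<kappa>. (\<And>i j. (\<Sum>k\<in>UNIV. \<kappa> k * (\<beta> k i * \<gamma> k j)) = 0) \<Longrightarrow> \<kappa> = (\<lambda>_. 0)"
proof -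
  define v :: "nat \<Rightarrow> 'i option \<Rightarrow> 'i \<Rightarrow> mpoly" where "v s k i = mvar (to_nat (s, k, i))" for s k i
  define t where "t g i j = (\<Sum>k\<in>UNIV. v 0 k g * v 1 k i * v 2 k j)" for g i j
  define tK where "tK g i j = to_fract (t g i j)" for g i j
  define h where "h c = to_fract (mconst c)" for c
  define G0 where "G0 = {(pexp_val h tK e, pexp_val id \<tau> e) | e. True}"
  have pK: "pexp_val h tK e = to_fract (pexp_val mconst t e)" for e
    by (induction e) (auto simp: h_def tK_def)
  have pv: "mpoly_val w (pexp_val mconst t e) = pexp_val id (\<lambda>g i j. mpoly_val w (t g i j)) e" for w e
    by (induction e) (auto simp: mconst_simps mpoly_val_add mpoly_val_mult)
  \<comment> \<open>This makes \<open>G0\<close> single valued: a polynomial vanishing at the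
    generic tensor vanishes at every specialization of the parameters, hence at
    \<open>\<tau>\<close>.\<close>
  have key: "pexp_val id \<tau> e = 0" if "pexp_val h tK e = 0" for e
  proof (rule \<tau>)
    fix x y z :: "'i option \<Rightarrow> 'i \<Rightarrow> complex"
    define w :: "nat \<Rightarrow> complex" where "w n = (case from_nat n :: nat \<times> 'i option \<times> 'i of
       (s, k, i) \<Rightarrow> (if s = 0 then x k i else if s = 1 then y k i else z k i))" for n
    have "pexp_val mconst t e = 0" using that pK by simp
    then have "pexp_val id (\<lambda>g i j. mpoly_val w (t g i j)) e = 0" using pv[of w e] by simp
    moreover have "(\<lambda>g i j. mpoly_val w (t g i j)) = (\<lambda>g i j. \<Sum>k\<in>UNIV. x k g * y k i * z k j)"
      by (simp add: fun_eq_iff t_def v_def mpoly_val_sum mpoly_val_mult w_def)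
    ultimately show "pexp_val id (\<lambda>g i j. \<Sum>k\<in>UNIV. x k g * y k i * z k j) e = 0" by simp
  qed
  have "partial_hom G0"
    unfolding partial_hom_def
  proof (intro conjI allI impI)
    show "(1, 1) \<in> G0" unfolding G0_def
      by (auto intro!: exI[of _ "Const 1"] simp: h_def mconst_simps)
    fix a c assume "(a, c) \<in> G0"
    then obtain e where e: "a = pexp_val h tK e" "c = pexp_val id \<tau> e" by (auto simp: G0_def)
    show "(- a, - c) \<in> G0" unfolding G0_def
      by (auto intro!: exI[of _ "Mult (Const (- 1)) e"] simp: h_def mconst_simps e)
    fix b d assume "(b, d) \<in> G0"
    then obtain e' where e': "b = pexp_val h tK e'" "d = pexp_val id \<tau> e'" by (auto simp: G0_def)
    show "(a + b, c + d) \<in> G0" unfolding G0_def by (auto intro!: exI[of _ "Add e e'"] simp: e e')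
    show "(a * b, c * d) \<in> G0" unfolding G0_def by (auto intro!: exI[of _ "Mult e e'"] simp: e e')
  next
    fix c assume "(0, c) \<in> G0"
    then obtain e where "pexp_val h tK e = 0" "c = pexp_val id \<tau> e" by (auto simp: G0_def)
    then show "c = 0" using key by simp
  qed
  from place_exists[OF this] obtain G where G: "G0 \<subseteq> G" "partial_hom G"
    "\<And>x. x \<notin> Domain G \<Longrightarrow> (inverse x, 0) \<in> G" by blast
  define r where "r x = (THE c. (x, c) \<in> G)" for x
  have r: "r x = c" if "(x, c) \<in> G" for x c
    unfolding r_def using that ph_fun[OF G(2)] by (intro the_equality) blast+
  have rG: "x \<in> Domain G \<Longrightarrow> (x, r x) \<in> G" for x using r by blast
  have hG: "(h c, c) \<in> G" for c
  proof -
    have "(pexp_val h tK (Const c), pexp_val id \<tau> (Const c)) \<in> G0" unfolding G0_def by blast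
    then show ?thesis using G(1) by auto
  qed
  have tG: "(tK g i j, \<tau> g i j) \<in> G" for g i j
  proof -
    have "(pexp_val h tK (Var g i j), pexp_val id \<tau> (Var g i j)) \<in> G0" unfolding G0_def by blast
    then show ?thesis using G(1) by auto
  qed
  have pl: "place (Domain G) r"
  proof
    show "(1 :: mpoly fract) \<in> Domain G" "r 1 = 1" using ph_one[OF G(2)] r by blast+
    show "\<exists>v\<in>Domain G. r v = c" for c using hG[of c] r by blast
    show "x \<notin> Domain G \<Longrightarrow> inverse x \<in> Domain G \<and> r (inverse x) = 0" for x
      using G(3) r by blast
    fix x y assume "x \<in> Domain G" "y \<in> Domain G"
    then have x: "(x, r x) \<in> G" and y: "(y, r y) \<in> G" using rG by blast+
    show "x + y \<in> Domain G" "r (x + y) = r x + r y" using ph_add[OF G(2) x y] r by blast+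
    show "x * y \<in> Domain G" "r (x * y) = r x * r y" using ph_mult[OF G(2) x y] r by blast+
    show "- x \<in> Domain G" using ph_minus[OF G(2) x] by blast
  qed
  show ?thesis
  proof (rule that[of "Domain G" r "\<lambda>k g. to_fract (v 0 k g)" "\<lambda>k i. to_fract (v 1 k i)" "\<lambda>k j. to_fract (v 2 k j)"])
    fix g i j
    have "(\<Sum>k\<in>UNIV. to_fract (v 0 k g) * to_fract (v 1 k i) * to_fract (v 2 k j)) = tK g i j"
      by (simp add: tK_def t_def)
    then show "(\<Sum>k\<in>UNIV. to_fract (v 0 k g) * to_fract (v 1 k i) * to_fract (v 2 k j)) \<in> Domain G"
      "r (\<Sum>k\<in>UNIV. to_fract (v 0 k g) * to_fract (v 1 k i) * to_fract (v 2 k j)) = \<tau> g i j"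
      using tG[of g i j] r by force+
  next
    fix k g
    have "mpoly_val (\<lambda>_. 1) (v 0 k g) = 1" by (simp add: v_def)
    then show "to_fract (v 0 k g) \<noteq> 0" by (metis mpoly_val_zero to_fract_eq_0_iff zero_neq_one)
  next
    fix \<kappa>
    assume \<kappa>: "\<And>i j. (\<Sum>k\<in>UNIV. \<kappa> k * (to_fract (v 1 k i) * to_fract (v 2 k j))) = 0"
    have "CARD('i option) \<le> CARD('i \<times> 'i)"
    proof -
      have "Suc n \<le> n * n" if "n > 1" for n :: nat
        using that mult_le_mono1[of 2 n n] by linarith
      then show ?thesis using card by (simp add: card_UNIV_option)
    qed
    then obtain d :: "'i option \<Rightarrow> 'i \<times> 'i" where d: "inj d"
      using card_le_inj[of "UNIV :: 'i option set" "UNIV :: ('i \<times> 'i) set"] by auto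
    \<comment> \<open>A maximal minor of the matrix of all products of \<open>\<beta>\<close> and
      \<open>\<gamma>\<close>. The injection \<open>d\<close> gives every term its own position, and
      the point \<open>w\<close> specializes the minor to the identity.\<close>
    define N :: "mpoly^'i option^'i option" where "N = (\<chi> k l. v 1 k (fst (d l)) * v 2 k (snd (d l)))"
    define w :: "nat \<Rightarrow> complex" where "w n = (case from_nat n :: nat \<times> 'i option \<times> 'i of
       (s, k, i) \<Rightarrow> (if s = 1 then of_bool (i = fst (d k)) else of_bool (i = snd (d k))))" for n
    have "mpoly_val w (N $ k $ l) = (if k = l then 1 else 0)" for k l
      using injD[OF d, of k l] by (auto simp: N_def mpoly_val_mult v_def w_def prod_eq_iff)
    then have "mpoly_val w (det N) = det (mat 1 :: complex^'i option^'i option)"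
      by (simp add: mpoly_val_det mat_def)
    then have "det N \<noteq> 0" by auto
    then have "det (\<chi> k l. to_fract (N $ k $ l)) \<noteq> 0" by (simp flip: to_fract_det)
    then show "\<kappa> = (\<lambda>_. 0)"
    proof (rule det_nonzero_ker)
      show "(\<Sum>k\<in>UNIV. \<kappa> k * (\<chi> k l. to_fract (N $ k $ l)) $ k $ l) = 0" for l
        using \<kappa>[of "fst (d l)" "snd (d l)"] by (simp add: N_def)
    qed
  qed (rule pl)
qed

section \<open>The coordinates of the Kronecker product\<close>

datatype five = E1 | E2 | E3 | E4 | E5

lemma UNIV_five: "UNIV = {E1, E2, E3, E4, E5}"
  using five.exhaust by auto

instance five :: finite
  by standard (simp add: UNIV_five)

instance five :: countable
  by countable_datatype

type_synonym idx = "five \<times> bool"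

definition leit :: "five \<Rightarrow> five \<Rightarrow> five \<Rightarrow> complex" where
  "leit g i j = of_bool (case g of E1 \<Rightarrow> i = j | E2 \<Rightarrow> (i, j) = (E1, E3) \<or> (i, j) = (E3, E5)
     | E3 \<Rightarrow> (i, j) = (E1, E4) | E4 \<Rightarrow> (i, j) = (E2, E4) | E5 \<Rightarrow> (i, j) = (E2, E5))"

text \<open>Multiplication by 1 and by \<epsilon> in the dual numbers. This is \<open>W\<close> with
  the two basis vectors of the third factor exchanged, which turns its first slice into the
  identity.\<close>

definition dual :: "bool \<Rightarrow> bool \<Rightarrow> bool \<Rightarrow> complex" where
  "dual g s t = of_bool (if g then \<not> s \<and> t else s = t)"

definition std :: "idx \<Rightarrow> idx \<Rightarrow> idx \<Rightarrow> complex" where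
  "std g i j = leit (fst g) (fst i) (fst j) * dual (snd g) (snd i) (snd j)"

text \<open>At \<open>piv k\<close> the slice \<open>k\<close> has entry 1 and the other slices have
  entry 0, so coefficients can be read off there. The position (E1, E5) is avoided, since it carries
  the products that leave the span of the slices.\<close>

fun piv :: "five \<Rightarrow> five \<times> five" where
  "piv E1 = (E5, E5)" | "piv E2 = (E3, E5)" | "piv E3 = (E1, E4)" | "piv E4 = (E2, E4)" | "piv E5 = (E2, E5)"

definition pivot :: "idx \<Rightarrow> idx \<times> idx" where
  "pivot g = ((fst (piv (fst g)), False), (snd (piv (fst g)), snd g))"

lemma std_pivot: "std g (fst (pivot g')) (snd (pivot g')) = (if g = g' then 1 else 0)"
  by (cases g; cases g'; cases "fst g"; cases "fst g'") (auto simp: std_def pivot_def leit_def dual_def)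

abbreviation one_idx :: idx where "one_idx \<equiv> (E1, False)"

lemma std_one: "std one_idx i j = (if i = j then 1 else 0)"
  by (auto simp: std_def leit_def dual_def prod_eq_iff)

section \<open>Square tensors, the unit slice and the extension by one dimension\<close>

definition tens :: "('n::finite \<Rightarrow> 'g \<Rightarrow> 'k::field) \<Rightarrow> ('n \<Rightarrow> 'i \<Rightarrow> 'k) \<Rightarrow> ('n \<Rightarrow> 'j \<Rightarrow> 'k) \<Rightarrow> 'g \<Rightarrow> 'i \<Rightarrow> 'j \<Rightarrow> 'k" where
  "tens a b c g i j = (\<Sum>k\<in>UNIV. a k g * b k i * c k j)"

definition rows_indep :: "('n::finite \<Rightarrow> 'n \<Rightarrow> 'k::field) \<Rightarrow> bool" where
  "rows_indep a \<longleftrightarrow> (\<forall>\<kappa>. (\<forall>k. (\<Sum>g\<in>UNIV. \<kappa> g * a k g) = 0) \<longrightarrow> \<kappa> = (\<lambda>_. 0))"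

lemma rows_indepD: "rows_indep a \<Longrightarrow> (\<And>k. (\<Sum>g\<in>UNIV. \<kappa> g * a k g) = 0) \<Longrightarrow> \<kappa> = (\<lambda>_. 0)"
  unfolding rows_indep_def by blast

lemma rows_indep_spans:
  assumes "rows_indep a"
  obtains n where "\<And>k. \<mu> k = (\<Sum>g\<in>UNIV. n g * a k g)"
  using basis_spans[of "\<lambda>g k. a k g" \<mu>] rows_indepD[OF assms] by metis

text \<open>The array is square, so its rows span, and the indicator of \<open>k\<close> is a
  combination of them; pairing it with \<open>\<kappa>\<close> extracts
  \<open>\<kappa> k\<close>.\<close>

lemma rows_indep_columns:
  assumes "rows_indep a" "\<And>g. (\<Sum>k\<in>UNIV. \<kappa> k * a k g) = 0"
  shows "\<kappa> k = 0"
proof -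
  obtain n where n: "\<And>k'. of_bool (k' = k) = (\<Sum>g\<in>UNIV. n g * a k' g)"
    using rows_indep_spans[OF assms(1), of "\<lambda>k'. of_bool (k' = k)"] by blast
  have "\<kappa> k = (\<Sum>k'\<in>UNIV. \<kappa> k' * of_bool (k' = k))" by simp
  also have "\<dots> = (\<Sum>k'\<in>UNIV. \<Sum>g\<in>UNIV. n g * (\<kappa> k' * a k' g))"
    unfolding n by (simp add: sum_distrib_left mult.left_commute)
  also have "\<dots> = (\<Sum>g\<in>UNIV. n g * (\<Sum>k'\<in>UNIV. \<kappa> k' * a k' g))"
    unfolding sum_distrib_left by (rule sum.swap)
  finally show ?thesis using assms(2) by simp
qed

context place
begin

text \<open>The slice \<open>g0\<close> reduces to the identity, so it has an integral inverse
  \<open>n\<close>, again congruent to the identity. Multiplying the third factor by it makes the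
  slice exactly the identity and changes no residue.\<close>

lemma normalize_unit_slice:
  fixes \<alpha> \<beta> \<gamma> :: "'n::finite \<Rightarrow> 'm::finite \<Rightarrow> 'k"
  assumes int: "\<And>g i j. tens \<alpha> \<beta> \<gamma> g i j \<in> V"
    and one: "\<And>i j. r (tens \<alpha> \<beta> \<gamma> g0 i j) = (if i = j then 1 else 0)"
    and ind: "\<And>\<kappa>. (\<And>i j. (\<Sum>k\<in>UNIV. \<kappa> k * (\<beta> k i * \<gamma> k j)) = 0) \<Longrightarrow> \<kappa> = (\<lambda>_. 0)"
  obtains \<gamma>' where "\<And>g i j. tens \<alpha> \<beta> \<gamma>' g i j \<in> V"
    "\<And>g i j. r (tens \<alpha> \<beta> \<gamma>' g i j) = r (tens \<alpha> \<beta> \<gamma> g i j)"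
    "\<And>i j. tens \<alpha> \<beta> \<gamma>' g0 i j = (if i = j then 1 else 0)"
    "\<And>\<kappa>. (\<And>i j. (\<Sum>k\<in>UNIV. \<kappa> k * (\<beta> k i * \<gamma>' k j)) = 0) \<Longrightarrow> \<kappa> = (\<lambda>_. 0)"
proof -
  let ?t = "tens \<alpha> \<beta> \<gamma>"
  have delta: "(\<Sum>i\<in>UNIV. \<mu> i * (if d = i then 1 else 0)) = \<mu> d"
      "(\<Sum>i\<in>UNIV. \<mu> i * (if i = d then 1 else 0)) = \<mu> d" for \<mu> :: "'m \<Rightarrow> complex" and d
    by (simp_all add: if_distrib[of "(*) _"] cong: if_cong)
  have res: "\<mu> = (\<lambda>_. 0)" if "\<And>d. (\<Sum>i\<in>UNIV. \<mu> i * r (?t g0 d i)) = 0" for \<mu>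
    using that by (simp add: one delta fun_eq_iff)
  have "\<exists>n. \<forall>i. (if i = j then 1 else 0) = (\<Sum>j'\<in>UNIV. n j' * ?t g0 i j')" for j
  proof -
    obtain n where "\<And>i. (if i = j then 1 else 0) = (\<Sum>j'\<in>UNIV. n j' * ?t g0 i j')"
    proof (rule basis_spans[of "\<lambda>j' i. ?t g0 i j'" "\<lambda>i. if i = j then 1 else 0"])
      fix \<kappa> assume "\<And>k. (\<Sum>g\<in>UNIV. \<kappa> g * ?t g0 k g) = 0"
      then show "\<kappa> = (\<lambda>_. 0)" using int res
        by (intro residue_independent[of "\<lambda>j' i. ?t g0 i j'"]) auto
    qed blast
    then show ?thesis by blast
  qed
  then obtain n where n: "\<And>i j. (\<Sum>j'\<in>UNIV. n j j' * ?t g0 i j') = (if i = j then 1 else 0)" by metis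
  have nV: "n j j' \<in> V" for j j'
  proof (rule integral_coeffs[of "\<lambda>j' i. ?t g0 i j'"])
    show "(\<Sum>j'\<in>UNIV. n j j' * ?t g0 i j') \<in> V" for i unfolding n by simp
  qed (use int res in auto)
  have rn: "r (n j j') = (if j' = j then 1 else 0)" for j j'
  proof -
    have "(if j' = j then 1 else 0) = r (\<Sum>l\<in>UNIV. n j l * ?t g0 j' l)" by (simp add: n)
    also have "\<dots> = (\<Sum>l\<in>UNIV. r (n j l) * (if j' = l then 1 else 0))" using nV int by (simp add: one)
    finally show ?thesis by (simp add: delta)
  qed
  define \<gamma>' where "\<gamma>' k j = (\<Sum>j'\<in>UNIV. \<gamma> k j' * n j j')" for k j
  have push: "(\<Sum>k\<in>UNIV. \<kappa> k * (\<beta> k i * \<gamma>' k j)) = (\<Sum>j'\<in>UNIV. (\<Sum>k\<in>UNIV. \<kappa> k * (\<beta> k i * \<gamma> k j')) * n j j')" for \<kappa> i j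
    unfolding \<gamma>'_def sum_distrib_left sum_distrib_right by (subst sum.swap) (simp add: mult.assoc)
  have t': "tens \<alpha> \<beta> \<gamma>' g i j = (\<Sum>j'\<in>UNIV. ?t g i j' * n j j')" for g i j
    using push[of "\<lambda>k. \<alpha> k g" i j] by (simp add: tens_def mult.assoc)
  show ?thesis
  proof (rule that[of \<gamma>'])
    show "tens \<alpha> \<beta> \<gamma>' g i j \<in> V" for g i j unfolding t' using int nV by auto
    show "r (tens \<alpha> \<beta> \<gamma>' g i j) = r (?t g i j)" for g i j
    proof -
      have "r (\<Sum>j'\<in>UNIV. ?t g i j' * n j j') = (\<Sum>j'\<in>UNIV. r (?t g i j') * (if j' = j then 1 else 0))"
        using int nV by (simp add: rn)
      then show ?thesis unfolding t' by (simp only: delta)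
    qed
    show "tens \<alpha> \<beta> \<gamma>' g0 i j = (if i = j then 1 else 0)" for i j
      unfolding t' using n[of j i] by (simp add: mult.commute)
    fix \<kappa> assume z: "\<And>i j. (\<Sum>k\<in>UNIV. \<kappa> k * (\<beta> k i * \<gamma>' k j)) = 0"
    have "(\<Sum>k\<in>UNIV. \<kappa> k * (\<beta> k i * \<gamma> k j)) = 0" for i j
    proof -
      have "(\<lambda>j'. \<Sum>k\<in>UNIV. \<kappa> k * (\<beta> k i * \<gamma> k j')) = (\<lambda>_. 0)"
      proof (rule residue_independent[of "\<lambda>j' j. n j j'"])
        fix \<mu> assume "\<And>d. (\<Sum>i\<in>UNIV. \<mu> i * r (n d i)) = 0"
        then show "\<mu> = (\<lambda>_. 0)" by (simp add: rn delta fun_eq_iff)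
      qed (use nV z push in auto)
      then show ?thesis by (rule fun_cong)
    qed
    then show "\<kappa> = (\<lambda>_. 0)" by (rule ind)
  qed
qed

text \<open>An instance of \<open>extend_slices\<close> for the matrices formed from
  \<open>a k\<close> and \<open>\<gamma> k\<close>, with the columns of \<open>\<beta>\<close> as
  slices. The pivots are the positions of the unit slice, which is why the extended unit slice gets
  a zero border.\<close>

lemma extend_side:
  fixes a :: "'m::finite option \<Rightarrow> 'm option \<Rightarrow> 'k" and \<beta> \<gamma> :: "'m option \<Rightarrow> 'm \<Rightarrow> 'k"
  assumes a: "rows_indep a"
    and \<gamma>: "\<And>k. \<exists>j. \<gamma> k j \<noteq> 0"
    and int: "\<And>g i j. tens a \<beta> \<gamma> g i j \<in> V"
    and one: "\<And>i j. tens a \<beta> \<gamma> g0 i j = (if i = j then 1 else 0)"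
  obtains t where "rows_indep (\<lambda>k. case_option (t k) (\<beta> k))"
    "\<And>g j. (\<Sum>k\<in>UNIV. a k g * t k * \<gamma> k j) \<in> V"
    "\<exists>g j. r (\<Sum>k\<in>UNIV. a k g * t k * \<gamma> k j) \<noteq> 0"
    "\<And>j. (\<Sum>k\<in>UNIV. a k g0 * t k * \<gamma> k j) = 0"
proof -
  let ?w = "\<lambda>k (g, j). a k g * \<gamma> k j"
  have e: "(\<Sum>k\<in>UNIV. u k * ?w k (g, j)) = (\<Sum>k\<in>UNIV. a k g * u k * \<gamma> k j)" for u g j
    by (simp add: algebra_simps)
 obtain t where t: "\<And>d. (\<Sum>k\<in>UNIV. t k * ?w k d) \<in> V" "\<exists>d. r (\<Sum>k\<in>UNIV. t k * ?w k d) \<noteq> 0"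
    "\<And>i. (\<Sum>k\<in>UNIV. t k * ?w k (g0, i)) = 0"
    "\<And>\<kappa>. (\<And>k. (\<Sum>g\<in>UNIV. \<kappa> g * (case g of None \<Rightarrow> t k | Some i \<Rightarrow> \<beta> k i)) = 0) \<Longrightarrow> \<kappa> = (\<lambda>_. 0)"
  proof (rule extend_slices[of ?w "\<lambda>i k. \<beta> k i" "\<lambda>i. (g0, i)"])
    fix \<kappa> assume z: "\<And>d. (\<Sum>k\<in>UNIV. \<kappa> k * ?w k d) = 0"
    have "\<kappa> k = 0" for k
    proof -
      obtain j where j: "\<gamma> k j \<noteq> 0" using \<gamma> by blast
      have "\<kappa> k * \<gamma> k j = 0"
      proof (rule rows_indep_columns[OF a])
        show "(\<Sum>k\<in>UNIV. \<kappa> k * \<gamma> k j * a k g) = 0" for g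
          using z[of "(g, j)"] by (simp add: algebra_simps)
      qed
      then show ?thesis using j by simp
    qed
    then show "\<kappa> = (\<lambda>_. 0)" by auto
  next
    fix i d
    have "(\<Sum>k\<in>UNIV. \<beta> k i * ?w k d) = tens a \<beta> \<gamma> (fst d) i (snd d)"
      by (cases d) (simp only: e tens_def fst_conv snd_conv)
    then show "(\<Sum>k\<in>UNIV. \<beta> k i * ?w k d) \<in> V" using int by simp
  next
    fix i i'
    have "(\<Sum>k\<in>UNIV. \<beta> k i * ?w k (g0, i')) = tens a \<beta> \<gamma> g0 i i'" by (simp only: e tens_def)
    then show "r (\<Sum>k\<in>UNIV. \<beta> k i * ?w k (g0, i')) = (if i = i' then 1 else 0)" using one by simp
  qed (blast intro: that)
  show ?thesis
  proof (rule that[of t])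
    show "rows_indep (\<lambda>k. case_option (t k) (\<beta> k))"
      unfolding rows_indep_def using t(4) by blast
    show "(\<Sum>k\<in>UNIV. a k g * t k * \<gamma> k j) \<in> V" for g j using t(1)[of "(g, j)"] by (simp only: e)
    obtain g j where "r (\<Sum>k\<in>UNIV. t k * ?w k (g, j)) \<noteq> 0" using t(2) by auto
    then show "\<exists>g j. r (\<Sum>k\<in>UNIV. a k g * t k * \<gamma> k j) \<noteq> 0" unfolding e by blast
    show "(\<Sum>k\<in>UNIV. a k g0 * t k * \<gamma> k j) = 0" for j using t(3)[of j] by (simp only: e)
  qed
qed

end

section \<open>Products of the ten slices\<close>

definition e15 :: "bool \<Rightarrow> idx \<Rightarrow> idx \<Rightarrow> complex" where
  "e15 g i j = of_bool (fst i = E1 \<and> fst j = E5) * dual g (snd i) (snd j)"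

definition mm :: "('i \<Rightarrow> 'm::finite \<Rightarrow> 'k::field) \<Rightarrow> ('m \<Rightarrow> 'j \<Rightarrow> 'k) \<Rightarrow> 'i \<Rightarrow> 'j \<Rightarrow> 'k" where
  "mm A B i j = (\<Sum>m\<in>UNIV. A i m * B m j)"

text \<open>Among the slices other than the identity only the square of the second one is nonzero;
  it is the matrix unit at (E1, E5). With the dual numbers as second factor,
  \<open>e15 False\<close> is x^2 and \<open>e15 True\<close> is x y, where y = \<epsilon>
  x.\<close>

lemma leit_mult: "(\<Sum>m\<in>UNIV. leit g i m * leit h m j) =
    (if g = E1 then leit h i j else if h = E1 then leit g i j
     else of_bool (g = E2 \<and> h = E2 \<and> i = E1 \<and> j = E5))"
  unfolding UNIV_five by (cases g; cases h; cases i; cases j) (simp_all add: leit_def)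

lemma dual_mult: "(\<Sum>t\<in>UNIV. dual g s t * dual h t u) = (if g \<and> h then 0 else dual (g \<or> h) s u)"
  unfolding UNIV_bool by (cases g; cases h; cases s; cases u) (simp_all add: dual_def)

lemma sum_idx: "(\<Sum>m\<in>UNIV. f (fst m) * h (snd m)) = (\<Sum>m\<in>UNIV. f m) * (\<Sum>t\<in>UNIV. h t)"
  for f :: "five \<Rightarrow> complex" and h :: "bool \<Rightarrow> complex"
  by (simp add: sum_product sum.cartesian_product flip: UNIV_Times_UNIV) (simp add: case_prod_unfold)

lemma mm_std: "mm (std g) (std h) i j =
    (if snd g \<and> snd h then 0 else
     (if fst g = E1 then leit (fst h) (fst i) (fst j) else if fst h = E1 then leit (fst g) (fst i) (fst j)
      else of_bool (fst g = E2 \<and> fst h = E2 \<and> fst i = E1 \<and> fst j = E5)) * dual (snd g \<or> snd h) (snd i) (snd j))"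
proof -
  have "mm (std g) (std h) i j = (\<Sum>m\<in>UNIV. (leit (fst g) (fst i) (fst m) * leit (fst h) (fst m) (fst j))
      * (dual (snd g) (snd i) (snd m) * dual (snd h) (snd m) (snd j)))"
    by (simp add: mm_def std_def algebra_simps)
  also have "\<dots> = (\<Sum>m\<in>UNIV. leit (fst g) (fst i) m * leit (fst h) m (fst j))
      * (\<Sum>t\<in>UNIV. dual (snd g) (snd i) t * dual (snd h) t (snd j))"
    by (rule sum_idx)
  finally show ?thesis by (auto simp: leit_mult dual_mult)
qed

lemma mm_lin_left: "mm (\<lambda>i j. x * A i j + y * B i j) C i j = x * mm A C i j + y * mm B C i j"
  and mm_lin_right: "mm C (\<lambda>i j. x * A i j + y * B i j) i j = x * mm C A i j + y * mm C B i j"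
  by (simp_all add: mm_def sum.distrib sum_distrib_left algebra_simps)

lemma std_commute: "mm (std g) (std h) i j = mm (std h) (std g) i j"
  by (auto simp: mm_std)

definition comb :: "(idx \<Rightarrow> complex) \<Rightarrow> idx \<Rightarrow> idx \<Rightarrow> complex" where
  "comb u i j = (\<Sum>g\<in>UNIV. u g * std g i j)"

lemma mm_comb: "mm (comb u) (comb v) i j = (\<Sum>g\<in>UNIV. \<Sum>h\<in>UNIV. u g * v h * mm (std g) (std h) i j)"
proof -
  have "mm (comb u) (comb v) i j = (\<Sum>m\<in>UNIV. \<Sum>g\<in>UNIV. \<Sum>h\<in>UNIV. u g * v h * (std g i m * std h m j))"
    by (simp add: mm_def comb_def sum_product algebra_simps)
  also have "\<dots> = (\<Sum>g\<in>UNIV. \<Sum>m\<in>UNIV. \<Sum>h\<in>UNIV. u g * v h * (std g i m * std h m j))"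
    by (rule sum.swap)
  also have "\<dots> = (\<Sum>g\<in>UNIV. \<Sum>h\<in>UNIV. \<Sum>m\<in>UNIV. u g * v h * (std g i m * std h m j))"
    by (rule sum.cong[OF refl], rule sum.swap)
  finally show ?thesis by (simp add: mm_def sum_distrib_left)
qed

lemma comb_commute: "mm (comb u) (comb v) i j = mm (comb v) (comb u) i j"
proof -
  have "mm (comb u) (comb v) i j = (\<Sum>h\<in>UNIV. \<Sum>g\<in>UNIV. u g * v h * mm (std g) (std h) i j)"
    unfolding mm_comb by (rule sum.swap)
  also have "\<dots> = mm (comb v) (comb u) i j"
    unfolding mm_comb by (intro sum.cong refl) (subst std_commute, simp)
  finally show ?thesis .
qed

lemma comb_of_bool: "comb (\<lambda>h. of_bool (h = g)) i j = std g i j"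
  by (simp add: comb_def if_distrib[of "\<lambda>x. x * _"] of_bool_def cong: if_cong)

abbreviation x_idx :: idx where "x_idx \<equiv> (E2, False)"
abbreviation y_idx :: idx where "y_idx \<equiv> (E2, True)"

lemma comb_sub: "comb (\<lambda>h. of_bool (h = g) - \<kappa> * of_bool (h = g')) i j = 1 * std g i j + (- \<kappa>) * std g' i j"
proof -
  have "comb (\<lambda>h. of_bool (h = g) - \<kappa> * of_bool (h = g')) i j
     = comb (\<lambda>h. of_bool (h = g)) i j - \<kappa> * comb (\<lambda>h. of_bool (h = g')) i j"
    by (simp only: comb_def sum_subtractf sum_distrib_left left_diff_distrib mult.assoc)
  then show ?thesis by (simp add: comb_of_bool)
qed

definition in_span :: "(idx \<Rightarrow> idx \<Rightarrow> complex) \<Rightarrow> (idx \<Rightarrow> idx \<Rightarrow> complex) \<Rightarrow> bool" where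
  "in_span Z M \<longleftrightarrow> (\<exists>u \<zeta>. \<forall>i j. M i j = comb u i j + \<zeta> * Z i j)"

lemma in_span_comb: "in_span Z (comb u)"
  unfolding in_span_def by (rule exI[of _ u], rule exI[of _ 0]) simp

lemma in_span_std: "in_span Z (std g)"
  using in_span_comb[of Z "\<lambda>h. of_bool (h = g)"] by (simp add: comb_of_bool[abs_def] in_span_def)

lemma in_span_lin:
  assumes "in_span Z A" "in_span Z B"
  shows "in_span Z (\<lambda>i j. x * A i j + y * B i j)"
proof -
  obtain u \<zeta> where u: "\<And>i j. A i j = comb u i j + \<zeta> * Z i j" using assms unfolding in_span_def by blast
  obtain v \<eta> where v: "\<And>i j. B i j = comb v i j + \<eta> * Z i j" using assms unfolding in_span_def by blast
  show ?thesis unfolding in_span_def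
    by (rule exI[of _ "\<lambda>g. x * u g + y * v g"], rule exI[of _ "x * \<zeta> + y * \<eta>"])
       (simp add: u v comb_def sum.distrib sum_distrib_left algebra_simps)
qed

lemma in_span_cong: "in_span Z A \<Longrightarrow> (\<And>i j. A i j = B i j) \<Longrightarrow> in_span Z B"
  unfolding in_span_def by simp

lemma comb_15: "comb u (E1, s) (E5, t) = 0"
  unfolding comb_def by (rule sum.neutral) (auto simp: std_def leit_def split: five.splits)

text \<open>The slices vanish on the block (E1, E5), so there both matrices would be multiples of
  the block of the single matrix \<open>Z\<close>; but they are linearly independent.\<close>

lemma not_both_e15:
  assumes "in_span Z (e15 False)" "in_span Z (e15 True)"
  shows False
proof -
  obtain u \<zeta> where u: "\<And>i j. e15 False i j = comb u i j + \<zeta> * Z i j" using assms unfolding in_span_def by blast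
  obtain v \<eta> where v: "\<And>i j. e15 True i j = comb v i j + \<eta> * Z i j" using assms unfolding in_span_def by blast
  show False
    using u[of "(E1, False)" "(E5, False)"] v[of "(E1, False)" "(E5, False)"]
      u[of "(E1, False)" "(E5, True)"] v[of "(E1, False)" "(E5, True)"]
    by (auto simp: e15_def dual_def comb_15)
qed

text \<open>
  The 11-dimensional residue space contains only one matrix modulo the ten slices, whereas the
  squares of \<open>x\<close> and \<open>\<epsilon> x\<close> would contribute two.
\<close>

lemma products_in_span:
  assumes P: "\<And>u v. (\<Sum>g\<in>UNIV. l g * u g) = 0 \<Longrightarrow> in_span Z (mm (comb u) (comb v))"
  shows "l x_idx \<noteq> 0" and "g \<noteq> x_idx \<Longrightarrow> l g = 0" and "in_span Z (e15 True)"
proof -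
  have PP: "in_span Z (\<lambda>i j. mm (std g) (std h) i j - \<kappa> * mm (std x_idx) (std h) i j
      - \<eta> * (mm (std g) (std x_idx) i j - \<kappa> * mm (std x_idx) (std x_idx) i j))"
    if "l g = \<kappa> * l x_idx" for g h \<kappa> \<eta>
  proof -
    let ?u = "\<lambda>h. of_bool (h = g) - \<kappa> * of_bool (h = x_idx)"
    let ?v = "\<lambda>k. of_bool (k = h) - \<eta> * of_bool (k = x_idx)"
    have "(\<Sum>g\<in>UNIV. l g * ?u g) = l g - \<kappa> * l x_idx"
      by (simp add: algebra_simps sum_subtractf of_bool_def if_distrib[of "(*) _"] cong: if_cong)
    then have "in_span Z (mm (comb ?u) (comb ?v))" using that by (intro P) simp
    then show ?thesis
    proof (rule in_span_cong)
      fix i j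
      show "mm (comb ?u) (comb ?v) i j = mm (std g) (std h) i j - \<kappa> * mm (std x_idx) (std h) i j
      - \<eta> * (mm (std g) (std x_idx) i j - \<kappa> * mm (std x_idx) (std x_idx) i j)"
        unfolding comb_sub[abs_def] mm_lin_left mm_lin_right by (simp add: algebra_simps)
    qed
  qed
  have xx: "mm (std x_idx) (std x_idx) i j = e15 False i j" and xy: "mm (std x_idx) (std y_idx) i j = e15 True i j"
    and yx: "mm (std y_idx) (std x_idx) i j = e15 True i j" and yy: "mm (std y_idx) (std y_idx) i j = 0" for i j
    by (simp_all add: mm_std e15_def)
  show x: "l x_idx \<noteq> 0"
  proof
    assume "l x_idx = 0"
    then have "in_span Z (e15 False)" "in_span Z (e15 True)"
      using PP[of x_idx 0 x_idx 0] PP[of x_idx 0 y_idx 0] by (simp_all add: xx xy)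
    then show False by (rule not_both_e15)
  qed
  define \<kappa> where "\<kappa> g = l g / l x_idx" for g
  have \<kappa>: "l g = \<kappa> g * l x_idx" for g using x by (simp add: \<kappa>_def)
  \<comment> \<open>Write \<kappa> for the factor of y. Then (y - \<kappa> x) x = x y - \<kappa> x^2
    and (y - \<kappa> x)^2 = - 2 \<kappa> x y + \<kappa>^2 x^2; for nonzero \<kappa> these two span
    both x y and x^2.\<close>
  have y1: "in_span Z (\<lambda>i j. e15 True i j - \<kappa> y_idx * e15 False i j)"
    using PP[OF \<kappa>[of y_idx], of x_idx 0] by (simp add: xx yx)
  have y2: "in_span Z (\<lambda>i j. - \<kappa> y_idx * (e15 True i j + (e15 True i j - \<kappa> y_idx * e15 False i j)))"
    using PP[OF \<kappa>[of y_idx], of y_idx "\<kappa> y_idx"] by (simp add: xx yx xy yy algebra_simps)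
  have y0: "\<kappa> y_idx = 0"
  proof (rule ccontr)
    assume k: "\<kappa> y_idx \<noteq> 0"
    have T: "in_span Z (e15 True)"
      using in_span_lin[OF y1 y2, of "-1" "- 1 / \<kappa> y_idx"]
      by (rule in_span_cong) (simp add: k field_simps)
    have "in_span Z (e15 False)"
      using in_span_lin[OF T y1, of "1 / \<kappa> y_idx" "- 1 / \<kappa> y_idx"]
      by (rule in_span_cong) (simp add: k field_simps)
    then show False using T not_both_e15 by blast
  qed
  show T: "in_span Z (e15 True)" using y1 y0 by simp
  assume g: "g \<noteq> x_idx"
  have "\<kappa> g = 0"
  proof (cases "g = y_idx")
    case False
    have gg: "in_span Z (mm (std g) (std g))" and gx: "in_span Z (mm (std g) (std x_idx))"
      and xg: "in_span Z (mm (std x_idx) (std g))"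
    proof -
      have n: "fst g \<noteq> E2" using g False by (cases g; cases "snd g") auto
      have zero: "in_span Z (\<lambda>i j. 0)" using in_span_lin[OF in_span_std in_span_std, of Z 0 _ 0] by simp
      show gx: "in_span Z (mm (std g) (std x_idx))"
      proof (cases "fst g = E1")
        case True
        show ?thesis using in_span_std[of Z "(E2, snd g)"]
          by (rule in_span_cong) (simp add: mm_std True std_def)
      next
        case False
        show ?thesis using zero by (rule in_span_cong) (simp add: mm_std False n)
      qed
      then show "in_span Z (mm (std x_idx) (std g))"
        by (rule in_span_cong) (rule std_commute)
      show "in_span Z (mm (std g) (std g))"
      proof (cases "g = one_idx")
        case True
        show ?thesis using in_span_std[of Z g] by (rule in_span_cong) (simp add: mm_std True std_def)
      next
        case False
        then have "snd g \<or> fst g \<noteq> E1" by (cases g) auto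
        then show ?thesis using zero by (intro in_span_cong[OF zero]) (auto simp: mm_std n)
      qed
    qed
    show ?thesis
    proof (rule ccontr)
      assume k: "\<kappa> g \<noteq> 0"
      \<comment> \<open>This is (g - \<kappa> x)^2. Removing g^2 and g x, which lie in the span,
        leaves a nonzero multiple of x^2.\<close>
      have "in_span Z (\<lambda>i j. mm (std g) (std g) i j - \<kappa> g * mm (std x_idx) (std g) i j
        - \<kappa> g * (mm (std g) (std x_idx) i j - \<kappa> g * e15 False i j))" (is "in_span Z ?A")
        using PP[OF \<kappa>[of g], of g "\<kappa> g"] by (simp add: xx)
      from in_span_lin[OF in_span_lin[OF this gg, of 1 "- 1"] in_span_lin[OF xg gx, of "\<kappa> g" "\<kappa> g"], of "1 / (\<kappa> g * \<kappa> g)" "1 / (\<kappa> g * \<kappa> g)"]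
      have "in_span Z (e15 False)"
        by (rule in_span_cong) (simp add: k field_simps)
      then show False using T not_both_e15 by blast
    qed
  qed (use y0 in simp)
  then show "l g = 0" using \<kappa>[of g] by simp
qed

text \<open>The slices vanish on the block (E1, E5), so \<open>Z\<close> occurs in
  \<open>e15 True\<close> with nonzero coefficient and can be exchanged for it.\<close>

lemma in_span_blocks:
  assumes T: "in_span Z (e15 True)" and "in_span Z M"
  obtains u \<eta> where "\<And>i j. M i j = comb u i j + \<eta> * e15 True i j"
proof -
  obtain v \<zeta> where v: "\<And>i j. e15 True i j = comb v i j + \<zeta> * Z i j" using T unfolding in_span_def by blast
  obtain u \<eta> where u: "\<And>i j. M i j = comb u i j + \<eta> * Z i j" using assms(2) unfolding in_span_def by blast
  have z: "\<zeta> \<noteq> 0" using v[of "(E1, False)" "(E5, True)"] by (auto simp: e15_def dual_def comb_15)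
  have "M i j = comb (\<lambda>g. u g - \<eta> / \<zeta> * v g) i j + \<eta> / \<zeta> * e15 True i j" for i j
  proof -
    have "comb (\<lambda>g. u g - \<eta> / \<zeta> * v g) i j = comb u i j - \<eta> / \<zeta> * comb v i j"
      by (simp add: comb_def sum_subtractf sum_distrib_left algebra_simps)
    then show ?thesis using u[of i j] v[of i j] z by (simp add: field_simps)
  qed
  then show ?thesis by (rule that)
qed

lemma comb_explicit: "comb u (i, s) (j, t) =
   (if s = t then \<Sum>g\<in>UNIV. u (g, False) * leit g i j else if \<not> s \<and> t then \<Sum>g\<in>UNIV. u (g, True) * leit g i j else 0)"
proof -
  have "comb u (i, s) (j, t) = (\<Sum>g\<in>UNIV. \<Sum>e\<in>UNIV. u (g, e) * (leit g i j * dual e s t))"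
    by (simp add: comb_def std_def sum.cartesian_product flip: UNIV_Times_UNIV) (simp add: case_prod_unfold)
  then show ?thesis
    by (cases s; cases t) (simp_all add: UNIV_bool dual_def)
qed

section \<open>Classification of the extended residue tensor\<close>

lemma sum_option: "(\<Sum>m\<in>UNIV. f m) = f None + (\<Sum>m\<in>UNIV. f (Some m))"
  for f :: "'b::finite option \<Rightarrow> 'a::comm_monoid_add"
  by (simp add: UNIV_option_conv sum.reindex)

section \<open>The commutative algebra carried by eleven rank-one terms in three bases\<close>

locale unital =
  fixes a b c :: "idx option \<Rightarrow> idx option \<Rightarrow> 'k::field"
  assumes a: "rows_indep a" and b: "rows_indep b" and c: "rows_indep c"
    and a1: "\<And>k. a k (Some one_idx) \<noteq> 0"
    and unit: "\<And>i j. tens a b c (Some one_idx) (Some i) (Some j) = (if i = j then 1 else 0)"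
    and unit_p: "\<And>i. tens a b c (Some one_idx) (Some i) None = 0"
    and unit_q: "\<And>j. tens a b c (Some one_idx) None (Some j) = 0"
begin

definition T where "T = tens a b c"

definition c0 where "c0 = T (Some one_idx) None None"

definition \<Phi> :: "(idx option \<Rightarrow> 'k) \<Rightarrow> idx option \<Rightarrow> idx option \<Rightarrow> 'k" where
  "\<Phi> \<kappa> i j = (\<Sum>k\<in>UNIV. \<kappa> k * b k i * c k j)"

text \<open>The componentwise product for which the row \<open>Some one_idx\<close> of
  \<open>a\<close> is the unit. Under \<open>\<Phi>\<close> it becomes the matrix product with the
  inverse of the unit slice in between, see \<open>\<Phi>_pr\<close>; the separate term there is the
  one with denominator \<open>c0\<close>.\<close>

definition pr :: "(idx option \<Rightarrow> 'k) \<Rightarrow> (idx option \<Rightarrow> 'k) \<Rightarrow> idx option \<Rightarrow> 'k" where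
  "pr \<kappa> \<mu> k = \<kappa> k * \<mu> k / a k (Some one_idx)"

lemma T_\<Phi>: "T g = \<Phi> (\<lambda>k. a k g)"
  by (simp add: T_def \<Phi>_def tens_def fun_eq_iff)

lemma \<Phi>_comb: "\<Phi> (\<lambda>k. \<Sum>g\<in>G. n g * f g k) i j = (\<Sum>g\<in>G. n g * \<Phi> (f g) i j)"
  unfolding \<Phi>_def sum_distrib_left sum_distrib_right by (subst sum.swap) (simp add: mult.assoc)

lemma \<Phi>_diff: "\<Phi> (\<lambda>k. f k - m * h k) i j = \<Phi> f i j - m * \<Phi> h i j"
  by (simp add: \<Phi>_def left_diff_distrib sum_subtractf sum_distrib_left mult.assoc)

lemma \<Phi>_scale: "\<Phi> (\<lambda>k. m * h k) i j = m * \<Phi> h i j"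
  by (simp add: \<Phi>_def sum_distrib_left mult.assoc)

text \<open>Otherwise the last column of the unit slice would vanish, and independence of
  \<open>b\<close> would make all \<open>c k None\<close> zero.\<close>

lemma c0_nz: "c0 \<noteq> 0"
proof
  assume z: "c0 = 0"
  have *: "a k (Some one_idx) * c k None = 0" for k
  proof (rule rows_indep_columns[OF b, of "\<lambda>k. a k (Some one_idx) * c k None"])
    fix i show "(\<Sum>k\<in>UNIV. a k (Some one_idx) * c k None * b k i) = 0"
      using unit_p z unfolding c0_def T_def tens_def
      by (cases i) (simp_all add: algebra_simps)
  qed
  have "c k None = 0" for k using *[of k] a1[of k] by simp
  then have "(\<lambda>g. of_bool (g = (None :: idx option)) :: 'k) = (\<lambda>_. 0)"
    by (intro rows_indepD[OF c]) (simp add: sum_option)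
  from fun_cong[OF this, of None] show False by simp
qed

definition R :: "idx option \<Rightarrow> 'k" where "R m = (case m of None \<Rightarrow> 1 / c0 | Some _ \<Rightarrow> 1)"

text \<open>With B, C the matrices of \<open>b\<close>, \<open>c\<close> and D the diagonal matrix
  of the unit row of \<open>a\<close>, the unit slice is B^T D C, with inverse \<open>R\<close>.
  Rearranged, C R B^T is the inverse of D.\<close>

lemma R_inverse: "(\<Sum>m\<in>UNIV. c k m * R m * b l m) = of_bool (k = l) / a k (Some one_idx)"
proof -
  define y where "y k = a k (Some one_idx) * (\<Sum>m\<in>UNIV. c k m * R m * b l m) - of_bool (k = l)" for k
  have "y k = 0"
  proof (rule rows_indep_columns[OF b])
    fix i
    have "(\<Sum>k\<in>UNIV. y k * b k i) = (\<Sum>k\<in>UNIV. \<Sum>m\<in>UNIV. a k (Some one_idx) * b k i * c k m * (R m * b l m)) - b l i"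
      by (simp add: y_def left_diff_distrib sum_subtractf sum_distrib_left sum_distrib_right algebra_simps)
    also have "(\<Sum>k\<in>UNIV. \<Sum>m\<in>UNIV. a k (Some one_idx) * b k i * c k m * (R m * b l m))
        = (\<Sum>m\<in>UNIV. T (Some one_idx) i m * (R m * b l m))"
      unfolding T_def tens_def sum_distrib_right by (rule sum.swap)
    also have "\<dots> = b l i"
    proof (cases i)
      case None
      then show ?thesis using c0_nz by (simp add: sum_option R_def T_def unit_q c0_def)
    next
      case (Some i')
      have "(\<Sum>m\<in>UNIV. (if i' = m then 1 else 0) * b l (Some m)) = b l (Some i')"
        by (simp add: if_distrib[of "\<lambda>x. x * _"] cong: if_cong)
      then show ?thesis using Some by (simp add: sum_option T_def unit unit_p R_def)
    qed
    finally show "(\<Sum>k\<in>UNIV. y k * b k i) = 0" by simp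
  qed
  then show ?thesis using a1[of k] by (simp add: y_def field_simps)
qed

lemma \<Phi>_pr: "\<Phi> (pr \<kappa> \<mu>) i j
    = (\<Sum>m\<in>UNIV. \<Phi> \<kappa> i (Some m) * \<Phi> \<mu> (Some m) j) + \<Phi> \<kappa> i None * \<Phi> \<mu> None j / c0"
proof -
  have "(\<Sum>m\<in>UNIV. \<Phi> \<kappa> i (Some m) * \<Phi> \<mu> (Some m) j) + \<Phi> \<kappa> i None * \<Phi> \<mu> None j / c0
      = (\<Sum>m\<in>UNIV. R m * (\<Phi> \<kappa> i m * \<Phi> \<mu> m j))"
    by (simp add: sum_option R_def)
  also have "\<dots> = (\<Sum>m\<in>UNIV. \<Sum>k\<in>UNIV. \<Sum>l\<in>UNIV. \<kappa> k * b k i * (\<mu> l * c l j) * (c k m * R m * b l m))"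
    unfolding \<Phi>_def sum_product unfolding sum_distrib_left by (intro sum.cong refl) (simp add: algebra_simps)
  also have "\<dots> = (\<Sum>k\<in>UNIV. \<Sum>m\<in>UNIV. \<Sum>l\<in>UNIV. \<kappa> k * b k i * (\<mu> l * c l j) * (c k m * R m * b l m))"
    by (rule sum.swap)
  also have "\<dots> = (\<Sum>k\<in>UNIV. \<Sum>l\<in>UNIV. \<Sum>m\<in>UNIV. \<kappa> k * b k i * (\<mu> l * c l j) * (c k m * R m * b l m))"
    by (rule sum.cong[OF refl], rule sum.swap)
  also have "\<dots> = (\<Sum>k\<in>UNIV. \<Sum>l\<in>UNIV. \<kappa> k * b k i * (\<mu> l * c l j) * (of_bool (k = l) / a k (Some one_idx)))"
    by (simp only: R_inverse flip: sum_distrib_left)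
  also have "\<dots> = \<Phi> (pr \<kappa> \<mu>) i j"
  proof -
    have "(\<Sum>l\<in>UNIV. \<kappa> k * b k i * (\<mu> l * c l j) * (of_bool (k = l) / a k (Some one_idx)))
        = \<kappa> k * \<mu> k / a k (Some one_idx) * b k i * c k j" for k
      by (simp add: of_bool_def if_distrib[of "\<lambda>x. x / _"] if_distrib[of "\<lambda>x. _ * x"] cong: if_cong)
    then show ?thesis by (simp add: \<Phi>_def pr_def)
  qed
  finally show ?thesis ..
qed

lemma pr_commute: "pr \<kappa> \<mu> = pr \<mu> \<kappa>"
  by (simp add: pr_def fun_eq_iff)

text \<open>The componentwise product is commutative. In the top left block this expresses the
  commutator of the matrices by the borders divided by \<open>c0\<close>.\<close>

lemma commutation:
  "\<Phi> \<kappa> (Some i) None * \<Phi> \<mu> None (Some j) - \<Phi> \<mu> (Some i) None * \<Phi> \<kappa> None (Some j)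
    = c0 * ((\<Sum>m\<in>UNIV. \<Phi> \<mu> (Some i) (Some m) * \<Phi> \<kappa> (Some m) (Some j))
          - (\<Sum>m\<in>UNIV. \<Phi> \<kappa> (Some i) (Some m) * \<Phi> \<mu> (Some m) (Some j)))"
proof -
  have "\<Phi> (pr \<kappa> \<mu>) (Some i) (Some j) = \<Phi> (pr \<mu> \<kappa>) (Some i) (Some j)"
    by (simp add: pr_commute[of \<kappa>])
  then show ?thesis unfolding \<Phi>_pr using c0_nz by (simp add: field_simps)
qed

end

section \<open>Residues of the extended tensor\<close>

locale extended = place V r + unital a b c
  for V :: "'k::field set" and r and a b c :: "idx option \<Rightarrow> idx option \<Rightarrow> 'k" +
  assumes int: "\<And>g i j. tens a b c g (Some i) (Some j) \<in> V"
    and res: "\<And>g i j. r (tens a b c (Some g) (Some i) (Some j)) = std g i j"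
    and Zpiv: "\<And>g. tens a b c None (Some (fst (pivot g))) (Some (snd (pivot g))) = 0"
    and Znz: "\<exists>i j. r (tens a b c None (Some i) (Some j)) \<noteq> 0"
    and pV: "\<And>g i. tens a b c g (Some i) None \<in> V"
    and pnz: "\<exists>g i. r (tens a b c g (Some i) None) \<noteq> 0"
    and qV: "\<And>g j. tens a b c g None (Some j) \<in> V"
    and qnz: "\<exists>g j. r (tens a b c g None (Some j)) \<noteq> 0"
begin

definition Z where "Z i j = r (T None (Some i) (Some j))"

lemma comb_pivot: "comb u (fst (pivot g)) (snd (pivot g)) = u g"
  unfolding comb_def std_pivot by (simp add: if_distrib[of "\<lambda>x. _ * x"] cong: if_cong)

lemma top_left_independent:
  assumes "\<And>d. (\<Sum>g\<in>UNIV. \<mu> g * r (T g (Some (fst d)) (Some (snd d)))) = 0"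
  shows "\<mu> = (\<lambda>_. 0)"
proof -
  have e: "\<mu> None * Z i j + comb (\<lambda>g. \<mu> (Some g)) i j = 0" for i j
    using assms[of "(i, j)"] by (simp add: sum_option Z_def comb_def T_def res)
  have s: "\<mu> (Some g) = 0" for g
    using e[of "fst (pivot g)" "snd (pivot g)"] Zpiv[of g] by (simp add: Z_def T_def comb_pivot)
  obtain i j where "Z i j \<noteq> 0" using Znz by (auto simp: Z_def T_def)
  then have "\<mu> None = 0" using e[of i j] s by (simp add: comb_def)
  then have "\<mu> g = 0" for g using s by (cases g) auto
  then show ?thesis by auto
qed

text \<open>The residues of the eleven top left blocks are independent, so integrality of that block
  alone forces integral coefficients; this also controls the border.\<close>

lemma expand:
  assumes "\<And>i j. \<Phi> \<kappa> (Some i) (Some j) \<in> V"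
  obtains n where "\<And>g. n g \<in> V" "\<And>k. \<kappa> k = (\<Sum>g\<in>UNIV. n g * a k g)"
    "\<And>i j. \<Phi> \<kappa> i j = (\<Sum>g\<in>UNIV. n g * T g i j)"
proof -
  obtain n where n: "\<And>k. \<kappa> k = (\<Sum>g\<in>UNIV. n g * a k g)" using rows_indep_spans[OF a] by blast
  have \<Phi>: "\<Phi> \<kappa> i j = (\<Sum>g\<in>UNIV. n g * T g i j)" for i j
    unfolding n[abs_def] T_\<Phi> by (rule \<Phi>_comb)
  have "n g \<in> V" for g
  proof (rule integral_coeffs[of "\<lambda>g d. T g (Some (fst d)) (Some (snd d))"])
    fix \<mu> assume "\<And>d. (\<Sum>i\<in>UNIV. \<mu> i * r (T i (Some (fst d)) (Some (snd d)))) = 0"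
    then show "\<mu> = (\<lambda>_. 0)" by (rule top_left_independent)
  next
    show "T g (Some (fst d)) (Some (snd d)) \<in> V" for g d using int by (simp add: T_def)
    show "(\<Sum>g\<in>UNIV. n g * T g (Some (fst d)) (Some (snd d))) \<in> V" for d
      using assms[of "fst d" "snd d"] unfolding \<Phi> .
  qed
  then show ?thesis by (rule that[OF _ n \<Phi>])
qed

lemma in_span_residue:
  assumes "\<And>i j. \<Phi> \<kappa> (Some i) (Some j) \<in> V"
  shows "in_span Z (\<lambda>i j. r (\<Phi> \<kappa> (Some i) (Some j)))"
proof -
  obtain n where n: "\<And>g. n g \<in> V" "\<And>k. \<kappa> k = (\<Sum>g\<in>UNIV. n g * a k g)"
    "\<And>i j. \<Phi> \<kappa> i j = (\<Sum>g\<in>UNIV. n g * T g i j)"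
    by (rule expand[OF assms], rule that)
  show ?thesis unfolding in_span_def
    by (rule exI[of _ "\<lambda>g. r (n (Some g))"], rule exI[of _ "r (n None)"])
       (use n(1) int in \<open>simp add: n(3) sum_option T_def Z_def comb_def res\<close>)
qed

definition lift where "lift u = (SOME v. v \<in> V \<and> r v = u)"

lemma lift: "lift u \<in> V" "r (lift u) = u"
  using someI_ex[of "\<lambda>v. v \<in> V \<and> r v = u"] r_surj[of u] unfolding lift_def by blast+

definition lin where "lin u k = (\<Sum>g\<in>UNIV. lift (u g) * a k (Some g))"

lemma \<Phi>_lin: "\<Phi> (lin u) i j = (\<Sum>g\<in>UNIV. lift (u g) * T (Some g) i j)"
  unfolding lin_def[abs_def] T_\<Phi> by (rule \<Phi>_comb)

lemma lin_int: "\<Phi> (lin u) (Some i) (Some j) \<in> V" "\<Phi> (lin u) (Some i) None \<in> V" "\<Phi> (lin u) None (Some j) \<in> V"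
  unfolding \<Phi>_lin using int pV qV lift by (auto simp: T_def)

lemma lin_res: "r (\<Phi> (lin u) (Some i) (Some j)) = comb u i j"
  unfolding \<Phi>_lin using int lift by (simp add: T_def res comb_def)

definition P where "P g i = r (T g (Some i) None)"
definition Q where "Q g j = r (T g None (Some j))"

lemma lin_P: "r (\<Phi> (lin u) (Some i) None) = (\<Sum>g\<in>UNIV. u g * P (Some g) i)"
  and lin_Q: "r (\<Phi> (lin u) None (Some j)) = (\<Sum>g\<in>UNIV. u g * Q (Some g) j)"
  unfolding \<Phi>_lin using pV qV lift by (simp_all add: T_def P_def Q_def)

text \<open>
  The product of two lattice elements is again in the lattice once the rank-one correction coming
  from the last row and column is integral; if the correction vanishes, the products of the
  residues stay in the residue space.
\<close>

lemma product_in_span: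
  assumes \<kappa>: "\<And>i j. \<Phi> \<kappa> (Some i) (Some j) \<in> V" and \<mu>: "\<And>i j. \<Phi> \<mu> (Some i) (Some j) \<in> V"
    and corr: "\<And>i j. \<Phi> \<kappa> (Some i) None * \<Phi> \<mu> None (Some j) / c0 \<in> V"
  shows "in_span Z (\<lambda>i j. mm (\<lambda>i j. r (\<Phi> \<kappa> (Some i) (Some j))) (\<lambda>i j. r (\<Phi> \<mu> (Some i) (Some j))) i j
    + r (\<Phi> \<kappa> (Some i) None * \<Phi> \<mu> None (Some j) / c0))"
proof -
  have "\<Phi> (pr \<kappa> \<mu>) (Some i) (Some j) \<in> V" for i j
    unfolding \<Phi>_pr using assms by auto
  from in_span_residue[OF this] show ?thesis
    by (rule in_span_cong) (use assms in \<open>simp add: \<Phi>_pr mm_def\<close>)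
qed

lemma no_correction_contradiction:
  assumes "\<And>u v i j. \<Phi> (lin u) (Some i) None * \<Phi> (lin v) None (Some j) / c0 \<in> V
     \<and> r (\<Phi> (lin u) (Some i) None * \<Phi> (lin v) None (Some j) / c0) = 0"
  shows False
proof -
  have "in_span Z (mm (comb u) (comb v))" for u v
    using product_in_span[OF lin_int(1) lin_int(1), of u v] assms
    by (rule_tac in_span_cong) (auto simp: lin_res)
  \<comment> \<open>With \<open>l = 0\<close> every \<open>u\<close> is admissible, and the
    conclusion that \<open>l\<close> is nonzero at x is absurd.\<close>
  then show False using products_in_span(1)[of "\<lambda>_. 0" Z] by simp
qed

lemma c0_V: "c0 \<in> V"
proof (rule ccontr)
  assume "c0 \<notin> V"
  from V_notin[OF this] have "inverse c0 \<in> V" "r (inverse c0) = 0" by auto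
  then show False
    by (intro no_correction_contradiction) (simp add: divide_inverse lin_int)
qed

lemma rank_one_families:
  fixes P' Q' :: "'g \<Rightarrow> 'i \<Rightarrow> complex"
  assumes sym: "\<And>g h i j. P' g i * Q' h j = P' h i * Q' g j"
    and nz: "P' g0 i0 \<noteq> 0" "\<exists>g j. Q' g j \<noteq> 0"
  shows "Q' g j = P' g i0 / P' g0 i0 * Q' g0 j" and "P' g i = P' g i0 / P' g0 i0 * P' g0 i"
    and "\<exists>j. Q' g0 j \<noteq> 0"
proof -
  show Q: "Q' g j = P' g i0 / P' g0 i0 * Q' g0 j" for g j
    using sym[of g0 i0 g j] nz(1) by (simp add: field_simps)
  show ex: "\<exists>j. Q' g0 j \<noteq> 0"
  proof (rule ccontr)
    assume "\<not> ?thesis"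
    then have "Q' g j = 0" for g j using Q[of g j] by simp
    then show False using nz(2) by blast
  qed
  then obtain j0 where "Q' g0 j0 \<noteq> 0" by blast
  then show "P' g i = P' g i0 / P' g0 i0 * P' g0 i"
    using sym[of g i g0 j0] Q[of g j0] nz(1) by (simp add: field_simps)
qed

text \<open>If \<open>c0\<close> were a unit, x^2 plus a rank-one matrix would lie in the span of
  the slices and \<open>e15 True\<close>. On the 2 by 2 block (E1, E5) the matrix x^2 is the
  identity. A rank-one matrix that cancels both diagonal entries has a nonzero lower left entry,
  where nothing can compensate for it.\<close>

lemma c0_small: "r c0 = 0"
proof (rule ccontr)
  assume c: "r c0 \<noteq> 0"
  have ic: "inverse c0 \<in> V" "r (inverse c0) = inverse (r c0)" using V_inverse[OF c0_V c] r_inverse[OF c0_V c] by auto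
  have corr: "\<Phi> (lin u) (Some i) None * \<Phi> (lin v) None (Some j) / c0 \<in> V"
     "r (\<Phi> (lin u) (Some i) None * \<Phi> (lin v) None (Some j) / c0)
       = (\<Sum>g\<in>UNIV. u g * P (Some g) i) * (\<Sum>g\<in>UNIV. v g * Q (Some g) j) / r c0" for u v i j
    using ic lin_int by (simp_all add: divide_inverse lin_P lin_Q)
  have sp: "in_span Z (\<lambda>i j. mm (comb u) (comb v) i j
      + (\<Sum>g\<in>UNIV. u g * P (Some g) i) * (\<Sum>g\<in>UNIV. v g * Q (Some g) j) / r c0)" for u v
    using product_in_span[OF lin_int(1) lin_int(1) corr(1), of u v]
    by (rule in_span_cong) (simp add: lin_res corr(2))
  have sym: "P (Some g) i * Q (Some h) j = P (Some h) i * Q (Some g) j" for g h i j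
  proof -
    have "r (T (Some g) (Some i) None * T (Some h) None (Some j) - T (Some h) (Some i) None * T (Some g) None (Some j))
       = r c0 * (mm (std h) (std g) i j - mm (std g) (std h) i j)"
      unfolding T_\<Phi> commutation
      using c0_V int by (simp add: T_def[symmetric] T_\<Phi>[symmetric] mm_def) (simp add: T_def int res)
    also have "\<dots> = 0" using std_commute[of g h i j] by simp
    finally show ?thesis using pV qV by (simp add: P_def Q_def T_def)
  qed
  show False
  proof (cases "(\<forall>g i. P (Some g) i = 0) \<or> (\<forall>g j. Q (Some g) j = 0)")
    case True
    have "(\<Sum>g\<in>UNIV. u g * P (Some g) i) = 0 \<or> (\<Sum>g\<in>UNIV. v g * Q (Some g) j) = 0" for u v i j
      using True
    proof
      assume *: "\<forall>g i. P (Some g) i = 0"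
      have "P (Some g) i = 0" for g using * by blast
      then show ?thesis by (simp only: mult_zero_right sum.neutral_const simp_thms)
    next
      assume *: "\<forall>g j. Q (Some g) j = 0"
      have "Q (Some g) j = 0" for g using * by blast
      then show ?thesis by (simp only: mult_zero_right sum.neutral_const simp_thms)
    qed
    then have "(\<Sum>g\<in>UNIV. u g * P (Some g) i) * (\<Sum>g\<in>UNIV. v g * Q (Some g) j) = 0" for u v i j
      by (simp only: mult_eq_0_iff)
    then show ?thesis using corr by (intro no_correction_contradiction) simp
  next
    case False
    then obtain g0 i0 where g0: "P (Some g0) i0 \<noteq> 0" by blast
    define l where "l g = P (Some g) i0 / P (Some g0) i0" for g
    have Pl: "P (Some g) i = l g * P (Some g0) i" and Ql: "Q (Some g) j = l g * Q (Some g0) j" for g i j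
    proof -
      obtain g' j' where "Q (Some g') j' \<noteq> 0" using False by blast
      then have ex: "\<exists>g j. Q (Some g) j \<noteq> 0" by blast
      show "P (Some g) i = l g * P (Some g0) i" "Q (Some g) j = l g * Q (Some g0) j"
        unfolding l_def by (rule rank_one_families(2,1)[of "\<lambda>g. P (Some g)" "\<lambda>g. Q (Some g)", OF sym g0 ex])+
    qed
    have pr: "in_span Z (mm (comb u) (comb v))" if "(\<Sum>g\<in>UNIV. l g * u g) = 0" for u v
    proof (rule in_span_cong[OF sp[of u v]])
      have "(\<Sum>g\<in>UNIV. u g * P (Some g) i) = (\<Sum>g\<in>UNIV. l g * u g) * P (Some g0) i" for i
        unfolding sum_distrib_right by (rule sum.cong[OF refl], subst Pl) (simp only: mult_ac)
      then show "mm (comb u) (comb v) i j + (\<Sum>g\<in>UNIV. u g * P (Some g) i) * (\<Sum>g\<in>UNIV. v g * Q (Some g) j) / r c0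
         = mm (comb u) (comb v) i j" for i j using that by simp
    qed
    have T15: "in_span Z (e15 True)" using products_in_span(3)[OF pr] by blast
    let ?u = "\<lambda>h. of_bool (h = x_idx)"
    obtain u \<eta> where u: "\<And>i j. mm (comb ?u) (comb ?u) i j
      + (\<Sum>g\<in>UNIV. ?u g * P (Some g) i) * (\<Sum>g\<in>UNIV. ?u g * Q (Some g) j) / r c0 = comb u i j + \<eta> * e15 True i j"
      using in_span_blocks[OF T15 sp[of ?u ?u]] by blast
    have xx: "mm (comb ?u) (comb ?u) i j = e15 False i j" for i j
      by (simp add: comb_of_bool[abs_def] mm_std e15_def)
    have N: "e15 False i j + P (Some x_idx) i * Q (Some x_idx) j / r c0 = comb u i j + \<eta> * e15 True i j" for i j
    proof -
      have "(\<Sum>g\<in>UNIV. ?u g * f g) = f x_idx" for f :: "idx \<Rightarrow> complex" by simp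
      then show ?thesis using u[of i j] by (simp only: xx)
    qed
    have "P (Some x_idx) (E1, False) * Q (Some x_idx) (E5, False) \<noteq> 0"
      using N[of "(E1, False)" "(E5, False)"] by (auto simp: comb_15 e15_def dual_def)
    moreover have "P (Some x_idx) (E1, True) * Q (Some x_idx) (E5, True) \<noteq> 0"
      using N[of "(E1, True)" "(E5, True)"] by (auto simp: comb_15 e15_def dual_def)
    moreover have "P (Some x_idx) (E1, True) * Q (Some x_idx) (E5, False) / r c0 = 0"
      using N[of "(E1, True)" "(E5, False)"] by (auto simp: comb_15 e15_def dual_def)
    ultimately show False using c by simp
  qed
qed

end

section \<open>The border and the normal form of the residue tensor\<close>

declare split_paired_All [simp del] split_paired_Ex [simp del]

text \<open>The right-hand side has a vanishing lower left block and equal diagonal blocks, so rank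
  one leaves only the upper right block. There the coefficients of the slices of a_1 and a_2 vanish,
  and what remains lies in rows 1, 2 and columns 4, 5.\<close>

lemma rank_one_shape:
  fixes p q :: "idx \<Rightarrow> complex"
  assumes pq: "\<And>i j. p i * q j = comb u i j + \<eta> * e15 True i j"
    and nz: "p i0 \<noteq> 0" "q j0 \<noteq> 0"
  shows "p i \<noteq> 0 \<Longrightarrow> fst i \<in> {E1, E2} \<and> \<not> snd i" and "q j \<noteq> 0 \<Longrightarrow> fst j \<in> {E4, E5} \<and> snd j"
proof -
  have e: "p (i, s) * q (j, t) = (if s = t then \<Sum>g\<in>UNIV. u (g, False) * leit g i j
     else if \<not> s \<and> t then (\<Sum>g\<in>UNIV. u (g, True) * leit g i j) + \<eta> * of_bool (i = E1 \<and> j = E5) else 0)" for i j s t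
    unfolding pq comb_explicit by (auto simp: e15_def dual_def)
  have pT: "p (i, True) = 0" for i
  proof (rule ccontr)
    assume i: "p (i, True) \<noteq> 0"
    have qF: "q (j, False) = 0" for j using e[of i True j False] i by simp
    have "q (j, True) = 0" for j using e[of i False j False] e[of i True j True] i qF by simp
    then have "q j0 = 0" using qF by (cases j0; cases "snd j0") auto
    then show False using nz by simp
  qed
  obtain i1 where i1: "p (i1, False) \<noteq> 0" using nz(1) pT by (cases i0; cases "snd i0") auto
  have qF: "q (j, False) = 0" for j using e[of i1 False j False] e[of i1 True j True] i1 pT by simp
  obtain j1 where j1: "q (j1, True) \<noteq> 0" using nz(2) qF by (cases j0; cases "snd j0") auto
  define x where "x i = p (i, False)" for i
  define y where "y j = q (j, True)" for j
  have xy: "x i * y j = (\<Sum>g\<in>UNIV. u (g, True) * leit g i j) + \<eta> * of_bool (i = E1 \<and> j = E5)" for i j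
    using e[of i False j True] by (simp add: x_def y_def)
  have xyv: "x E1 * y E1 = u (E1, True)" "x E2 * y E2 = u (E1, True)" "x E3 * y E3 = u (E1, True)"
    "x E4 * y E4 = u (E1, True)" "x E5 * y E5 = u (E1, True)"
    "x E1 * y E2 = 0" "x E1 * y E3 = u (E2, True)" "x E3 * y E5 = u (E2, True)"
    "x E2 * y E1 = 0" "x E3 * y E1 = 0" "x E4 * y E1 = 0" "x E5 * y E1 = 0" "x E3 * y E2 = 0" "x E4 * y E2 = 0" "x E5 * y E2 = 0"
    "x E2 * y E3 = 0" "x E4 * y E3 = 0" "x E5 * y E3 = 0" "x E3 * y E4 = 0" "x E5 * y E4 = 0" "x E4 * y E5 = 0"
    unfolding xy by (simp_all add: UNIV_five leit_def)
  \<comment> \<open>Here and for \<open>u2\<close> a 2 by 2 minor of a rank-one matrix is set to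
    zero.\<close>
  have u1: "u (E1, True) = 0"
  proof -
    have "(x E1 * y E1) * (x E2 * y E2) = (x E1 * y E2) * (x E2 * y E1)" by (simp only: mult_ac)
    then show ?thesis by (simp only: xyv(1,2,6)) simp
  qed
  have u2: "u (E2, True) = 0"
  proof -
    have "(x E1 * y E3) * (x E3 * y E5) = (x E3 * y E3) * (x E1 * y E5)" by (simp only: mult_ac)
    then show ?thesis by (simp only: xyv(3,7,8) u1) simp
  qed
  have x3: "x i = 0" if i: "i \<in> {E3, E4, E5}" for i
  proof (rule ccontr)
    assume nz: "x i \<noteq> 0"
    have "x i * y j = 0" for j
      unfolding xy using i by (cases j) (auto simp: UNIV_five leit_def u1 u2)
    then have "y j1 = 0" using nz by simp
    then show False using j1 by (simp add: y_def)
  qed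
  have y3: "y j = 0" if j: "j \<in> {E1, E2, E3}" for j
  proof (rule ccontr)
    assume nz: "y j \<noteq> 0"
    have "x i * y j = 0" for i
      unfolding xy using j by (cases i) (auto simp: UNIV_five leit_def u1 u2)
    then have "x i1 = 0" using nz by simp
    then show False using i1 by (simp add: x_def)
  qed
  show "p i \<noteq> 0 \<Longrightarrow> fst i \<in> {E1, E2} \<and> \<not> snd i"
    using pT x3 by (cases i; cases "fst i"; cases "snd i") (auto simp: x_def)
  show "q j \<noteq> 0 \<Longrightarrow> fst j \<in> {E4, E5} \<and> snd j"
    using qF y3 by (cases j; cases "fst j"; cases "snd j") (auto simp: y_def)
qed

text \<open>Only \<open>p\<close> and \<open>q\<close> remain undetermined. The new slice is x y,
  and the matrix \<open>p i * q j\<close> is the residue of c0 x^2: the border is the trace that x^2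
  leaves in the limit.\<close>

definition res3 :: "(idx \<Rightarrow> complex) \<Rightarrow> (idx \<Rightarrow> complex) \<Rightarrow> idx option \<Rightarrow> idx option \<Rightarrow> idx option \<Rightarrow> complex" where
  "res3 p q g i j = (case (i, j) of
      (Some i, Some j) \<Rightarrow> (case g of Some g \<Rightarrow> std g i j | None \<Rightarrow> e15 True i j)
    | (Some i, None) \<Rightarrow> (if g = Some x_idx then p i else 0)
    | (None, Some j) \<Rightarrow> (if g = Some x_idx then q j else 0)
    | (None, None) \<Rightarrow> 0)"

text \<open>The slices whose border stays divisible by c0 with quotient of residue 0, so that their
  multiplication operators are integral. For x this fails, because \<open>p\<close> and
  \<open>q\<close> are nonzero.\<close>

definition gens :: "idx set" where
  "gens = {(E1, True), y_idx, (E3, False), (E4, False), (E5, False)}"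

context extended
begin

text \<open>The right side of \<open>commutation\<close> carries the factor \<open>c0\<close>, of
  residue 0. So the symmetry includes the new slice, about whose products nothing is known
  yet.\<close>

lemma PQ_sym: "P g i * Q h j = P h i * Q g j"
proof -
  have "r (T g (Some i) None * T h None (Some j) - T h (Some i) None * T g None (Some j)) = 0"
    unfolding T_\<Phi> commutation
    using c0_V c0_small int by (simp add: T_\<Phi>[symmetric] T_def)
  then show ?thesis using pV qV by (simp add: P_def Q_def T_def)
qed

text \<open>The product formula divides a border column times a border row by \<open>c0\<close>, so
  one of them should be divisible by \<open>c0\<close>. Subtracting \<open>m\<close> times the slice
  \<open>s0\<close>, with \<open>r m = 0\<close>, achieves this without changing residues of the top
  left block.\<close>

definition adjusted where
  "adjusted \<kappa> s0 m P' Q' \<longleftrightarrow> m \<in> V \<and> r m = 0 \<and> (\<forall>i. P' i \<in> V) \<and> (\<forall>j. Q' j \<in> V)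
    \<and> (\<forall>i. \<Phi> (\<lambda>k. \<kappa> k - m * a k s0) (Some i) None = c0 * P' i)
    \<and> (\<forall>j. \<Phi> (\<lambda>k. \<kappa> k - m * a k s0) None (Some j) = c0 * Q' j)
    \<and> ((\<forall>i j. mm (\<lambda>i j. r (\<Phi> \<kappa> (Some i) (Some j))) (\<lambda>i j. r (T s0 (Some i) (Some j))) i j
        = mm (\<lambda>i j. r (T s0 (Some i) (Some j))) (\<lambda>i j. r (\<Phi> \<kappa> (Some i) (Some j))) i j) \<longrightarrow>
      (\<forall>i. r (P' i) = 0) \<and> (\<forall>j. r (Q' j) = 0))"

text \<open>\<open>m\<close> is chosen to clear entry \<open>j0\<close> of the border row. At
  \<open>j0\<close> the commutation with \<open>s0\<close> then has a single border term, so a unit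
  times the column equals \<open>c0\<close> times a commutator. The row follows in the same way at
  \<open>i0\<close>. The quotients are commutators up to units, whence the last clause of
  \<open>adjusted\<close>.\<close>

lemma adjust:
  assumes s: "P s0 i0 \<noteq> 0" "Q s0 j0 \<noteq> 0"
    and V: "\<And>i j. \<Phi> \<kappa> (Some i) (Some j) \<in> V" "\<And>i. \<Phi> \<kappa> (Some i) None \<in> V" "\<And>j. \<Phi> \<kappa> None (Some j) \<in> V"
    and z: "\<And>i. r (\<Phi> \<kappa> (Some i) None) = 0" "\<And>j. r (\<Phi> \<kappa> None (Some j)) = 0"
  shows "\<exists>m P' Q'. adjusted \<kappa> s0 m P' Q'"
proof -
  define ps where "ps = T s0 (Some i0) None"
  define qs where "qs = T s0 None (Some j0)"
  have ps: "ps \<in> V" "r ps \<noteq> 0" "inverse ps \<in> V" "ps \<noteq> 0"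
    using s pV V_inverse[of ps] by (auto simp: ps_def P_def T_def)
  have qs: "qs \<in> V" "r qs \<noteq> 0" "inverse qs \<in> V" "qs \<noteq> 0"
    using s qV V_inverse[of qs] by (auto simp: qs_def Q_def T_def)
  define m where "m = \<Phi> \<kappa> None (Some j0) * inverse qs"
  have m: "m \<in> V" "r m = 0" using V z qs by (auto simp: m_def)
  define \<kappa>' where "\<kappa>' k = \<kappa> k - m * a k s0" for k
  have \<Phi>': "\<Phi> \<kappa>' i j = \<Phi> \<kappa> i j - m * T s0 i j" for i j
    unfolding \<kappa>'_def[abs_def] \<Phi>_diff T_\<Phi> ..
  have q0: "\<Phi> \<kappa>' None (Some j0) = 0"
    using qs by (simp add: \<Phi>' m_def flip: qs_def)
  define D where "D i j = (\<Sum>m\<in>UNIV. T s0 (Some i) (Some m) * \<Phi> \<kappa>' (Some m) (Some j))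
          - (\<Sum>m\<in>UNIV. \<Phi> \<kappa>' (Some i) (Some m) * T s0 (Some m) (Some j))" for i j
  have tV: "\<Phi> \<kappa>' (Some i) (Some j) \<in> V" "r (\<Phi> \<kappa>' (Some i) (Some j)) = r (\<Phi> \<kappa> (Some i) (Some j))" for i j
    using V m int by (auto simp: \<Phi>' T_def)
  have D: "D i j \<in> V" for i j using tV int by (auto simp: D_def T_def)
  have rD: "r (D i j) = mm (\<lambda>i j. r (T s0 (Some i) (Some j))) (\<lambda>i j. r (\<Phi> \<kappa> (Some i) (Some j))) i j
     - mm (\<lambda>i j. r (\<Phi> \<kappa> (Some i) (Some j))) (\<lambda>i j. r (T s0 (Some i) (Some j))) i j" for i j
    using tV int by (simp add: D_def T_def mm_def)
  have comm: "\<Phi> \<kappa>' (Some i) None * T s0 None (Some j) - T s0 (Some i) None * \<Phi> \<kappa>' None (Some j) = c0 * D i j" for i j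
    using commutation[of \<kappa>' i "\<lambda>k. a k s0" j] unfolding D_def T_\<Phi> .
  define P' where "P' i = D i j0 * inverse qs" for i
  define Q' where "Q' j = (P' i0 * T s0 None (Some j) - D i0 j) * inverse ps" for j
  have P': "\<Phi> \<kappa>' (Some i) None = c0 * P' i" for i
    using comm[of i j0] qs q0 by (simp add: P'_def field_simps flip: qs_def)
  have Q': "\<Phi> \<kappa>' None (Some j) = c0 * Q' j" for j
    using comm[of i0 j] ps P'[of i0] by (simp add: Q'_def field_simps flip: ps_def)
  have PV: "P' i \<in> V" for i using D qs by (simp add: P'_def)
  have QV: "Q' j \<in> V" for j using D ps PV qV by (simp add: Q'_def T_def)
  have "adjusted \<kappa> s0 m P' Q'"
    unfolding adjusted_def
  proof (intro conjI allI impI m PV QV)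
    show "\<Phi> (\<lambda>k. \<kappa> k - m * a k s0) (Some i) None = c0 * P' i" for i using P' unfolding \<kappa>'_def[abs_def] .
    show "\<Phi> (\<lambda>k. \<kappa> k - m * a k s0) None (Some j) = c0 * Q' j" for j using Q' unfolding \<kappa>'_def[abs_def] .
    assume *: "\<forall>i j. mm (\<lambda>i j. r (\<Phi> \<kappa> (Some i) (Some j))) (\<lambda>i j. r (T s0 (Some i) (Some j))) i j
        = mm (\<lambda>i j. r (T s0 (Some i) (Some j))) (\<lambda>i j. r (\<Phi> \<kappa> (Some i) (Some j))) i j"
    have D0: "r (D i j) = 0" for i j unfolding rD using * by simp
    show P0: "r (P' i) = 0" for i using D qs D0 by (simp add: P'_def)
    show "r (Q' j) = 0" for j using D ps PV qV D0 P0 by (simp add: Q'_def T_def)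
  qed
  then show ?thesis by blast
qed

text \<open>For the adjusted representative of \<open>u\<close> the correction is
  \<open>P' i\<close> times the border row of \<open>v\<close>, which is integral. Its residue
  vanishes because \<open>P' i\<close> reduces to 0, as the ten slices commute, or because the row
  does.\<close>

lemma adjusted_product:
  assumes s: "P s0 i0 \<noteq> 0" "Q s0 j0 \<noteq> 0"
    and zP: "\<And>i. (\<Sum>g\<in>UNIV. u g * P (Some g) i) = 0" and zQ: "\<And>j. (\<Sum>g\<in>UNIV. u g * Q (Some g) j) = 0"
    and alt: "(\<exists>g. s0 = Some g) \<or> (\<forall>g j. Q (Some g) j = 0)"
  shows "in_span Z (mm (comb u) (comb v))"
proof -
  have z: "r (\<Phi> (lin u) (Some i) None) = 0" "r (\<Phi> (lin u) None (Some j)) = 0" for i j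
    using zP zQ by (simp_all add: lin_P lin_Q)
  obtain m P' Q' where adj: "adjusted (lin u) s0 m P' Q'"
    using adjust[OF s lin_int z] by blast
  then have A: "m \<in> V" "r m = 0" "\<And>i. P' i \<in> V"
    "\<And>i. \<Phi> (\<lambda>k. lin u k - m * a k s0) (Some i) None = c0 * P' i"
    by (auto simp: adjusted_def)
  define \<kappa>' where "\<kappa>' k = lin u k - m * a k s0" for k
  have \<Phi>': "\<Phi> \<kappa>' i j = \<Phi> (lin u) i j - m * T s0 i j" for i j
    unfolding \<kappa>'_def[abs_def] \<Phi>_diff T_\<Phi> ..
  have tV: "\<Phi> \<kappa>' (Some i) (Some j) \<in> V" "r (\<Phi> \<kappa>' (Some i) (Some j)) = comb u i j" for i j
    using lin_int A(1,2) int by (auto simp: \<Phi>' T_def lin_res)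
  have p': "\<Phi> \<kappa>' (Some i) None = c0 * P' i" for i using A(4) unfolding \<kappa>'_def[abs_def] .
  have corr: "\<Phi> \<kappa>' (Some i) None * \<Phi> (lin v) None (Some j) / c0 = P' i * \<Phi> (lin v) None (Some j)" for i j
    using c0_nz by (simp add: p')
  have cV: "\<Phi> \<kappa>' (Some i) None * \<Phi> (lin v) None (Some j) / c0 \<in> V" for i j
    unfolding corr using A(3) lin_int by simp
  have c0': "r (\<Phi> \<kappa>' (Some i) None * \<Phi> (lin v) None (Some j) / c0) = 0" for i j
    using alt
  proof
    assume "\<exists>g. s0 = Some g"
    then obtain g where g: "s0 = Some g" by blast
    have "(\<lambda>i j. r (T s0 (Some i) (Some j))) = comb (\<lambda>h. of_bool (h = g))"
      by (simp add: fun_eq_iff g T_def res comb_of_bool)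
    then have "\<forall>i j. mm (\<lambda>i j. r (\<Phi> (lin u) (Some i) (Some j))) (\<lambda>i j. r (T s0 (Some i) (Some j))) i j
        = mm (\<lambda>i j. r (T s0 (Some i) (Some j))) (\<lambda>i j. r (\<Phi> (lin u) (Some i) (Some j))) i j"
      by (simp add: lin_res) (simp add: comb_commute)
    then have "\<forall>i. r (P' i) = 0" using adj unfolding adjusted_def by blast
    then show ?thesis unfolding corr using A(3) lin_int by simp
  next
    assume "\<forall>g j. Q (Some g) j = 0"
    then show ?thesis unfolding corr using A(3) lin_int by (simp add: lin_Q)
  qed
  show ?thesis
    using product_in_span[OF tV(1) lin_int(1) cV] by (rule in_span_cong) (simp add: tV(2) lin_res c0')
qed

text \<open>The borders of all slices are proportional to one of them, with factors
  \<open>l\<close>. Elements of the kernel of \<open>l\<close> multiply into the span, so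
  \<open>products_in_span\<close> identifies \<open>l\<close> as a multiple of the coordinate of x.
  If only the new slice had a border, all products would lie in the span.\<close>

lemma border_structure:
  obtains i0 j0 where "P (Some x_idx) i0 \<noteq> 0" "Q (Some x_idx) j0 \<noteq> 0"
    "\<And>g i. g \<noteq> x_idx \<Longrightarrow> P (Some g) i = 0" "\<And>g j. g \<noteq> x_idx \<Longrightarrow> Q (Some g) j = 0"
    "in_span Z (e15 True)"
proof -
  have ex: "\<exists>g i. P g i \<noteq> 0" "\<exists>g j. Q g j \<noteq> 0" using pnz qnz by (simp_all add: P_def Q_def T_def)
  have "\<exists>g i. P (Some g) i \<noteq> 0"
  proof (rule ccontr)
    assume "\<not> ?thesis"
    then have Pz: "P (Some g) i = 0" for g i by blast
    obtain g i where "P g i \<noteq> 0" using ex by blast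
    then have N: "P None i \<noteq> 0" using Pz by (cases g) auto
    note f = rank_one_families[of P Q, OF PQ_sym N ex(2)]
    have Qz: "Q (Some g) j = 0" for g j using f(1)[of "Some g" j] Pz by simp
    obtain j where "Q None j \<noteq> 0" using f(3) by blast
    then have "in_span Z (mm (comb u) (comb v))" for u v
      using adjusted_product[OF N, of j u v] Pz Qz by simp
    then show False using products_in_span(1)[of "\<lambda>_. 0" Z] by simp
  qed
  then obtain g0 i0 where g0: "P (Some g0) i0 \<noteq> 0" by blast
  note f = rank_one_families[of P Q, OF PQ_sym g0 ex(2)]
  obtain j0 where j0: "Q (Some g0) j0 \<noteq> 0" using f(3) by blast
  define l where "l g = P (Some g) i0 / P (Some g0) i0" for g
  have Pl: "P (Some g) i = l g * P (Some g0) i" and Ql: "Q (Some g) j = l g * Q (Some g0) j" for g i j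
    unfolding l_def by (rule f(2), rule f(1))
  have pr: "in_span Z (mm (comb u) (comb v))" if "(\<Sum>g\<in>UNIV. l g * u g) = 0" for u v
  proof (rule adjusted_product[OF g0 j0])
    have "(\<Sum>g\<in>UNIV. u g * P (Some g) i) = (\<Sum>g\<in>UNIV. l g * u g) * P (Some g0) i" for i
      unfolding sum_distrib_right by (rule sum.cong[OF refl], subst Pl) (simp only: mult_ac)
    then show "(\<Sum>g\<in>UNIV. u g * P (Some g) i) = 0" for i using that by simp
    have "(\<Sum>g\<in>UNIV. u g * Q (Some g) j) = (\<Sum>g\<in>UNIV. l g * u g) * Q (Some g0) j" for j
      unfolding sum_distrib_right by (rule sum.cong[OF refl], subst Ql) (simp only: mult_ac)
    then show "(\<Sum>g\<in>UNIV. u g * Q (Some g) j) = 0" for j using that by simp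
  qed simp
  have lx: "l x_idx \<noteq> 0" "\<And>g. g \<noteq> x_idx \<Longrightarrow> l g = 0" "in_span Z (e15 True)"
    by (rule products_in_span(1)[of l Z, OF pr], assumption,
        rule products_in_span(2)[of l Z, OF pr], assumption+,
        rule products_in_span(3)[of l Z, OF pr], assumption)
  show ?thesis
  proof (rule that[of i0 j0, OF _ _ _ _ lx(3)])
    show "P (Some x_idx) i0 \<noteq> 0" using Pl[of x_idx i0] lx(1) g0 by (metis mult_eq_0_iff)
    show "Q (Some x_idx) j0 \<noteq> 0" using Ql[of x_idx j0] lx(1) j0 by (metis mult_eq_0_iff)
    show "P (Some g) i = 0" if "g \<noteq> x_idx" for g i using Pl[of g i] lx(2)[OF that] by (metis mult_zero_left)
    show "Q (Some g) j = 0" if "g \<noteq> x_idx" for g j using Ql[of g j] lx(2)[OF that] by (metis mult_zero_left)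
  qed
qed

end

text \<open>The quotients in \<open>gen_col\<close> and \<open>gen_row\<close> are the border
  entries of a generator after multiplication by the inverse of the unit slice: they say that its
  operators are integral and reduce to the slice itself.\<close>

locale normal_form = place V r + unital a b c
  for V :: "'k::field set" and r and a b c :: "idx option \<Rightarrow> idx option \<Rightarrow> 'k" +
  fixes p q :: "idx \<Rightarrow> complex"
  assumes int: "\<And>g i j. tens a b c g i j \<in> V"
    and res: "\<And>g i j. r (tens a b c g i j) = res3 p q g i j"
    and gen_col: "\<And>g i. g \<in> gens \<Longrightarrow> tens a b c (Some g) i None / tens a b c (Some one_idx) None None \<in> V"
    and gen_row: "\<And>g j. g \<in> gens \<Longrightarrow> tens a b c (Some g) None j / tens a b c (Some one_idx) None None \<in> V"
    and gen_col0: "\<And>g i. g \<in> gens \<Longrightarrow> r (tens a b c (Some g) i None / tens a b c (Some one_idx) None None) = 0"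
    and gen_row0: "\<And>g j. g \<in> gens \<Longrightarrow> r (tens a b c (Some g) None j / tens a b c (Some one_idx) None None) = 0"
    and p_supp: "\<And>i. p i \<noteq> 0 \<Longrightarrow> fst i \<in> {E1, E2} \<and> \<not> snd i"
    and q_supp: "\<And>j. q j \<noteq> 0 \<Longrightarrow> fst j \<in> {E4, E5} \<and> snd j"
    and p_nz: "\<exists>i. p i \<noteq> 0" and q_nz: "\<exists>j. q j \<noteq> 0"

lemma gens_kill:
  assumes p: "\<And>i. p i \<noteq> 0 \<Longrightarrow> fst i \<in> {E1, E2} \<and> \<not> snd i" and g: "g \<in> gens"
  shows "(\<Sum>m\<in>UNIV. std g i m * p m) = 0"
proof (rule sum.neutral, rule ballI)
  fix m
  show "std g i m * p m = 0"
  proof (cases "p m = 0")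
    case False
    then show ?thesis using p[OF False] g by (auto simp: gens_def std_def leit_def dual_def)
  qed simp
qed

lemma e15_pivot: "e15 True (fst (pivot g)) (snd (pivot g)) = 0"
  by (cases "fst g") (auto simp: e15_def pivot_def)

context extended
begin

lemma normal_form_exists: "\<exists>a' p q. normal_form V r a' b c p q"
proof -
  obtain i0 j0 where B: "P (Some x_idx) i0 \<noteq> 0" "Q (Some x_idx) j0 \<noteq> 0"
    "\<And>g i. g \<noteq> x_idx \<Longrightarrow> P (Some g) i = 0" "\<And>g j. g \<noteq> x_idx \<Longrightarrow> Q (Some g) j = 0"
    "in_span Z (e15 True)"
    by (rule border_structure, rule that)
  \<comment> \<open>The unit slice has a zero border already and has to stay exact, hence
    \<open>m = 0\<close> for it.\<close>
  have "\<exists>m P' Q'. adjusted (\<lambda>k. a k (Some g)) (Some x_idx) m P' Q' \<and> (g = one_idx \<longrightarrow> m = 0)" if g: "g \<noteq> x_idx" for g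
  proof (cases "g = one_idx")
    case True
    have "adjusted (\<lambda>k. a k (Some g)) (Some x_idx) 0 (\<lambda>_. 0) (\<lambda>_. 0)"
      unfolding adjusted_def True \<Phi>_diff by (simp add: T_\<Phi>[symmetric] T_def unit_p unit_q)
    then show ?thesis by blast
  next
    case False
    have "\<exists>m P' Q'. adjusted (\<lambda>k. a k (Some g)) (Some x_idx) m P' Q'"
      by (rule adjust[OF B(1,2)])
         (use B(3,4)[OF g] in \<open>simp_all add: T_\<Phi>[symmetric] T_def int pV qV P_def Q_def\<close>)
    then show ?thesis using False by blast
  qed
  then obtain m P' Q' where adj: "\<And>g. g \<noteq> x_idx \<Longrightarrow> adjusted (\<lambda>k. a k (Some g)) (Some x_idx) (m g) (P' g) (Q' g)"
    and m1: "m one_idx = 0" by (metis prod.inject five.distinct(1))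
  have m: "m g \<in> V" "r (m g) = 0" and PV: "P' g i \<in> V" and QV: "Q' g j \<in> V"
    and eP: "\<Phi> (\<lambda>k. a k (Some g) - m g * a k (Some x_idx)) (Some i) None = c0 * P' g i"
    and eQ: "\<Phi> (\<lambda>k. a k (Some g) - m g * a k (Some x_idx)) None (Some j) = c0 * Q' g j"
    and rP: "r (P' g i) = 0" and rQ: "r (Q' g j) = 0" if "g \<noteq> x_idx" for g i j
    using adj[OF that] std_commute unfolding adjusted_def
    by (simp_all add: T_\<Phi>[symmetric] T_def res)
  define e where "e g k = (if g = x_idx then a k (Some x_idx) else a k (Some g) - m g * a k (Some x_idx))" for g k
  have ex: "\<Phi> (e x_idx) = T (Some x_idx)" by (simp add: e_def[abs_def] T_\<Phi>)
  have eg: "\<Phi> (e g) i j = T (Some g) i j - m g * T (Some x_idx) i j" if "g \<noteq> x_idx" for g i j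
    using that \<Phi>_diff[of "\<lambda>k. a k (Some g)" "m g" "\<lambda>k. a k (Some x_idx)" i j] by (simp add: e_def[abs_def] T_\<Phi>)
  have e1: "e one_idx k = a k (Some one_idx)" for k by (simp add: e_def m1)
  have tl: "\<Phi> (e g) (Some i) (Some j) \<in> V" "r (\<Phi> (e g) (Some i) (Some j)) = std g i j" for g i j
    using m[of g] int by (cases "g = x_idx"; simp add: ex eg T_def res)+
  have pe: "\<Phi> (e g) (Some i) None = c0 * P' g i" if "g \<noteq> x_idx" for g i
    using eP[OF that] that by (simp add: e_def[abs_def])
  have qe: "\<Phi> (e g) None (Some j) = c0 * Q' g j" if "g \<noteq> x_idx" for g j
    using eQ[OF that] that by (simp add: e_def[abs_def])
  define px where "px i = T (Some x_idx) (Some i) None" for i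
  define qx where "qx j = T (Some x_idx) None (Some j)" for j
  define sx where "sx = T (Some x_idx) None None"
  have pxV: "px i \<in> V" "r (px i) = P (Some x_idx) i" for i using pV by (simp_all add: px_def T_def P_def)
  have qxV: "qx j \<in> V" "r (qx j) = Q (Some x_idx) j" for j using qV by (simp_all add: qx_def T_def Q_def)
  have ipx: "inverse (px i0) \<in> V" "px i0 \<noteq> 0" using V_inverse[of "px i0"] pxV B(1) by (auto, metis pxV(2) r_0)
  \<comment> \<open>This is c0 x^2: the factor clears the denominator, and the residue is the
    product of the two borders. That rank-one matrix therefore lies in the span, which gives
    \<open>shape\<close>.\<close>
  define \<kappa> where "\<kappa> k = c0 * pr (e x_idx) (e x_idx) k" for k
  have \<kappa>: "\<Phi> \<kappa> i j = c0 * (\<Sum>m\<in>UNIV. T (Some x_idx) i (Some m) * T (Some x_idx) (Some m) j)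
      + T (Some x_idx) i None * T (Some x_idx) None j" for i j
    unfolding \<kappa>_def[abs_def] \<Phi>_scale \<Phi>_pr ex using c0_nz by (simp add: distrib_left)
  have \<kappa>V: "\<Phi> \<kappa> (Some i) (Some j) \<in> V" "r (\<Phi> \<kappa> (Some i) (Some j)) = P (Some x_idx) i * Q (Some x_idx) j" for i j
    using c0_V c0_small int pV qV unfolding \<kappa> by (auto simp: T_def P_def Q_def)
  \<comment> \<open>The border column of c0 x^2 is integral by \<open>expand\<close>, and up to
    integral terms its entry \<open>i0\<close> is the unit \<open>px i0\<close> times
    \<open>sx\<close>.\<close>
  have sxV: "sx \<in> V"
  proof -
    obtain n where n: "\<And>g. n g \<in> V" "\<And>k. \<kappa> k = (\<Sum>g\<in>UNIV. n g * a k g)"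
      "\<And>i j. \<Phi> \<kappa> i j = (\<Sum>g\<in>UNIV. n g * T g i j)"
      by (rule expand[OF \<kappa>V(1)], rule that)
    have "\<Phi> \<kappa> (Some i0) None \<in> V" unfolding n(3) using n(1) pV by (auto simp: T_def)
    then have "\<Phi> \<kappa> (Some i0) None - c0 * (\<Sum>m\<in>UNIV. T (Some x_idx) (Some i0) (Some m) * T (Some x_idx) (Some m) None) \<in> V"
      using c0_V int pV by (intro V_diff V_mult V_sum) (auto simp: T_def)
    then have "px i0 * sx \<in> V" unfolding \<kappa> by (simp add: px_def sx_def)
    then have "inverse (px i0) * (px i0 * sx) \<in> V" by (rule V_mult[OF ipx(1)])
    then show ?thesis using ipx by (simp flip: mult.assoc)
  qed
  have shape: "P (Some x_idx) i \<noteq> 0 \<Longrightarrow> fst i \<in> {E1, E2} \<and> \<not> snd i"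
    "Q (Some x_idx) j \<noteq> 0 \<Longrightarrow> fst j \<in> {E4, E5} \<and> snd j" for i j
  proof -
    obtain u \<eta> where "\<And>i j. r (\<Phi> \<kappa> (Some i) (Some j)) = comb u i j + \<eta> * e15 True i j"
      by (rule in_span_blocks[OF B(5) in_span_residue[OF \<kappa>V(1)]], rule that)
    then have u: "\<And>i j. P (Some x_idx) i * Q (Some x_idx) j = comb u i j + \<eta> * e15 True i j" by (simp only: \<kappa>V(2))
    show "P (Some x_idx) i \<noteq> 0 \<Longrightarrow> fst i \<in> {E1, E2} \<and> \<not> snd i"
      "Q (Some x_idx) j \<noteq> 0 \<Longrightarrow> fst j \<in> {E4, E5} \<and> snd j"
      by (rule rank_one_shape[OF u B(1,2)], assumption)+
  qed
  have kill: "(\<Sum>m\<in>UNIV. std g i m * P (Some x_idx) m) = 0" if "g \<in> gens" for g i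
    by (rule gens_kill[OF shape(1) that])
  \<comment> \<open>Comparing the products of \<open>e g\<close> and x in both orders in the last
    column shows that the border of x is an eigenvector of the slice \<open>g\<close>; the
    eigenvalue is the residue of corner over \<open>c0\<close>. Only the entry \<open>i0\<close> is
    used.\<close>
  have \<sigma>: "\<Phi> (e g) None None / c0 \<in> V"
      "r (\<Phi> (e g) None None / c0) * P (Some x_idx) i0 = (\<Sum>m\<in>UNIV. std g i0 m * P (Some x_idx) m)" if g: "g \<noteq> x_idx" for g
  proof -
    define W where "W = (\<Sum>m\<in>UNIV. \<Phi> (e g) (Some i0) (Some m) * px m) + P' g i0 * sx
        - (\<Sum>m\<in>UNIV. T (Some x_idx) (Some i0) (Some m) * (c0 * P' g m))"
    have "\<Phi> (pr (e g) (e x_idx)) (Some i0) None = \<Phi> (pr (e x_idx) (e g)) (Some i0) None"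
      by (simp add: pr_commute[of "e g"])
    then have W: "px i0 * (\<Phi> (e g) None None / c0) = W"
      unfolding \<Phi>_pr ex pe[OF g] W_def px_def sx_def using c0_nz by (simp add: algebra_simps)
    have WV: "W \<in> V" "r W = (\<Sum>m\<in>UNIV. std g i0 m * P (Some x_idx) m)"
      unfolding W_def using tl pxV PV[OF g] rP[OF g] sxV int c0_V c0_small by (auto simp: T_def)
    have "\<Phi> (e g) None None / c0 = inverse (px i0) * W" using W ipx by (simp flip: mult.assoc add: W[symmetric])
    then show v: "\<Phi> (e g) None None / c0 \<in> V" using WV ipx by simp
    show "r (\<Phi> (e g) None None / c0) * P (Some x_idx) i0 = (\<Sum>m\<in>UNIV. std g i0 m * P (Some x_idx) m)"
      using r_mult[OF pxV(1)[of i0] v] unfolding W WV(2) pxV(2) by (simp add: mult.commute)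
  qed
  have \<sigma>0: "r (\<Phi> (e g) None None / c0) = 0" if "g \<in> gens" for g
    using \<sigma>(2)[of g] kill[OF that] that B(1) by (auto simp: gens_def)
  have sV: "\<Phi> (e g) None None \<in> V" "r (\<Phi> (e g) None None) = 0" if "g \<noteq> x_idx" for g
  proof -
    have "\<Phi> (e g) None None = c0 * (\<Phi> (e g) None None / c0)" using c0_nz by simp
    then show "\<Phi> (e g) None None \<in> V" "r (\<Phi> (e g) None None) = 0"
      using V_mult[OF c0_V \<sigma>(1)[OF that]] r_mult[OF c0_V \<sigma>(1)[OF that]] c0_small by simp_all
  qed
  \<comment> \<open>The new slice was arbitrary up to now. It is replaced by the product y x, whose
    residue is \<open>e15 True\<close> and whose border can be computed.\<close>
  define a' where "a' k = case_option (pr (e y_idx) (e x_idx) k) (\<lambda>g. e g k)" for k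
  have T': "tens a' b c (Some g) i j = \<Phi> (e g) i j" "tens a' b c None i j = \<Phi> (pr (e y_idx) (e x_idx)) i j" for g i j
    by (simp_all add: tens_def \<Phi>_def a'_def)
  have yx: "y_idx \<noteq> x_idx" "y_idx \<in> gens" by (auto simp: gens_def)
  have N: "\<Phi> (pr (e y_idx) (e x_idx)) (Some i) (Some j) \<in> V \<and> r (\<Phi> (pr (e y_idx) (e x_idx)) (Some i) (Some j)) = e15 True i j"
     "\<Phi> (pr (e y_idx) (e x_idx)) (Some i) None \<in> V \<and> r (\<Phi> (pr (e y_idx) (e x_idx)) (Some i) None) = 0"
     "\<Phi> (pr (e y_idx) (e x_idx)) None (Some j) \<in> V \<and> r (\<Phi> (pr (e y_idx) (e x_idx)) None (Some j)) = 0"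
     "\<Phi> (pr (e y_idx) (e x_idx)) None None \<in> V \<and> r (\<Phi> (pr (e y_idx) (e x_idx)) None None) = 0" for i j
  proof -
    define \<sigma>y where "\<sigma>y = \<Phi> (e y_idx) None None / c0"
    have \<sigma>y: "\<sigma>y \<in> V" "r \<sigma>y = 0" unfolding \<sigma>y_def by (rule \<sigma>(1)[OF yx(1)], rule \<sigma>0[OF yx(2)])
    have xT: "T (Some x_idx) (Some i) (Some j) \<in> V" "r (T (Some x_idx) (Some i) (Some j)) = std x_idx i j" for i j
      using int by (simp_all add: T_def res)
    have 1: "\<Phi> (pr (e y_idx) (e x_idx)) (Some i) (Some j)
        = (\<Sum>m\<in>UNIV. \<Phi> (e y_idx) (Some i) (Some m) * T (Some x_idx) (Some m) (Some j)) + P' y_idx i * qx j"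
      unfolding \<Phi>_pr ex pe[OF yx(1)] qx_def using c0_nz by simp
    have "(\<Sum>m\<in>UNIV. std y_idx i m * std x_idx m j) = e15 True i j"
      using mm_std[of y_idx x_idx i j] by (simp add: mm_def e15_def)
    then show "\<Phi> (pr (e y_idx) (e x_idx)) (Some i) (Some j) \<in> V \<and> r (\<Phi> (pr (e y_idx) (e x_idx)) (Some i) (Some j)) = e15 True i j"
      unfolding 1 using tl xT PV[OF yx(1)] qxV rP[OF yx(1)] by auto
    have 2: "\<Phi> (pr (e y_idx) (e x_idx)) (Some i) None
        = (\<Sum>m\<in>UNIV. \<Phi> (e y_idx) (Some i) (Some m) * px m) + P' y_idx i * sx"
      unfolding \<Phi>_pr ex pe[OF yx(1)] px_def sx_def using c0_nz by simp
    show "\<Phi> (pr (e y_idx) (e x_idx)) (Some i) None \<in> V \<and> r (\<Phi> (pr (e y_idx) (e x_idx)) (Some i) None) = 0"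
      unfolding 2 using tl pxV PV[OF yx(1)] sxV rP[OF yx(1)] kill[OF yx(2)] by auto
    have 3: "\<Phi> (pr (e y_idx) (e x_idx)) None (Some j)
        = (\<Sum>m\<in>UNIV. c0 * Q' y_idx m * T (Some x_idx) (Some m) (Some j)) + \<sigma>y * qx j"
      unfolding \<Phi>_pr ex qe[OF yx(1)] qx_def \<sigma>y_def by simp
    show "\<Phi> (pr (e y_idx) (e x_idx)) None (Some j) \<in> V \<and> r (\<Phi> (pr (e y_idx) (e x_idx)) None (Some j)) = 0"
      unfolding 3 using c0_V c0_small QV[OF yx(1)] xT \<sigma>y qxV by auto
    have 4: "\<Phi> (pr (e y_idx) (e x_idx)) None None
        = (\<Sum>m\<in>UNIV. c0 * Q' y_idx m * px m) + \<sigma>y * sx"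
      unfolding \<Phi>_pr ex qe[OF yx(1)] px_def sx_def \<sigma>y_def by simp
    show "\<Phi> (pr (e y_idx) (e x_idx)) None None \<in> V \<and> r (\<Phi> (pr (e y_idx) (e x_idx)) None None) = 0"
      unfolding 4 using c0_V c0_small QV[OF yx(1)] pxV \<sigma>y sxV by auto
  qed
  have ind: "\<mu> = (\<lambda>_. 0)"
    if "\<And>d. (\<Sum>g\<in>UNIV. \<mu> g * r (tens a' b c g (Some (fst d)) (Some (snd d)))) = 0" for \<mu>
  proof -
    have e: "\<mu> None * e15 True i j + comb (\<lambda>g. \<mu> (Some g)) i j = 0" for i j
      using that[of "(i, j)"] by (simp add: sum_option T' tl N comb_def)
    have s: "\<mu> (Some g) = 0" for g
      using e[of "fst (pivot g)" "snd (pivot g)"] by (simp add: e15_pivot comb_pivot)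
    have "\<mu> None = 0" using e[of "(E1, False)" "(E5, True)"] s by (simp add: comb_def e15_def dual_def)
    then have "\<mu> g = 0" for g using s by (cases g) auto
    then show ?thesis by auto
  qed
  have T'V: "tens a' b c g (Some i) (Some j) \<in> V" for g i j by (cases g) (use tl N in \<open>auto simp: T'\<close>)
  have a': "rows_indep a'"
    unfolding rows_indep_def
  proof (intro allI impI)
    fix \<mu> assume z: "\<forall>k. (\<Sum>g\<in>UNIV. \<mu> g * a' k g) = 0"
    show "\<mu> = (\<lambda>_. 0)"
    proof (rule residue_independent[of "\<lambda>g d. tens a' b c g (Some (fst d)) (Some (snd d))"])
      show "(\<Sum>g\<in>UNIV. \<mu> g * tens a' b c g (Some (fst d)) (Some (snd d))) = 0" for d
      proof -
        have "(\<Sum>g\<in>UNIV. \<mu> g * tens a' b c g (Some (fst d)) (Some (snd d)))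
            = \<Phi> (\<lambda>k. \<Sum>g\<in>UNIV. \<mu> g * a' k g) (Some (fst d)) (Some (snd d))"
          unfolding \<Phi>_comb[of \<mu> "\<lambda>g k. a' k g"] by (simp add: tens_def \<Phi>_def)
        then show ?thesis using z by (simp add: \<Phi>_def)
      qed
    qed (use ind T'V in auto)
  qed
  \<comment> \<open>Expand c0 x^2 once more. The coefficient of the slice x, read off at its pivot,
    reduces to 0 by the shape of the border; the other slices have border columns of residue 0. So
    entry \<open>i0\<close> of the border column reduces to 0, but it is also a nonzero number times
    the residue of \<open>sx\<close>.\<close>
  have sx0: "r sx = 0"
  proof -
    obtain n where n: "\<And>k. \<kappa> k = (\<Sum>g\<in>UNIV. n g * a' k g)" using rows_indep_spans[OF a'] by blast
    have \<Phi>n: "\<Phi> \<kappa> i j = (\<Sum>g\<in>UNIV. n g * tens a' b c g i j)" for i j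
      unfolding n[abs_def] \<Phi>_comb[of n "\<lambda>g k. a' k g"] by (simp add: tens_def \<Phi>_def)
    have nV: "n g \<in> V" for g
    proof (rule integral_coeffs[of "\<lambda>g d. tens a' b c g (Some (fst d)) (Some (snd d))"])
      show "(\<Sum>g\<in>UNIV. n g * tens a' b c g (Some (fst d)) (Some (snd d))) \<in> V" for d
        using \<kappa>V(1) unfolding \<Phi>n .
    qed (use ind T'V in auto)
    have "P (Some x_idx) i * Q (Some x_idx) j = r (n None) * e15 True i j + comb (\<lambda>g. r (n (Some g))) i j" for i j
      unfolding \<kappa>V(2)[symmetric] \<Phi>n using nV T'V by (simp add: sum_option T' tl N comb_def)
    from this[of "fst (pivot x_idx)" "snd (pivot x_idx)"]
    have "r (n (Some x_idx)) = P (Some x_idx) (E3, False) * Q (Some x_idx) (E5, False)"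
      unfolding e15_pivot comb_pivot by (simp add: pivot_def)
    then have nx: "r (n (Some x_idx)) = 0" using shape(1)[of "(E3, False)"] by auto
    have V1: "tens a' b c g (Some i0) None \<in> V" and
       V2: "r (n g * tens a' b c g (Some i0) None) = 0" for g
    proof -
      have "tens a' b c g (Some i0) None \<in> V \<and> r (n g * tens a' b c g (Some i0) None) = 0"
      proof (cases g)
        case None then show ?thesis using N nV by (simp add: T')
      next
        case (Some h)
        show ?thesis
        proof (cases "h = x_idx")
          case True then show ?thesis using Some nx nV pxV by (simp add: T' ex flip: px_def)
        next
          case False then show ?thesis
            using Some nV pe[OF False] PV[OF False] c0_V c0_small by (simp add: T')
        qed
      qed
      then show "tens a' b c g (Some i0) None \<in> V" "r (n g * tens a' b c g (Some i0) None) = 0" by auto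
    qed
    have "r (\<Phi> \<kappa> (Some i0) None) = (\<Sum>g\<in>UNIV. r (n g * tens a' b c g (Some i0) None))"
      unfolding \<Phi>n by (rule r_sum) (rule V_mult[OF nV V1])
    then have "r (\<Phi> \<kappa> (Some i0) None) = 0" by (simp only: V2 sum.neutral_const)
    moreover have "r (\<Phi> \<kappa> (Some i0) None) = P (Some x_idx) i0 * r sx"
      unfolding \<kappa> using c0_V c0_small int pV sxV pxV
      by (simp add: px_def sx_def T_def)
    ultimately show ?thesis using B(1) by simp
  qed
  have full: "tens a' b c g i j \<in> V \<and> r (tens a' b c g i j) = res3 (P (Some x_idx)) (Q (Some x_idx)) g i j" for g i j
  proof (cases g)
    case None
    then show ?thesis using N by (cases i; cases j) (simp_all add: T' res3_def)
  next
    case (Some h)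
    show ?thesis
    proof (cases "h = x_idx")
      case True
      then show ?thesis using Some pxV qxV sxV sx0 int
        by (cases i; cases j) (simp_all add: T' ex res3_def px_def qx_def sx_def, simp_all add: T_def res int)
    next
      case False
      then show ?thesis using Some tl sV[OF False] PV[OF False] QV[OF False] c0_V c0_small
        by (cases i; cases j) (simp_all add: T' res3_def pe[OF False] qe[OF False])
    qed
  qed
  have c0': "tens a' b c (Some one_idx) i j = T (Some one_idx) i j" for i j
    by (simp add: T' T_\<Phi> e1[abs_def])
  have c0'': "tens a' b c (Some one_idx) None None = c0" by (simp add: c0' c0_def)
  have "normal_form V r a' b c (P (Some x_idx)) (Q (Some x_idx))"
  proof (unfold_locales, unfold c0'')
    show "rows_indep a'" "rows_indep b" "rows_indep c" by (rule a', rule b, rule c)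
    show "a' k (Some one_idx) \<noteq> 0" for k using a1 by (simp add: a'_def e1)
    show "tens a' b c g i j \<in> V" "r (tens a' b c g i j) = res3 (P (Some x_idx)) (Q (Some x_idx)) g i j" for g i j
      using full by blast+
    show "tens a' b c (Some one_idx) (Some i) (Some j) = (if i = j then 1 else 0)"
      "tens a' b c (Some one_idx) (Some i) None = 0" "tens a' b c (Some one_idx) None (Some j) = 0" for i j
      by (simp_all add: c0' T_def unit unit_p unit_q)
    show "\<exists>i. P (Some x_idx) i \<noteq> 0" "\<exists>i. Q (Some x_idx) i \<noteq> 0" using B by blast+
    fix g assume g: "g \<in> gens"
    then have gx: "g \<noteq> x_idx" by (auto simp: gens_def)
    show "tens a' b c (Some g) i None / c0 \<in> V" "r (tens a' b c (Some g) i None / c0) = 0"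
      "tens a' b c (Some g) None i / c0 \<in> V" "r (tens a' b c (Some g) None i / c0) = 0" for i
      using \<sigma>(1)[OF gx] \<sigma>0[OF g] PV[OF gx] QV[OF gx] rP[OF gx] rQ[OF gx] c0_nz
      by (cases i; simp add: T' pe[OF gx] qe[OF gx])+
  qed (rule shape(1) shape(2), assumption)+
  then show ?thesis by blast
qed

end

section \<open>The tangent space of the orbit of the unit tensor\<close>

text \<open>
  Unknowns of the equations: \<open>OT\<close> for a first-order variation of the tensor, and \<open>OA u\<close>, \<open>OB u\<close>,
  \<open>OC u\<close> for the variations of the three multiplication operators of a generator \<open>u\<close>.
\<close>

datatype outc = OT "idx option" "idx option" "idx option" | OA idx "idx option" "idx option"
  | OB idx "idx option" "idx option" | OC idx "idx option" "idx option"

definition outs :: "outc set" where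
  "outs = (\<lambda>(g, i, j). OT g i j) ` UNIV \<union> (\<lambda>(u, g, h). OA u g h) ` (gens \<times> UNIV)
     \<union> (\<lambda>(u, g, h). OB u g h) ` (gens \<times> UNIV) \<union> (\<lambda>(u, g, h). OC u g h) ` (gens \<times> UNIV)"

lemma finite_outs [simp]: "finite outs"
  by (simp add: outs_def)

lemma outsI: "OT g i j \<in> outs" "u \<in> gens \<Longrightarrow> OA u g i \<in> outs" "u \<in> gens \<Longrightarrow> OB u i j \<in> outs" "u \<in> gens \<Longrightarrow> OC u i j \<in> outs"
  unfolding outs_def
  using imageI[of "(g, i, j)" UNIV "\<lambda>(g, i, j). OT g i j"] imageI[of "(u, g, i)" "gens \<times> UNIV" "\<lambda>(u, g, h). OA u g h"]
    imageI[of "(u, i, j)" "gens \<times> UNIV" "\<lambda>(u, g, h). OB u g h"] imageI[of "(u, i, j)" "gens \<times> UNIV" "\<lambda>(u, g, h). OC u g h"]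
  by simp_all

text \<open>
  The product of the generator \<open>u\<close> with slice \<open>g\<close> is slice \<open>mul u g\<close>, or zero for \<open>None\<close>; it is not
  correct for \<open>u = x\<close>, which is not a generator.
\<close>

definition mul :: "idx \<Rightarrow> idx option \<Rightarrow> idx option option" where
  "mul u g = (case g of None \<Rightarrow> None | Some g \<Rightarrow>
     if snd u \<and> snd g then None else if fst u = E1 then Some (Some (fst g, snd u \<or> snd g))
     else if fst g = E1 then Some (Some (fst u, snd u \<or> snd g))
     else if fst u = E2 \<and> fst g = E2 then Some None else None)"

definition at_mul :: "(idx option \<Rightarrow> complex) \<Rightarrow> idx \<Rightarrow> idx option \<Rightarrow> complex" where
  "at_mul f u g = (case mul u g of None \<Rightarrow> 0 | Some h \<Rightarrow> f h)"

type_synonym param = "(idx option \<times> idx option \<times> idx option) + (idx \<times> idx option)"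

text \<open>\<open>Inl (l, k, m)\<close> is the coefficient of the product of the l-th vector of
  \<open>a\<close>, the k-th of \<open>b\<close> and the m-th of \<open>c\<close>. Changing one
  factor of a term produces triples with two equal indices, and these span the tangent space.
  \<open>Inr (u, k)\<close> varies the eigenvalue of \<open>u\<close> on the k-th term.\<close>

definition params :: "param set" where
  "params = Inl ` {(l, k, m). l = k \<or> k = m \<or> l = m} \<union> Inr ` (gens \<times> UNIV)"

lemma card_five [simp]: "CARD(five) = 5"
  by (simp add: UNIV_five)

lemma card_idx_option: "CARD(idx option) = 11"
  by (simp add: UNIV_five card_UNIV_option card_UNIV_bool)

lemma card_gens: "card gens = 5"
  by (simp add: gens_def)

lemma finite_params [simp]: "finite params"
proof -
  have "finite gens" by (simp add: gens_def)
  then show ?thesis unfolding params_def by simp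
qed

lemma card_params: "card params = 396"
proof -
  let ?U = "UNIV :: idx option set"
  let ?D = "?U \<times> ?U - (\<lambda>k. (k, k)) ` ?U"
  have D: "card ?D = 110"
    by (subst card_Diff_subset)
      (auto simp: card_cartesian_product card_image inj_on_def card_idx_option simp del: card_option card_UNIV_option simp flip: UNIV_Times_UNIV)
  \<comment> \<open>The triples are split disjointly by which two indices agree: 121 with the first
    two equal, then twice 110 pairs off the diagonal.\<close>
  have e: "{(l, k, m). l = k \<or> k = m \<or> l = m}
     = (\<lambda>(k, m). (k, k, m)) ` (?U \<times> ?U) \<union> ((\<lambda>(l, k). (l, k, k)) ` ?D \<union> (\<lambda>(l, k). (l, k, l)) ` ?D)"
    (is "?N = ?A \<union> (?B \<union> ?C)")
    by (auto simp: image_iff Bex_def split_paired_Ex split_paired_All)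
  have "card ?A = 121"
    by (subst card_image) (auto simp: inj_on_def card_cartesian_product card_idx_option)
  moreover have "card ?B = 110" "card ?C = 110"
    by (subst card_image, force simp: inj_on_def, rule D)+
  moreover have "card (?A \<union> (?B \<union> ?C)) = card ?A + card (?B \<union> ?C)"
    by (rule card_Un_disjoint) auto
  moreover have "card (?B \<union> ?C) = card ?B + card ?C"
    by (rule card_Un_disjoint) auto
  ultimately have N: "card ?N = 341" unfolding e by simp
  have "card params = card (Inl ` ?N :: param set) + card (Inr ` (gens \<times> ?U) :: param set)"
    unfolding params_def by (rule card_Un_disjoint) (auto simp: gens_def)
  also have "\<dots> = 396"
    using N by (simp add: card_image card_cartesian_product card_gens card_idx_option)
  finally show ?thesis .
qed

definition lin_form :: "((param \<Rightarrow> 'k::field) \<Rightarrow> 'k) \<Rightarrow> bool" where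
  "lin_form f \<longleftrightarrow> (\<exists>M. \<forall>x. f x = (\<Sum>i\<in>UNIV. M i * x i))"

lemma lin_form_coord: "lin_form (\<lambda>x. x i)"
  unfolding lin_form_def
  by (rule exI[of _ "\<lambda>j. if j = i then 1 else 0"]) (simp add: if_distrib[of "\<lambda>x. x * _"] cong: if_cong)

lemma lin_form_zero: "lin_form (\<lambda>x. 0)"
  unfolding lin_form_def by (rule exI[of _ "\<lambda>_. 0"]) simp

lemma lin_form_add: "lin_form f \<Longrightarrow> lin_form h \<Longrightarrow> lin_form (\<lambda>x. f x + h x)"
  unfolding lin_form_def
  by (elim exE, rule_tac x = "\<lambda>i. M i + Ma i" in exI) (simp add: distrib_right sum.distrib)

lemma lin_form_mult: "lin_form f \<Longrightarrow> lin_form (\<lambda>x. w * f x)"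
  unfolding lin_form_def
  by (elim exE, rule_tac x = "\<lambda>i. w * M i" in exI) (simp add: sum_distrib_left mult.assoc)

lemma lin_form_mult': "lin_form f \<Longrightarrow> lin_form (\<lambda>x. f x * w)"
  using lin_form_mult[of f w] by (simp add: mult.commute)

lemma lin_form_sum: "(\<And>i. i \<in> I \<Longrightarrow> lin_form (f i)) \<Longrightarrow> lin_form (\<lambda>x. \<Sum>i\<in>I. f i x)"
  by (induction I rule: infinite_finite_induct) (auto intro: lin_form_zero lin_form_add)

lemma lin_form_if: "lin_form f \<Longrightarrow> lin_form h \<Longrightarrow> lin_form (\<lambda>x. if P then f x else h x)"
  by (cases P) auto

lemmas lin_form_intros = lin_form_coord lin_form_add lin_form_mult lin_form_mult' lin_form_sum lin_form_if

section \<open>First-order variations of the tensor and of its multiplication operators\<close>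

context normal_form
begin

text \<open>Passes from a matrix in the bases \<open>b\<close>, \<open>c\<close> to standard
  coordinates; \<open>\<Phi>\<close> is the diagonal case.\<close>

definition Psi :: "(idx option \<Rightarrow> idx option \<Rightarrow> 'k) \<Rightarrow> idx option \<Rightarrow> idx option \<Rightarrow> 'k" where
  "Psi S i j = (\<Sum>k\<in>UNIV. \<Sum>l\<in>UNIV. S k l * b k i * c l j)"

lemma Psi_add: "Psi (\<lambda>k l. S k l + S' k l) i j = Psi S i j + Psi S' i j"
  by (simp add: Psi_def distrib_right sum.distrib)

lemma Psi_sum: "Psi (\<lambda>k l. \<Sum>h\<in>H. n h * S h k l) i j = (\<Sum>h\<in>H. n h * Psi (S h) i j)"
proof -
  have "Psi (\<lambda>k l. \<Sum>h\<in>H. n h * S h k l) i j = (\<Sum>k\<in>UNIV. \<Sum>l\<in>UNIV. \<Sum>h\<in>H. n h * (S h k l * b k i * c l j))"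
    by (simp add: Psi_def sum_distrib_right mult.assoc)
  also have "\<dots> = (\<Sum>k\<in>UNIV. \<Sum>h\<in>H. \<Sum>l\<in>UNIV. n h * (S h k l * b k i * c l j))"
    by (rule sum.cong[OF refl], rule sum.swap)
  also have "\<dots> = (\<Sum>h\<in>H. \<Sum>k\<in>UNIV. \<Sum>l\<in>UNIV. n h * (S h k l * b k i * c l j))"
    by (rule sum.swap)
  finally show ?thesis by (simp add: Psi_def sum_distrib_left)
qed

lemma Psi_diag: "Psi (\<lambda>k l. if k = l then f k else 0) i j = \<Phi> f i j"
  by (simp add: Psi_def \<Phi>_def if_distrib[of "\<lambda>x. x * _"] cong: if_cong)

lemma Psi_zero:
  assumes "\<And>i j. Psi S i j = 0"
  shows "S k l = 0"
proof -
  have "(\<Sum>l\<in>UNIV. S k l * c l j) = 0" for k j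
  proof (rule rows_indep_columns[OF b, of "\<lambda>k. \<Sum>l\<in>UNIV. S k l * c l j"])
    fix i
    show "(\<Sum>k\<in>UNIV. (\<Sum>l\<in>UNIV. S k l * c l j) * b k i) = 0"
      using assms[of i j] by (simp add: Psi_def sum_distrib_right sum_distrib_left mult_ac)
  qed
  then show ?thesis by (intro rows_indep_columns[OF c, of "S k"]) simp
qed

text \<open>The same computation as \<open>\<Phi>_pr\<close> for matrices that are no longer
  diagonal: \<open>R\<close> between the factors turns into the weights
  \<open>1 / a h (Some one_idx)\<close>.\<close>

lemma Psi_mult: "(\<Sum>m\<in>UNIV. Psi S i m * R m * Psi S' m j)
    = Psi (\<lambda>k l. \<Sum>h\<in>UNIV. S k h / a h (Some one_idx) * S' h l) i j"
proof -
  have R_inverse': "(\<Sum>m\<in>UNIV. c h m * R m * (\<Sum>h'\<in>UNIV. b h' m * z h')) = z h / a h (Some one_idx)" for h z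
  proof -
    have "(\<Sum>m\<in>UNIV. c h m * R m * (\<Sum>h'\<in>UNIV. b h' m * z h')) = (\<Sum>h'\<in>UNIV. (\<Sum>m\<in>UNIV. c h m * R m * b h' m) * z h')"
      unfolding sum_distrib_left sum_distrib_right by (subst sum.swap) (simp only: mult.assoc)
    also have "\<dots> = (\<Sum>h'\<in>UNIV. if h = h' then z h' / a h (Some one_idx) else 0)"
      unfolding R_inverse by (intro sum.cong) auto
    finally show ?thesis by simp
  qed
  have right: "Psi S' m j = (\<Sum>h\<in>UNIV. b h m * (\<Sum>l\<in>UNIV. S' h l * c l j))" for m
    by (simp add: Psi_def sum_distrib_left mult_ac)
  have left: "Psi S i m = (\<Sum>h\<in>UNIV. (\<Sum>k\<in>UNIV. S k h * b k i) * c h m)" for m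
    unfolding Psi_def sum_distrib_right by (rule sum.swap)
  have "(\<Sum>m\<in>UNIV. Psi S i m * R m * Psi S' m j)
      = (\<Sum>m\<in>UNIV. \<Sum>h\<in>UNIV. (\<Sum>k\<in>UNIV. S k h * b k i) * (c h m * R m * Psi S' m j))"
    unfolding left sum_distrib_right by (simp only: mult.assoc)
  also have "\<dots> = (\<Sum>h\<in>UNIV. (\<Sum>k\<in>UNIV. S k h * b k i) * (\<Sum>m\<in>UNIV. c h m * R m * Psi S' m j))"
    unfolding sum_distrib_left by (rule sum.swap)
  also have "\<dots> = (\<Sum>h\<in>UNIV. (\<Sum>k\<in>UNIV. S k h * b k i) * ((\<Sum>l\<in>UNIV. S' h l * c l j) / a h (Some one_idx)))"
    unfolding right R_inverse' ..
  also have "\<dots> = (\<Sum>h\<in>UNIV. \<Sum>k\<in>UNIV. \<Sum>l\<in>UNIV. S k h / a h (Some one_idx) * S' h l * b k i * c l j)"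
    unfolding sum_divide_distrib sum_product by (simp add: mult_ac)
  also have "\<dots> = (\<Sum>k\<in>UNIV. \<Sum>h\<in>UNIV. \<Sum>l\<in>UNIV. S k h / a h (Some one_idx) * S' h l * b k i * c l j)"
    by (rule sum.swap)
  also have "\<dots> = (\<Sum>k\<in>UNIV. \<Sum>l\<in>UNIV. \<Sum>h\<in>UNIV. S k h / a h (Some one_idx) * S' h l * b k i * c l j)"
    by (rule sum.cong[OF refl], rule sum.swap)
  finally show ?thesis by (simp add: Psi_def sum_distrib_right)
qed

lemma T_Psi: "T g i j = Psi (\<lambda>k l. if k = l then a k g else 0) i j"
  by (simp add: Psi_diag T_\<Phi>)

text \<open>The operator of \<open>u\<close> is diagonal in the bases, with eigenvalues
  \<open>\<omega> u k\<close>. A variation \<open>S\<close> of the slices determines the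
  off-diagonal parts of the varied operators \<open>\<alpha>\<close>, \<open>\<beta>\<close>,
  \<open>\<gamma>\<close>, through differences of eigenvalues; the free eigenvalue variation is
  common to all three factors.\<close>

definition \<omega> where "\<omega> u k = a k (Some u) / a k (Some one_idx)"

definition S where "S x g k l = (\<Sum>h\<in>UNIV. x (Inl (h, k, l)) * a h g)"

definition \<alpha> where "\<alpha> x u g k = x (Inr (u, k)) * a k g + (\<Sum>l\<in>UNIV. x (Inl (l, k, k)) * ((\<omega> u k - \<omega> u l) * a l g))"

definition \<beta> where "\<beta> x u k l = (if k = l then x (Inr (u, k)) else x (Inl (k, k, l)) * (\<omega> u k - \<omega> u l))"

definition \<gamma> where "\<gamma> x u k l = (if k = l then x (Inr (u, k)) else x (Inl (l, k, l)) * (\<omega> u l - \<omega> u k))"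

definition ad where "ad k = (SOME n. \<forall>k'. of_bool (k' = k) = (\<Sum>h\<in>UNIV. n h * a k' h))"

lemma ad: "(\<Sum>h\<in>UNIV. ad k h * a k' h) = of_bool (k' = k)"
proof -
  obtain n where n: "\<And>k'. of_bool (k' = k) = (\<Sum>h\<in>UNIV. n h * a k' h)"
    by (rule rows_indep_spans[OF a, of "\<lambda>k'. of_bool (k' = k)"], rule that)
  have "\<exists>n. \<forall>k'. of_bool (k' = k) = (\<Sum>h\<in>UNIV. n h * a k' h)"
    by (rule exI[of _ n], intro allI, rule n)
  from someI_ex[OF this, folded ad_def, rule_format, of k'] show ?thesis by (rule sym)
qed

text \<open>The operators on the second and third factor are written in standard coordinates; their
  factors \<open>a k (Some one_idx)\<close> cancel the weights of \<open>Psi_mult\<close>.\<close>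

fun val where
  "val x (OT g i j) = Psi (S x g) i j"
| "val x (OA u g h) = (\<Sum>k\<in>UNIV. \<alpha> x u g k * ad k h)"
| "val x (OB u m j) = R m * Psi (\<lambda>k l. a k (Some one_idx) * \<beta> x u k l) m j"
| "val x (OC u i m) = Psi (\<lambda>k l. \<gamma> x u k l * a l (Some one_idx)) i m * R m"

lemma lin_val: "lin_form (\<lambda>x. val x out)"
  by (cases out) (auto simp: Psi_def S_def \<alpha>_def \<beta>_def \<gamma>_def intro!: lin_form_intros)

lemma OA_expand: "(\<Sum>h\<in>UNIV. val x (OA u g h) * a k h) = \<alpha> x u g k"
proof -
  have "(\<Sum>h\<in>UNIV. val x (OA u g h) * a k h) = (\<Sum>k'\<in>UNIV. \<alpha> x u g k' * (\<Sum>h\<in>UNIV. ad k' h * a k h))"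
    by (simp add: sum_distrib_right sum_distrib_left mult.assoc) (rule sum.swap)
  also have "\<dots> = (\<Sum>k'\<in>UNIV. if k' = k then \<alpha> x u g k else 0)"
    by (intro sum.cong) (auto simp: ad)
  finally show ?thesis by simp
qed

text \<open>The \<open>OT\<close> coordinates determine the \<open>Inl\<close> parameters, since
  \<open>a\<close>, \<open>b\<close>, \<open>c\<close> are bases, and the diagonal of
  \<open>\<beta>\<close> determines the \<open>Inr\<close> parameters.\<close>

lemma val_zero:
  assumes supp: "\<And>i. i \<notin> params \<Longrightarrow> x i = 0" and z: "\<And>out. out \<in> outs \<Longrightarrow> val x out = 0"
  shows "x i = 0"
proof -
  have "Psi (S x g) i j = 0" for g i j using z[OF outsI(1)[of g i j]] by simp
  then have "S x g k l = 0" for g k l by (rule Psi_zero)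
  then have l: "x (Inl (h, k, l)) = 0" for h k l
    by (intro rows_indep_columns[OF a, of "\<lambda>h. x (Inl (h, k, l))"]) (simp add: S_def)
  have r: "x (Inr (u, k)) = 0" if u: "u \<in> gens" for u k
  proof -
    have "Psi (\<lambda>k l. a k (Some one_idx) * \<beta> x u k l) m j = 0" for m j
      using z[OF outsI(3)[OF u, of m j]] c0_nz by (cases m) (simp_all add: R_def)
    then have "a k (Some one_idx) * \<beta> x u k k = 0" by (rule Psi_zero)
    then show ?thesis using a1[of k] by (simp add: \<beta>_def)
  qed
  show ?thesis
  proof (cases i)
    case (Inl t) then show ?thesis using l by (cases t) auto
  next
    case (Inr t)
    then show ?thesis using r supp[of i] by (cases t) (auto simp: params_def)
  qed
qed

text \<open>\<open>u\<close> acts in the same way through each of the three factors; differentiating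
  gives one equation for the first and second factor and one for the first and third. In the bases
  \<open>b\<close>, \<open>c\<close> they can be checked entry by entry.\<close>

lemma val_equation:
  assumes supp: "\<And>h k l. h \<noteq> k \<Longrightarrow> k \<noteq> l \<Longrightarrow> h \<noteq> l \<Longrightarrow> x (Inl (h, k, l)) = 0"
    and n: "\<And>k. \<omega> u k * a k g = (\<Sum>h\<in>UNIV. n h * a k h)"
  shows "(\<Sum>h\<in>UNIV. n h * val x (OT h i j)) + (\<Sum>h\<in>UNIV. val x (OA u g h) * T h i j)
      = (\<Sum>m\<in>UNIV. val x (OT g i m) * (R m * T (Some u) m j)) + (\<Sum>m\<in>UNIV. T g i m * val x (OB u m j))" (is "?L = ?R1")
    and "(\<Sum>h\<in>UNIV. n h * val x (OT h i j)) + (\<Sum>h\<in>UNIV. val x (OA u g h) * T h i j)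
      = (\<Sum>m\<in>UNIV. (T (Some u) i m * R m) * val x (OT g m j)) + (\<Sum>m\<in>UNIV. val x (OC u i m) * T g m j)" (is "?L = ?R2")
proof -
  have nS: "(\<Sum>h\<in>UNIV. n h * S x h k l) = (\<Sum>l'\<in>UNIV. x (Inl (l', k, l)) * (\<omega> u l' * a l' g))" for k l
    unfolding S_def n sum_distrib_left by (subst sum.swap) (simp add: mult_ac)
  have L: "?L = Psi (\<lambda>k l. (\<Sum>h\<in>UNIV. n h * S x h k l) + (if k = l then \<alpha> x u g k else 0)) i j"
  proof -
    have "(\<Sum>h\<in>UNIV. val x (OA u g h) * T h i j) = Psi (\<lambda>k l. \<Sum>h\<in>UNIV. val x (OA u g h) * (if k = l then a k h else 0)) i j"
      unfolding T_Psi by (rule Psi_sum[symmetric])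
    also have "\<dots> = Psi (\<lambda>k l. if k = l then \<alpha> x u g k else 0) i j"
    proof -
      have "(\<lambda>k l. \<Sum>h\<in>UNIV. val x (OA u g h) * (if k = l then a k h else 0)) = (\<lambda>k l. if k = l then \<alpha> x u g k else 0)"
        using OA_expand[of x u g] by (intro ext) (simp del: val.simps)
      then show ?thesis by simp
    qed
    finally show ?thesis unfolding Psi_add by (simp add: Psi_sum)
  qed
  have delta: "(\<Sum>h\<in>UNIV. f h * (if h = l then z h else 0)) = f l * z l"
     "(\<Sum>h\<in>UNIV. f h * (if h = l then z h else 0) / a h (Some one_idx)) = f l * z l / a l (Some one_idx)"
     "(\<Sum>h\<in>UNIV. (if k = h then y else 0) * f h / a h (Some one_idx)) = y * f k / a k (Some one_idx)"
     "(\<Sum>h\<in>UNIV. (if k = h then z h else 0) * f h) = z k * f k"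
     "(\<Sum>h\<in>UNIV. (if k = h then z k else 0) / a h (Some one_idx) * f h) = z k / a k (Some one_idx) * f k"
    for f z :: "idx option \<Rightarrow> 'k" and y k l
    by (simp_all add: if_distrib[of "(*) _"] if_distrib[of "\<lambda>x. x * _"] if_distrib[of "\<lambda>x. x / _"] cong: if_cong)
  have R1: "?R1 = Psi (\<lambda>k l. S x g k l * \<omega> u l + a k g * \<beta> x u k l) i j"
  proof -
    have 1: "(\<Sum>m\<in>UNIV. val x (OT g i m) * (R m * T (Some u) m j)) = Psi (\<lambda>k l. S x g k l * \<omega> u l) i j"
      using Psi_mult[of "S x g" i "\<lambda>k l. if k = l then a k (Some u) else 0" j]
      by (simp add: T_Psi delta \<omega>_def mult.assoc)
    have 2: "(\<Sum>m\<in>UNIV. T g i m * val x (OB u m j)) = Psi (\<lambda>k l. a k g * \<beta> x u k l) i j"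
      using Psi_mult[of "\<lambda>k l. if k = l then a k g else 0" i "\<lambda>k l. a k (Some one_idx) * \<beta> x u k l" j] a1
      by (simp add: T_Psi delta mult.assoc)
    show ?thesis unfolding 1 2 Psi_add ..
  qed
  have R2: "?R2 = Psi (\<lambda>k l. \<omega> u k * S x g k l + \<gamma> x u k l * a l g) i j"
  proof -
    have 1: "(\<Sum>m\<in>UNIV. (T (Some u) i m * R m) * val x (OT g m j)) = Psi (\<lambda>k l. \<omega> u k * S x g k l) i j"
      using Psi_mult[of "\<lambda>k l. if k = l then a k (Some u) else 0" i "S x g" j]
      by (simp add: T_Psi delta \<omega>_def mult.assoc)
    have 2: "(\<Sum>m\<in>UNIV. val x (OC u i m) * T g m j) = Psi (\<lambda>k l. \<gamma> x u k l * a l g) i j"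
      using Psi_mult[of "\<lambda>k l. \<gamma> x u k l * a l (Some one_idx)" i "\<lambda>k l. if k = l then a k g else 0" j] a1
      by (simp add: T_Psi delta mult.assoc)
    show ?thesis unfolding 1 2 Psi_add ..
  qed
  have dS: "(\<Sum>l'\<in>UNIV. x (Inl (l', k, l)) * (\<omega> u l' * a l' g)) = S x g k l * w + (\<Sum>l'\<in>UNIV. x (Inl (l', k, l)) * ((\<omega> u l' - w) * a l' g))" for k l w
    by (simp add: S_def left_diff_distrib right_diff_distrib sum_subtractf sum_distrib_left mult_ac)
  have al: "\<alpha> x u g k + (\<Sum>l'\<in>UNIV. x (Inl (l', k, k)) * ((\<omega> u l' - \<omega> u k) * a l' g)) = x (Inr (u, k)) * a k g" for k
    by (simp add: \<alpha>_def algebra_simps flip: sum.distrib)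
  \<comment> \<open>Off the diagonal the support condition leaves just the terms with
    \<open>l'\<close> equal to \<open>k\<close> or \<open>l\<close>; one of them vanishes for
    suitable \<open>w\<close>, and \<open>\<beta>\<close> or \<open>\<gamma>\<close> absorbs the
    other.\<close>
  have only: "(\<Sum>l'\<in>UNIV. x (Inl (l', k, l)) * ((\<omega> u l' - w) * a l' g))
      = x (Inl (k, k, l)) * ((\<omega> u k - w) * a k g) + x (Inl (l, k, l)) * ((\<omega> u l - w) * a l g)" if "k \<noteq> l" for k l w
  proof -
    have "(\<Sum>l'\<in>UNIV. x (Inl (l', k, l)) * ((\<omega> u l' - w) * a l' g))
      = (\<Sum>l'\<in>{k, l}. x (Inl (l', k, l)) * ((\<omega> u l' - w) * a l' g))"
      by (rule sum.mono_neutral_right) (use that supp in auto)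
    then show ?thesis using that by simp
  qed
  have "(\<Sum>h\<in>UNIV. n h * S x h k l) + (if k = l then \<alpha> x u g k else 0) = S x g k l * \<omega> u l + a k g * \<beta> x u k l" for k l
  proof (cases "k = l")
    case True
    then show ?thesis using al[of l] unfolding nS dS[of k l "\<omega> u l"] by (simp add: \<beta>_def algebra_simps)
  next
    case False
    then show ?thesis unfolding nS dS[of k l "\<omega> u l"] only[OF False] by (simp add: \<beta>_def algebra_simps)
  qed
  then show "?L = ?R1" unfolding L R1 by simp
  have "(\<Sum>h\<in>UNIV. n h * S x h k l) + (if k = l then \<alpha> x u g k else 0) = \<omega> u k * S x g k l + \<gamma> x u k l * a l g" for k l
  proof (cases "k = l")
    case True
    then show ?thesis using al[of l] unfolding nS dS[of k l "\<omega> u k"] by (simp add: \<gamma>_def algebra_simps)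
  next
    case False
    then show ?thesis unfolding nS dS[of k l "\<omega> u k"] only[OF False] by (simp add: \<gamma>_def algebra_simps)
  qed
  then show "?L = ?R2" unfolding L R2 by simp
qed

lemma res_top_indep:
  assumes "\<And>i j. (\<Sum>g\<in>UNIV. \<mu> g * res3 p q g (Some i) (Some j)) = 0"
  shows "\<mu> = (\<lambda>_. 0)"
proof -
  have e: "\<mu> None * e15 True i j + comb (\<lambda>g. \<mu> (Some g)) i j = 0" for i j
    using assms[of i j] by (simp add: sum_option res3_def comb_def)
  have s: "\<mu> (Some g) = 0" for g
    using e[of "fst (pivot g)" "snd (pivot g)"]
    by (simp add: e15_pivot comb_def std_pivot if_distrib[of "\<lambda>x. _ * x"] cong: if_cong)
  have "\<mu> None = 0"
    using e[of "(E1, False)" "(E5, True)"] by (simp add: s comb_def e15_def dual_def)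
  with s show ?thesis by (intro ext, rename_tac g, case_tac g) auto
qed

lemma res_mult:
  assumes u: "u \<in> gens"
  shows "(\<Sum>m\<in>UNIV. res3 p q g (Some i) (Some m) * std u m j) = at_mul (\<lambda>h. res3 p q h (Some i) (Some j)) u g"
proof (cases g)
  case None
  have "e15 True i m * std u m j = 0" for m
    using u by (auto simp: gens_def e15_def std_def leit_def dual_def)
  then have "(\<Sum>m\<in>UNIV. e15 True i m * std u m j) = 0" by (intro sum.neutral) simp
  then show ?thesis using None by (simp add: res3_def at_mul_def mul_def)
next
  case (Some g')
  have "(\<Sum>m\<in>UNIV. res3 p q g (Some i) (Some m) * std u m j) = mm (std g') (std u) i j"
    by (simp add: Some res3_def mm_def)
  also have "\<dots> = at_mul (\<lambda>h. res3 p q h (Some i) (Some j)) u g"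
    unfolding mm_std Some using u
    by (cases "fst g'"; cases g'; cases "snd g'") (auto simp: gens_def at_mul_def mul_def res3_def std_def e15_def)
  finally show ?thesis .
qed

text \<open>\<open>R\<close> divides the last row or column by c0. This is where the generators need
  borders divisible by c0 with quotients of residue 0.\<close>

lemma row_div: "u \<in> gens \<Longrightarrow> R m * T (Some u) m j \<in> V" "u \<in> gens \<Longrightarrow> r (R m * T (Some u) m j) = res3 p q (Some u) m j"
    "u \<in> gens \<Longrightarrow> T (Some u) i m * R m \<in> V" "u \<in> gens \<Longrightarrow> r (T (Some u) i m * R m) = res3 p q (Some u) i m"
proof -
  have x: "u \<noteq> x_idx" if "u \<in> gens" using that by (auto simp: gens_def)
  show "u \<in> gens \<Longrightarrow> R m * T (Some u) m j \<in> V" "u \<in> gens \<Longrightarrow> r (R m * T (Some u) m j) = res3 p q (Some u) m j"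
    using gen_row[of u j] gen_row0[of u j] int res x
    by (cases m; cases j; simp add: R_def T_def c0_def res3_def)+
  show "u \<in> gens \<Longrightarrow> T (Some u) i m * R m \<in> V" "u \<in> gens \<Longrightarrow> r (T (Some u) i m * R m) = res3 p q (Some u) i m"
    using gen_col[of u i] gen_col0[of u i] int res x
    by (cases m; cases i; simp add: R_def T_def c0_def res3_def)+
qed

text \<open>The product of \<open>u\<close> with a slice is integral by \<open>row_div\<close>, so
  its coefficients are integral by independence of the residues, and their residues are found from
  \<open>res_mult\<close>.\<close>

lemma mul_coeff:
  assumes u: "u \<in> gens"
  obtains n where "\<And>k. \<omega> u k * a k g = (\<Sum>h\<in>UNIV. n h * a k h)" "\<And>h. n h \<in> V"
    "\<And>f. (\<Sum>h\<in>UNIV. r (n h) * f h) = at_mul f u g"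
proof -
  obtain n where n: "\<And>k. \<omega> u k * a k g = (\<Sum>h\<in>UNIV. n h * a k h)"
    by (rule rows_indep_spans[OF a, of "\<lambda>k. \<omega> u k * a k g"], rule that)
  have pr: "(\<Sum>h\<in>UNIV. n h * T h i j) = (\<Sum>m\<in>UNIV. T g i m * (R m * T (Some u) m j))" for i j
  proof -
    have "(\<Sum>h\<in>UNIV. n h * T h i j) = \<Phi> (\<lambda>k. \<Sum>h\<in>UNIV. n h * a k h) i j"
      unfolding \<Phi>_comb by (simp add: T_\<Phi>)
    also have "(\<lambda>k. \<Sum>h\<in>UNIV. n h * a k h) = pr (\<lambda>k. a k g) (\<lambda>k. a k (Some u))"
      unfolding n[symmetric] by (simp add: pr_def \<omega>_def mult_ac fun_eq_iff)
    finally show ?thesis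
      unfolding \<Phi>_pr by (simp add: T_\<Phi>[symmetric] sum_option R_def)
  qed
  have TV: "T g i j \<in> V" "r (T g i j) = res3 p q g i j" for g i j
    using int res by (simp_all add: T_def)
  have nV: "n h \<in> V" for h
  proof (rule integral_coeffs[of "\<lambda>h (i, j). T h (Some i) (Some j)"])
    fix d :: "idx \<times> idx"
    obtain i j where d: "d = (i, j)" by (cases d)
    have "(\<Sum>h\<in>UNIV. n h * T h (Some i) (Some j)) \<in> V"
      unfolding pr using TV row_div(1)[OF u] by auto
    then show "(\<Sum>h\<in>UNIV. n h * (case d of (i, j) \<Rightarrow> T h (Some i) (Some j))) \<in> V" by (simp add: d)
    show "(case d of (i, j) \<Rightarrow> T h (Some i) (Some j)) \<in> V" for h using TV by (simp add: d)
  next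
    fix \<mu> assume z: "\<And>d. (\<Sum>h\<in>UNIV. \<mu> h * r (case d of (i, j) \<Rightarrow> T h (Some i) (Some j))) = 0"
    show "\<mu> = (\<lambda>_. 0)"
      by (rule res_top_indep) (use z[of "(_, _)"] in \<open>simp add: TV\<close>)
  qed
  have "(\<lambda>h. r (n h) - (if mul u g = Some h then 1 else 0)) = (\<lambda>_. 0)"
  proof (rule res_top_indep)
    fix i j
    have "(\<Sum>h\<in>UNIV. r (n h) * res3 p q h (Some i) (Some j)) = r (\<Sum>h\<in>UNIV. n h * T h (Some i) (Some j))"
      using TV nV by simp
    also have "\<dots> = (\<Sum>m\<in>UNIV. res3 p q g (Some i) m * res3 p q (Some u) m (Some j))"
      unfolding pr using TV row_div[OF u] by simp
    also have "\<dots> = (\<Sum>m\<in>UNIV. res3 p q g (Some i) (Some m) * std u m j)"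
      using u by (auto simp: sum_option res3_def gens_def)
    also have "\<dots> = at_mul (\<lambda>h. res3 p q h (Some i) (Some j)) u g" by (rule res_mult[OF u])
    also have "\<dots> = (\<Sum>h\<in>UNIV. (if mul u g = Some h then 1 else 0) * res3 p q h (Some i) (Some j))"
      by (cases "mul u g") (simp_all add: at_mul_def if_distrib[of "\<lambda>x. x * _"] cong: if_cong)
    finally show "(\<Sum>h\<in>UNIV. (r (n h) - (if mul u g = Some h then 1 else 0)) * res3 p q h (Some i) (Some j)) = 0"
      by (simp only: left_diff_distrib sum_subtractf) simp
  qed
  then have rn: "r (n h) = (if mul u g = Some h then 1 else 0)" for h by (simp add: fun_eq_iff)
  have "(\<Sum>h\<in>UNIV. r (n h) * f h) = at_mul f u g" for f
    unfolding rn by (cases "mul u g") (simp_all add: at_mul_def if_distrib[of "\<lambda>x. x * _"] cong: if_cong)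
  with n nV show ?thesis by (rule that)
qed

lemma residue_solution:
  assumes J: "finite J" "card J < 396"
  shows "\<exists>f. (\<exists>out\<in>outs. f out \<noteq> 0) \<and> (\<forall>out\<in>J \<inter> outs. f out = 0) \<and> (\<forall>u g i j. u \<in> gens \<longrightarrow>
    at_mul (\<lambda>h. f (OT h i j)) u g + (\<Sum>h\<in>UNIV. f (OA u g h) * res3 p q h i j)
      = (\<Sum>m\<in>UNIV. f (OT g i m) * res3 p q (Some u) m j) + (\<Sum>m\<in>UNIV. res3 p q g i m * f (OB u m j)) \<and>
    at_mul (\<lambda>h. f (OT h i j)) u g + (\<Sum>h\<in>UNIV. f (OA u g h) * res3 p q h i j)
      = (\<Sum>m\<in>UNIV. res3 p q (Some u) i m * f (OT g m j)) + (\<Sum>m\<in>UNIV. f (OC u i m) * res3 p q g m j))"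
proof -
  define M where "M out = (SOME M. \<forall>x. val x out = (\<Sum>i\<in>UNIV. M i * x i))" for out
  have M: "val x out = (\<Sum>i\<in>UNIV. M out i * x i)" for out x
    using someI_ex[OF lin_val[of out, unfolded lin_form_def], folded M_def] by (rule spec)
  have "card J < card params" using J by (simp add: card_params)
  from hom_system[OF J(1) finite_params this, of M] obtain x0 where
    x0: "\<exists>i\<in>params. x0 i \<noteq> 0" "\<And>out. out \<in> J \<Longrightarrow> (\<Sum>i\<in>params. M out i * x0 i) = 0"
    by (elim exE conjE) (rule that, assumption, erule bspec)
  define x where "x i = (if i \<in> params then x0 i else 0)" for i
  have zJ: "val x out = 0" if "out \<in> J" for out
  proof -
    have "val x out = (\<Sum>i\<in>params. M out i * x0 i)"
      unfolding M by (rule sum.mono_neutral_cong_right) (simp_all add: x_def)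
    then show ?thesis using x0(2)[OF that] by (rule trans)
  qed
  have supp: "x i = 0" if "i \<notin> params" for i using that by (simp add: x_def)
  \<comment> \<open>Injectivity of the parametrization gives the scaling a nonzero coordinate to
    start from.\<close>
  have "\<exists>out\<in>outs. val x out \<noteq> 0"
  proof (rule ccontr)
    assume "\<not> ?thesis"
    then have z: "val x out = 0" if "out \<in> outs" for out using that by (rule_tac ccontr) (rule notE, assumption, rule bexI)
    have x_zero: "x i = 0" for i by (rule val_zero[OF supp z])
    obtain i where "i \<in> params" "x0 i \<noteq> 0" using x0(1) by (rule bexE)
    then show False using x_zero[of i] by (simp add: x_def)
  qed
  then obtain o1 where o1: "o1 \<in> outs" "val x o1 \<noteq> 0" by (rule bexE)
  obtain s where s: "s \<noteq> 0" "\<And>out. out \<in> outs \<Longrightarrow> s * val x out \<in> V" "\<exists>out\<in>outs. r (s * val x out) \<noteq> 0"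
    by (rule scale[of outs o1 "\<lambda>out. val x out", OF finite_outs o1], rule that)
  define v where "v out = s * val x out" for out
  define f where "f out = r (v out)" for out
  have vV: "v (OT g i j) \<in> V" "u \<in> gens \<Longrightarrow> v (OA u g i) \<in> V" "u \<in> gens \<Longrightarrow> v (OB u i j) \<in> V" "u \<in> gens \<Longrightarrow> v (OC u i j) \<in> V"
    for u g i j unfolding v_def by (intro s(2) outsI; assumption?)+
  have TV: "T g i j \<in> V" "r (T g i j) = res3 p q g i j" for g i j
    using int res by (simp_all add: T_def)
  have "at_mul (\<lambda>h. f (OT h i j)) u g + (\<Sum>h\<in>UNIV. f (OA u g h) * res3 p q h i j)
      = (\<Sum>m\<in>UNIV. f (OT g i m) * res3 p q (Some u) m j) + (\<Sum>m\<in>UNIV. res3 p q g i m * f (OB u m j)) \<and>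
    at_mul (\<lambda>h. f (OT h i j)) u g + (\<Sum>h\<in>UNIV. f (OA u g h) * res3 p q h i j)
      = (\<Sum>m\<in>UNIV. res3 p q (Some u) i m * f (OT g m j)) + (\<Sum>m\<in>UNIV. f (OC u i m) * res3 p q g m j)"
    (is "?L = ?R1 \<and> ?L = ?R2") if u: "u \<in> gens" for u g i j
  proof -
    obtain n where n: "\<And>k. \<omega> u k * a k g = (\<Sum>h\<in>UNIV. n h * a k h)" "\<And>h. n h \<in> V"
      "\<And>f. (\<Sum>h\<in>UNIV. r (n h) * f h) = at_mul f u g"
      by (rule mul_coeff[OF u, of g], rule that)
    have sx: "x (Inl (h, k, l)) = 0" if "h \<noteq> k" "k \<noteq> l" "h \<noteq> l" for h k l
      using that by (intro supp) (auto simp: params_def)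
    have L: "r ((\<Sum>h\<in>UNIV. n h * v (OT h i j)) + (\<Sum>h\<in>UNIV. v (OA u g h) * T h i j)) = ?L"
      using n(2) vV u TV by (simp add: f_def n(3))
    have R1: "r ((\<Sum>m\<in>UNIV. v (OT g i m) * (R m * T (Some u) m j)) + (\<Sum>m\<in>UNIV. T g i m * v (OB u m j))) = ?R1"
      using vV u TV row_div[OF u] by (simp add: f_def)
    have R2: "r ((\<Sum>m\<in>UNIV. (T (Some u) i m * R m) * v (OT g m j)) + (\<Sum>m\<in>UNIV. v (OC u i m) * T g m j)) = ?R2"
      using vV u TV row_div[OF u] by (simp add: f_def)
    have pull: "(\<Sum>h\<in>UNIV. A h * v (B h)) = s * (\<Sum>h\<in>UNIV. A h * val x (B h))"
       "(\<Sum>h\<in>UNIV. v (B h) * A h) = s * (\<Sum>h\<in>UNIV. val x (B h) * A h)" for A B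
      by (simp_all add: v_def sum_distrib_left mult_ac)
    show ?thesis
      unfolding L[symmetric] R1[symmetric] R2[symmetric] unfolding pull distrib_left[symmetric]
      using val_equation[of x u g n i j, OF sx n(1)] by (simp only: simp_thms)
  qed
  moreover have "\<exists>out\<in>outs. f out \<noteq> 0" using s(3) by (simp add: f_def v_def)
  moreover have "\<forall>out\<in>J \<inter> outs. f out = 0" using zJ by (simp add: f_def v_def)
  ultimately show ?thesis by blast
qed

end

section \<open>Elimination\<close>

text \<open>The 2 by 2 block form over the dual numbers. For the slices of a_3, a_4, a_5 two blocks
  suffice, since \<open>nilp_blocks\<close> makes the lower left one zero and the lower right one
  equal to the upper left; \<open>x_borders\<close> leaves half of the border of x.\<close>

abbreviation "tP i j \<equiv> OT (Some x_idx) (Some (i, False)) (Some (j, False))"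
abbreviation "tQ i j \<equiv> OT (Some x_idx) (Some (i, False)) (Some (j, True))"
abbreviation "tS i j \<equiv> OT (Some x_idx) (Some (i, True)) (Some (j, False))"
abbreviation "tT i j \<equiv> OT (Some x_idx) (Some (i, True)) (Some (j, True))"
abbreviation "tA f i j \<equiv> OT (Some (f, False)) (Some (i, False)) (Some (j, False))"
abbreviation "tB f i j \<equiv> OT (Some (f, False)) (Some (i, False)) (Some (j, True))"
abbreviation "t\<pi> i \<equiv> OT (Some x_idx) (Some (i, False)) None"
abbreviation "t\<theta> j \<equiv> OT (Some x_idx) None (Some (j, True))"

text \<open>
  These lists were found by computer search: setting the listed coordinates to zero, all others
  vanish by solving one equation after the other for a single unknown.
\<close>

definition common :: "outc list" where
  "common = [tA E3 E1 E5, tA E3 E4 E4, tA E4 E1 E5, tA E4 E2 E3, tA E4 E3 E4, tA E5 E1 E5, tA E5 E4 E5, tB E3 E1 E3,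
     tB E3 E3 E4, tB E3 E4 E4, tB E4 E2 E2, tB E4 E2 E3, tB E4 E3 E4, tB E5 E1 E3, tP E1 E5, tP E3 E1, tP E3 E2,
     tP E3 E5, tP E4 E4, tQ E1 E1, tQ E1 E3, tQ E2 E2, tQ E2 E3, tQ E3 E2, tQ E3 E3, tQ E3 E4, tQ E5 E3,
     tT E1 E1, tT E1 E3, tT E2 E3, tT E3 E3, tT E3 E4, t\<pi> E3, t\<theta> E3, t\<theta> E4, t\<theta> E5]"

definition chosen14 :: "outc list" where
  "chosen14 = [tB E3 E2 E3, tB E4 E1 E3, tB E5 E2 E3, tB E5 E3 E4, tP E1 E1, tP E1 E2, tP E1 E3, tP E3 E4, tQ E1 E2,
     tQ E2 E1, tQ E4 E4, tQ E4 E5, tQ E5 E4, tS E1 E4, tT E1 E4, tT E1 E5, tT E2 E4, tT E2 E5, tT E4 E4,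
     tT E5 E4, t\<pi> E2]"

definition chosen24 :: "outc list" where
  "chosen24 = [tB E3 E2 E3, tB E5 E2 E3, tB E5 E3 E4, tP E2 E1, tP E2 E2, tP E2 E3, tP E3 E4, tQ E2 E1, tQ E4 E4, tQ E5 E4,
     tS E2 E4, tT E1 E4, tT E2 E4, tT E2 E5, tT E4 E4, tT E5 E4, t\<pi> E1]"

definition chosen15 :: "outc list" where
  "chosen15 = [tB E3 E2 E3, tB E3 E3 E3, tB E4 E1 E3, tB E4 E3 E3, tB E5 E2 E3, tB E5 E3 E3, tB E5 E3 E4, tP E1 E1,
     tP E1 E2, tP E1 E3, tQ E1 E2, tQ E4 E5, tS E1 E5, tT E1 E4, tT E1 E5, tT E2 E5, tT E3 E5, tT E4 E5,
     tT E5 E5, t\<pi> E2]"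

definition chosen25 :: "outc list" where
  "chosen25 = [tB E3 E2 E3, tB E4 E1 E3, tB E5 E2 E3, tP E2 E1, tP E2 E2, tP E2 E3, tQ E2 E1, tQ E4 E5, tQ E5 E4, tS E2 E5,
     tT E1 E5, tT E2 E4, tT E2 E5, tT E3 E5, tT E4 E5, tT E5 E5, t\<pi> E1]"

text \<open>Slices whose products with each other and with the slice of a_2 vanish.\<close>

definition nilp :: "five set" where "nilp = {E3, E4, E5}"

lemma nilp_simps [simp]: "E3 \<in> nilp" "E4 \<in> nilp" "E5 \<in> nilp"
  by (simp_all add: nilp_def)

lemma sum_five: "(\<Sum>k\<in>UNIV. F k) = F E1 + F E2 + F E3 + F E4 + F E5"
  for F :: "five \<Rightarrow> 'a::comm_monoid_add"
  by (simp add: UNIV_five add.assoc)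

definition leit_comb :: "(five \<Rightarrow> complex) \<Rightarrow> five \<Rightarrow> five \<Rightarrow> complex" where
  "leit_comb l i j = (\<Sum>k\<in>UNIV. l k * leit k i j)"

text \<open>The parameters besides \<open>v\<close>, \<open>p\<close>, \<open>q\<close> are values
  of \<open>v\<close> under short names: \<open>\<rho>1\<close>, \<open>\<rho>2\<close>,
  \<open>r1\<close>, \<open>r2\<close> the border entries of the operators of \<epsilon>, primed
  those of a nilpotent slice; \<open>L\<close>, \<open>M\<close>, \<open>m\<close> and
  \<open>N\<close>, \<open>Z\<close>, \<open>z\<close> the coefficients in the first factor when a
  nilpotent slice acts on x and on a nilpotent slice.\<close>

locale reduced =
  fixes v :: "outc \<Rightarrow> complex" and p q \<rho>1 \<rho>2 r1 r2 :: "five \<Rightarrow> complex"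
    and \<rho>1' \<rho>2' r1' r2' L M :: "five \<Rightarrow> five \<Rightarrow> complex" and m :: "five \<Rightarrow> complex"
    and N Z :: "five \<Rightarrow> five \<Rightarrow> five \<Rightarrow> complex" and z :: "five \<Rightarrow> five \<Rightarrow> complex"
begin

abbreviation "P i j \<equiv> v (tP i j)"
abbreviation "Q i j \<equiv> v (tQ i j)"
abbreviation "S i j \<equiv> v (tS i j)"
abbreviation "T i j \<equiv> v (tT i j)"
abbreviation "A f i j \<equiv> v (tA f i j)"
abbreviation "B f i j \<equiv> v (tB f i j)"
abbreviation "\<pi> i \<equiv> v (t\<pi> i)"
abbreviation "\<theta> j \<equiv> v (t\<theta> j)"

definition all_zero where
  "all_zero \<longleftrightarrow> (\<forall>i j. P i j = 0 \<and> Q i j = 0 \<and> S i j = 0 \<and> T i j = 0 \<and> \<pi> i = 0 \<and> \<theta> i = 0 \<and>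
     (\<forall>f\<in>nilp. A f i j = 0 \<and> B f i j = 0))"

lemma forall_five: "(\<forall>i. F i) \<longleftrightarrow> F E1 \<and> F E2 \<and> F E3 \<and> F E4 \<and> F E5"
  by (metis five.exhaust)

lemma all_zeroI:
  assumes "\<forall>i j. P i j = 0" "\<forall>i j. Q i j = 0" "\<forall>i j. S i j = 0" "\<forall>i j. T i j = 0"
    "\<forall>i. \<pi> i = 0" "\<forall>i. \<theta> i = 0" "\<forall>f\<in>nilp. \<forall>i j. A f i j = 0" "\<forall>f\<in>nilp. \<forall>i j. B f i j = 0"
  shows all_zero
  using assms by (simp add: all_zero_def)

end

text \<open>\<open>S1\<close>, \<open>S2\<close> and \<open>PT\<close> come from \<epsilon> acting
  on x; \<open>e1\<close> to \<open>e6\<close> are the blocks and \<open>e7\<close>,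
  \<open>e8\<close> the border of a nilpotent slice acting on x; \<open>e9\<close> to
  \<open>e12\<close> come from two nilpotent slices. Consecutive equations with the same right side
  compare the first factor with the second and with the third.\<close>

locale reduced_system = reduced +
  assumes p_supp: "p E3 = 0" "p E4 = 0" "p E5 = 0" and q_supp: "q E1 = 0" "q E2 = 0" "q E3 = 0"
    and S1: "\<And>i j. S i j = p i * \<rho>1 j" and S2: "\<And>i j. S i j = r2 i * q j"
    and PT: "\<And>i j. P i j + p i * \<rho>2 j = T i j + r1 i * q j"
    and e1: "\<And>f i j. f \<in> nilp \<Longrightarrow> (\<Sum>k\<in>UNIV. P i k * leit f k j) + (\<Sum>k\<in>UNIV. leit E2 i k * A f k j) + p i * \<rho>1' f j = leit_comb (L f) i j"
    and e2: "\<And>f i j. f \<in> nilp \<Longrightarrow> (\<Sum>k\<in>UNIV. leit f i k * P k j) + (\<Sum>k\<in>UNIV. A f i k * leit E2 k j) = leit_comb (L f) i j"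
    and e3: "\<And>f i j. f \<in> nilp \<Longrightarrow> (\<Sum>k\<in>UNIV. T i k * leit f k j) + (\<Sum>k\<in>UNIV. leit E2 i k * A f k j) = leit_comb (L f) i j"
    and e4: "\<And>f i j. f \<in> nilp \<Longrightarrow> (\<Sum>k\<in>UNIV. leit f i k * T k j) + (\<Sum>k\<in>UNIV. A f i k * leit E2 k j) + r2' f i * q j = leit_comb (L f) i j"
    and e5: "\<And>f i j. f \<in> nilp \<Longrightarrow> (\<Sum>k\<in>UNIV. Q i k * leit f k j) + (\<Sum>k\<in>UNIV. leit E2 i k * B f k j) + p i * \<rho>2' f j
        = leit_comb (M f) i j + m f * of_bool (i = E1 \<and> j = E5)"
    and e6: "\<And>f i j. f \<in> nilp \<Longrightarrow> (\<Sum>k\<in>UNIV. leit f i k * Q k j) + (\<Sum>k\<in>UNIV. B f i k * leit E2 k j) + r1' f i * q j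
        = leit_comb (M f) i j + m f * of_bool (i = E1 \<and> j = E5)"
    and e7: "\<And>f i. f \<in> nilp \<Longrightarrow> (\<Sum>k\<in>UNIV. leit f i k * \<pi> k) + (\<Sum>k\<in>UNIV. A f i k * p k) = L f E2 * p i"
    and e8: "\<And>f j. f \<in> nilp \<Longrightarrow> (\<Sum>k\<in>UNIV. \<theta> k * leit f k j) + (\<Sum>k\<in>UNIV. q k * A f k j) = L f E2 * q j"
    and e9: "\<And>f g i j. f \<in> nilp \<Longrightarrow> g \<in> nilp \<Longrightarrow>
        (\<Sum>k\<in>UNIV. A g i k * leit f k j) + (\<Sum>k\<in>UNIV. leit g i k * A f k j) = leit_comb (N f g) i j"
    and e10: "\<And>f g i j. f \<in> nilp \<Longrightarrow> g \<in> nilp \<Longrightarrow>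
        (\<Sum>k\<in>UNIV. leit f i k * A g k j) + (\<Sum>k\<in>UNIV. A f i k * leit g k j) = leit_comb (N f g) i j"
    and e11: "\<And>f g i j. f \<in> nilp \<Longrightarrow> g \<in> nilp \<Longrightarrow>
        (\<Sum>k\<in>UNIV. B g i k * leit f k j) + (\<Sum>k\<in>UNIV. leit g i k * B f k j)
        = leit_comb (Z f g) i j + z f g * of_bool (i = E1 \<and> j = E5)"
    and e12: "\<And>f g i j. f \<in> nilp \<Longrightarrow> g \<in> nilp \<Longrightarrow>
        (\<Sum>k\<in>UNIV. leit f i k * B g k j) + (\<Sum>k\<in>UNIV. B f i k * leit g k j)
        = leit_comb (Z f g) i j + z f g * of_bool (i = E1 \<and> j = E5)"
    and pivP: "\<And>k. k \<noteq> E2 \<Longrightarrow> P (fst (piv k)) (snd (piv k)) = 0"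
    and pivA: "\<And>f k. f \<in> nilp \<Longrightarrow> k \<noteq> E2 \<Longrightarrow> A f (fst (piv k)) (snd (piv k)) = 0"
    and pivQ: "\<And>k. Q (fst (piv k)) (snd (piv k)) = 0" "Q E1 E5 = 0"
    and pivB: "\<And>f k. f \<in> nilp \<Longrightarrow> B f (fst (piv k)) (snd (piv k)) = 0" "\<And>f. f \<in> nilp \<Longrightarrow> B f E1 E5 = 0"
    and common: "list_all (\<lambda>out. v out = 0) common"
begin

context
  notes [simp] = sum_five leit_def leit_comb_def forall_five p_supp q_supp
begin

lemmas [simp] = common[unfolded common_def, simplified]
lemmas [simp] = pivP[of E1, simplified] pivP[of E3, simplified] pivP[of E4, simplified] pivP[of E5, simplified]
  pivQ(1)[of E1, simplified] pivQ(1)[of E2, simplified] pivQ(1)[of E3, simplified] pivQ(1)[of E4, simplified] pivQ(1)[of E5, simplified]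
  pivA[of _ E1, simplified] pivA[of _ E3, simplified] pivA[of _ E4, simplified] pivA[of _ E5, simplified] pivQ(2)
  pivB(1)[of _ E1, simplified] pivB(1)[of _ E2, simplified] pivB(1)[of _ E3, simplified] pivB(1)[of _ E4, simplified]
  pivB(1)[of _ E5, simplified] pivB(2)
text \<open>Entries of the equations, simplified with the zeros found before, serve as rewrite rules
  for unknowns that remain. The seven groups are successive rounds of the elimination that are
  common to all cases of \<open>p\<close> and \<open>q\<close>.\<close>

lemmas [simp] = PT[of E3 E1, simplified] PT[of E3 E2, simplified] PT[of E3 E3, simplified] S1[of E3 E1, simplified]
  S1[of E3 E2, simplified] S1[of E3 E3, simplified] S1[of E3 E4, simplified] S1[of E3 E5, simplified]
  S1[of E4 E1, simplified] S1[of E4 E2, simplified] S1[of E4 E3, simplified] S1[of E4 E4, simplified]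
  S1[of E4 E5, simplified] S1[of E5 E1, simplified] S1[of E5 E2, simplified] S1[of E5 E3, simplified]
  S1[of E5 E4, simplified] S1[of E5 E5, simplified] S2[of E1 E1, simplified] S2[of E1 E2, simplified]
  S2[of E1 E3, simplified] S2[of E2 E1, simplified] S2[of E2 E2, simplified] S2[of E2 E3, simplified]
  e10[of E3 E4 E1 E2, simplified] e10[of E3 E4 E1 E5, simplified] e10[of E3 E5 E1 E2, simplified]
  e10[of E3 E5 E1 E5, simplified] e10[of E3 E5 E2 E4, simplified] e10[of E4 E5 E1 E5, simplified]
  e11[of E3 E3 E1 E2, simplified] e11[of E3 E3 E3 E4, simplified] e11[of E3 E4 E1 E5, simplified]
  e11[of E3 E4 E2 E3, simplified] e11[of E3 E4 E3 E4, simplified] e11[of E3 E5 E1 E5, simplified]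
  e11[of E3 E5 E2 E3, simplified] e11[of E3 E5 E2 E5, simplified] e11[of E3 E5 E3 E4, simplified]
  e11[of E4 E4 E2 E3, simplified] e11[of E4 E4 E3 E4, simplified] e11[of E4 E5 E1 E5, simplified]
  e11[of E4 E5 E2 E3, simplified] e11[of E4 E5 E2 E5, simplified] e11[of E4 E5 E3 E4, simplified]
  e11[of E5 E5 E2 E3, simplified] e12[of E3 E4 E1 E2, simplified] e12[of E3 E4 E2 E5, simplified]
  e12[of E3 E4 E3 E4, simplified] e12[of E3 E5 E1 E2, simplified] e12[of E3 E5 E2 E4, simplified]
  e12[of E4 E5 E1 E4, simplified] e12[of E4 E5 E2 E3, simplified] e1[of E3 E3 E1, simplified]
  e1[of E3 E3 E2, simplified] e1[of E3 E3 E4, simplified] e1[of E3 E3 E5, simplified] e1[of E3 E5 E4, simplified]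
  e1[of E4 E3 E1, simplified] e1[of E4 E3 E2, simplified] e1[of E4 E3 E4, simplified] e1[of E4 E3 E5, simplified]
  e1[of E4 E5 E4, simplified] e1[of E5 E3 E1, simplified] e1[of E5 E3 E2, simplified] e1[of E5 E3 E4, simplified]
  e1[of E5 E3 E5, simplified] e2[of E3 E1 E2, simplified] e2[of E3 E1 E4, simplified] e2[of E3 E2 E3, simplified]
  e2[of E3 E2 E4, simplified] e2[of E3 E4 E3, simplified] e2[of E3 E4 E5, simplified] e2[of E4 E1 E4, simplified]
  e2[of E4 E1 E5, simplified] e2[of E4 E2 E1, simplified] e2[of E4 E2 E4, simplified] e2[of E4 E4 E3, simplified]
  e2[of E4 E4 E5, simplified] e2[of E5 E1 E4, simplified] e2[of E5 E1 E5, simplified] e2[of E5 E4 E3, simplified]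
  e2[of E5 E4 E5, simplified] e3[of E3 E1 E2, simplified] e3[of E3 E1 E5, simplified] e3[of E3 E2 E5, simplified]
  e3[of E3 E5 E4, simplified] e3[of E4 E1 E2, simplified] e3[of E4 E1 E5, simplified] e3[of E4 E2 E5, simplified]
  e3[of E4 E5 E4, simplified] e3[of E5 E1 E2, simplified] e3[of E5 E2 E4, simplified] e4[of E3 E1 E2, simplified]
  e4[of E4 E2 E1, simplified] e5[of E3 E3 E1, simplified] e5[of E3 E3 E2, simplified] e5[of E3 E3 E5, simplified]
  e5[of E3 E5 E4, simplified] e5[of E4 E3 E1, simplified] e5[of E4 E3 E2, simplified] e5[of E4 E3 E4, simplified]
  e5[of E4 E3 E5, simplified] e5[of E4 E5 E4, simplified] e5[of E5 E3 E1, simplified] e5[of E5 E3 E2, simplified]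
  e5[of E5 E3 E4, simplified] e5[of E5 E3 E5, simplified] e6[of E3 E1 E2, simplified] e6[of E3 E2 E3, simplified]
  e6[of E3 E4 E3, simplified] e6[of E4 E2 E1, simplified] e6[of E4 E4 E3, simplified] e6[of E5 E2 E3, simplified]
  e6[of E5 E4 E3, simplified] e9[of E3 E3 E1 E2, simplified] e9[of E3 E3 E1 E5, simplified]
  e9[of E3 E3 E3 E4, simplified] e9[of E3 E4 E3 E4, simplified] e9[of E3 E5 E2 E3, simplified]
  e9[of E3 E5 E2 E5, simplified] e9[of E3 E5 E3 E4, simplified] e9[of E4 E5 E2 E3, simplified]
  e9[of E4 E5 E2 E5, simplified] e9[of E5 E5 E1 E5, simplified] e9[of E5 E5 E2 E3, simplified]
lemmas [simp] = e10[of E3 E5 E2 E5, simplified] e10[of E4 E5 E2 E5, simplified] e11[of E3 E4 E2 E5, simplified]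
  e11[of E3 E5 E2 E4, simplified] e11[of E4 E5 E1 E4, simplified] e12[of E3 E4 E1 E5, simplified]
  e12[of E3 E5 E2 E5, simplified] e12[of E4 E5 E1 E5, simplified] e12[of E4 E5 E2 E5, simplified]
  e2[of E3 E2 E5, simplified] e2[of E3 E3 E5, simplified] e2[of E4 E1 E3, simplified] e2[of E4 E2 E5, simplified]
  e2[of E4 E3 E5, simplified] e2[of E5 E1 E3, simplified] e2[of E5 E2 E4, simplified] e2[of E5 E3 E5, simplified]
  e3[of E3 E1 E4, simplified] e3[of E3 E2 E4, simplified] e3[of E4 E1 E4, simplified] e3[of E4 E2 E4, simplified]
  e3[of E5 E1 E4, simplified] e6[of E4 E1 E3, simplified] e6[of E5 E1 E3, simplified] e8[of E3 E4, simplified]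
  e8[of E5 E5, simplified] e9[of E3 E5 E2 E4, simplified]
lemmas [simp] = e10[of E3 E4 E2 E4, simplified] e11[of E3 E4 E1 E4, simplified] e11[of E3 E5 E1 E4, simplified]
  e12[of E3 E4 E2 E4, simplified] e12[of E3 E5 E1 E5, simplified] e2[of E3 E1 E5, simplified]
  e2[of E5 E2 E3, simplified] e3[of E5 E1 E5, simplified] e3[of E5 E2 E5, simplified] e4[of E5 E2 E3, simplified]
  e5[of E3 E3 E4, simplified] e9[of E3 E4 E1 E4, simplified] e9[of E3 E5 E1 E4, simplified]
lemmas [simp] = e10[of E3 E4 E1 E4, simplified] e10[of E3 E5 E1 E4, simplified] e11[of E3 E4 E2 E4, simplified]
  e12[of E3 E4 E1 E4, simplified] e12[of E3 E5 E1 E4, simplified] e2[of E5 E2 E5, simplified]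
  e9[of E3 E4 E2 E4, simplified]
lemmas [simp] = e10[of E4 E5 E2 E4, simplified] e12[of E4 E5 E2 E4, simplified] e2[of E4 E2 E3, simplified]
  e4[of E4 E2 E3, simplified] e6[of E4 E2 E3, simplified] e7[of E4 E2, simplified]
lemmas [simp] = e11[of E4 E5 E2 E4, simplified] e2[of E3 E1 E3, simplified] e6[of E3 E1 E3, simplified]
  e9[of E4 E5 E2 E4, simplified]
lemmas [simp] = e7[of E5 E2, simplified]

text \<open>The digits name the entries of \<open>p\<close> and \<open>q\<close> used as divisors,
  here \<open>p E1\<close> and \<open>q E4\<close>; \<open>p E2\<close> and \<open>q E5\<close> are
  arbitrary. The other three cases assume that the preferred entry \<open>p E1\<close> or
  \<open>q E4\<close> vanishes.\<close>

lemma zero_14: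
  assumes pq [simp]: "p E1 \<noteq> 0" "q E4 \<noteq> 0"
    and z: "list_all (\<lambda>out. v out = 0) chosen14" and \<pi>0 [simp]: "\<pi> E1 = 0"
  shows all_zero
proof -
  note [simp] = z[unfolded chosen14_def, simplified]
  note [simp] = PT[of E1 E1, simplified] PT[of E1 E2, simplified] PT[of E1 E3, simplified] PT[of E3 E4, simplified]
    PT[of E4 E4, simplified] PT[of E5 E4, simplified] S1[of E1 E4, simplified] S2[of E1 E4, simplified]
    e6[of E3 E3 E4, simplified] e6[of E4 E3 E4, simplified] e6[of E5 E3 E4, simplified]
  note [simp] = PT[of E2 E1, simplified] PT[of E2 E2, simplified] PT[of E2 E3, simplified] PT[of E3 E5, simplified]
    PT[of E4 E5, simplified] PT[of E5 E5, simplified] S1[of E2 E4, simplified] S2[of E1 E5, simplified]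
    e6[of E3 E3 E5, simplified] e6[of E4 E3 E5, simplified] e6[of E5 E3 E5, simplified]
  note [simp] = S1[of E1 E5, simplified]
  note [simp] = S1[of E2 E5, simplified]
  show ?thesis by (rule all_zeroI) (simp_all add: nilp_def)
qed

lemma zero_24:
  assumes pq [simp]: "p E1 = 0" "p E2 \<noteq> 0" "q E4 \<noteq> 0"
    and z: "list_all (\<lambda>out. v out = 0) chosen24" and \<pi>0 [simp]: "\<pi> E2 = 0"
  shows all_zero
proof -
  note [simp] = z[unfolded chosen24_def, simplified]
  note [simp] = PT[of E1 E1, simplified] PT[of E1 E2, simplified] PT[of E1 E3, simplified] PT[of E1 E4, simplified]
    PT[of E3 E4, simplified] PT[of E4 E4, simplified] PT[of E5 E4, simplified] S1[of E1 E4, simplified]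
    S1[of E1 E5, simplified] S2[of E2 E4, simplified] e5[of E3 E1 E3, simplified] e5[of E3 E1 E4, simplified]
    e5[of E3 E1 E5, simplified] e5[of E4 E1 E3, simplified] e5[of E4 E1 E5, simplified] e5[of E5 E1 E3, simplified]
    e5[of E5 E1 E4, simplified]
  note [simp] = PT[of E1 E5, simplified] PT[of E3 E5, simplified] PT[of E4 E5, simplified] PT[of E5 E5, simplified]
    S2[of E2 E5, simplified] e6[of E3 E1 E4, simplified] e6[of E5 E1 E4, simplified]
  note [simp] = e6[of E3 E1 E5, simplified] e6[of E5 E1 E5, simplified]
  note [simp] = e5[of E5 E1 E5, simplified]
  note [simp] = e5[of E4 E1 E4, simplified]
  note [simp] = e6[of E4 E1 E4, simplified]
  note [simp] = e6[of E4 E1 E5, simplified]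
  show ?thesis by (rule all_zeroI) (simp_all add: nilp_def)
qed

lemma zero_15:
  assumes pq [simp]: "p E1 \<noteq> 0" "q E4 = 0" "q E5 \<noteq> 0"
    and z: "list_all (\<lambda>out. v out = 0) chosen15" and \<pi>0 [simp]: "\<pi> E1 = 0"
  shows all_zero
proof -
  note [simp] = z[unfolded chosen15_def, simplified]
  note [simp] = PT[of E1 E1, simplified] PT[of E1 E2, simplified] PT[of E1 E3, simplified] PT[of E1 E4, simplified]
    PT[of E3 E4, simplified] PT[of E4 E4, simplified] PT[of E5 E4, simplified] S1[of E1 E5, simplified]
    S2[of E1 E4, simplified] S2[of E2 E4, simplified] e6[of E3 E2 E4, simplified] e6[of E4 E1 E4, simplified]
    e6[of E5 E1 E4, simplified]
  note [simp] = PT[of E2 E1, simplified] PT[of E2 E2, simplified] PT[of E2 E3, simplified] PT[of E2 E4, simplified]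
    S1[of E2 E5, simplified] e5[of E4 E1 E4, simplified] e5[of E5 E1 E4, simplified]
  note [simp] = e5[of E4 E2 E4, simplified] e5[of E5 E2 E4, simplified]
  note [simp] = e6[of E4 E2 E4, simplified] e6[of E5 E2 E4, simplified]
  note [simp] = e6[of E3 E1 E4, simplified]
  note [simp] = e5[of E3 E1 E4, simplified]
  note [simp] = e5[of E3 E2 E4, simplified]
  show ?thesis by (rule all_zeroI) (simp_all add: nilp_def)
qed

lemma zero_25:
  assumes pq [simp]: "p E1 = 0" "p E2 \<noteq> 0" "q E4 = 0" "q E5 \<noteq> 0"
    and z: "list_all (\<lambda>out. v out = 0) chosen25" and \<pi>0 [simp]: "\<pi> E2 = 0"
  shows all_zero
proof -
  note [simp] = z[unfolded chosen25_def, simplified]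
  note [simp] = PT[of E1 E1, simplified] PT[of E1 E2, simplified] PT[of E1 E3, simplified] PT[of E1 E4, simplified]
    PT[of E3 E4, simplified] PT[of E4 E4, simplified] PT[of E5 E4, simplified] S1[of E1 E4, simplified]
    S1[of E1 E5, simplified] S2[of E2 E4, simplified] e5[of E3 E1 E3, simplified] e5[of E3 E1 E4, simplified]
    e5[of E4 E1 E3, simplified] e5[of E5 E1 E3, simplified] e6[of E4 E1 E4, simplified] e6[of E5 E1 E4, simplified]
  note [simp] = e5[of E4 E1 E4, simplified] e5[of E5 E1 E4, simplified] e6[of E3 E1 E4, simplified]
  show ?thesis by (rule all_zeroI) (simp_all add: nilp_def)
qed

end

end

section \<open>The residue equations with 395 vanishing coordinates\<close>

abbreviation eps :: idx where "eps \<equiv> (E1, True)"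

text \<open>Eleven positions, one for each slice of \<open>res3\<close>: the border entry
  \<open>i0\<close> detects x, the entry at row (E1, False) and column (E5, True) detects the new
  slice, and pivots detect the rest. Zeros there remove the freedom of adding multiples of the
  slices, see \<open>kill\<close>.\<close>

definition pivs :: "five \<Rightarrow> (idx option \<times> idx option) set" where
  "pivs i0 = insert (Some (i0, False), None) (insert (Some (E1, False), Some (E5, True))
     ((\<lambda>h. (Some (fst (pivot h)), Some (snd (pivot h)))) ` (UNIV - {x_idx})))"

text \<open>The commutator of \<epsilon> with a matrix can have arbitrary upper blocks, so
  conjugation can clear the 50 entries of the upper half. The nine lower entries are pivots for the
  combinations that \<open>eps_zero\<close> finds in the lower blocks.\<close>

definition eps_zeros :: "five \<Rightarrow> (idx option \<times> idx option) set" where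
  "eps_zeros i0 = insert (Some (i0, False), None) ((\<lambda>(i, j, s). (Some (i, False), Some (j, s))) ` UNIV \<union>
     ((\<lambda>k. (Some (fst (piv k), True), Some (snd (piv k), False))) ` nilp \<union>
      insert (Some (E1, True), Some (E5, True)) ((\<lambda>k. (Some (fst (piv k), True), Some (snd (piv k), True))) ` UNIV)))"

text \<open>At most 50 + 5 + 121 + 99 + 60 + 2 = 337 elements, in this order. The entries of
  \<open>OA\<close> prevent a generator from being varied by multiples of other slices; freezing the
  unit slice and the positions \<open>pivs\<close> uses up changes of basis.\<close>

definition base :: "five \<Rightarrow> five \<Rightarrow> outc set" where
  "base i0 j0 = (\<lambda>(u, h). OA u (Some one_idx) h) ` (gens \<times> (UNIV - {Some x_idx}))
     \<union> ((\<lambda>u. OB u None (Some (j0, True))) ` gens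
     \<union> ((\<lambda>(i, j). OT (Some one_idx) i j) ` UNIV
     \<union> ((\<lambda>(g, i, j). OT g i j) ` ((UNIV - {Some one_idx, Some eps}) \<times> pivs i0)
     \<union> ((\<lambda>(i, j). OT (Some eps) i j) ` eps_zeros i0
     \<union> {OT (Some x_idx) None None, OT (Some x_idx) (Some (i0, True)) None}))))"

lemma card_image_bound: "finite A \<Longrightarrow> card A \<le> n \<Longrightarrow> card (f ` A) \<le> n"
  using card_image_le order_trans by blast

lemma card_Un_bound: "card A \<le> m \<Longrightarrow> card B \<le> n \<Longrightarrow> card (A \<union> B) \<le> m + n"
  by (meson add_mono card_Un_le order_trans)

lemma card_insert_bound: "card A \<le> n \<Longrightarrow> card (insert a A) \<le> Suc n"
  by (cases "finite A") (simp_all add: card_insert_if)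

lemma finite_gens [simp]: "finite gens"
  by (simp add: gens_def)

lemma card_pivs: "card (pivs i0) \<le> Suc (Suc 9)"
  unfolding pivs_def by (intro card_insert_bound card_image_bound) (simp_all add: UNIV_five card_UNIV_bool)

lemma card_eps_zeros: "card (eps_zeros i0) \<le> Suc (50 + (3 + Suc 5))"
  unfolding eps_zeros_def
  by (intro card_insert_bound card_Un_bound card_image_bound) (simp_all add: UNIV_five card_UNIV_bool nilp_def)

lemma base: "finite (base i0 j0)" "card (base i0 j0) \<le> 337"
proof -
  have [simp]: "finite (pivs i0)" "finite (eps_zeros i0)"
    by (simp_all add: pivs_def eps_zeros_def nilp_def)
  show "finite (base i0 j0)" by (simp add: base_def)
  have "card (base i0 j0) \<le> 50 + (5 + (121 + (99 + (60 + 2))))"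
    unfolding base_def
  proof (intro card_Un_bound card_image_bound)
    show "card (gens \<times> (UNIV - {Some x_idx})) \<le> 50"
      by (simp add: card_cartesian_product card_gens card_Diff_singleton card_idx_option del: card_option card_UNIV_option)
    show "card gens \<le> 5" by (simp add: card_gens)
    show "card (UNIV :: (idx option \<times> idx option) set) \<le> 121"
      by (simp add: card_idx_option del: card_option card_UNIV_option)
    have "card (UNIV - {Some one_idx, Some eps}) = 9"
      by (subst card_Diff_subset) (simp_all add: card_idx_option del: card_option card_UNIV_option)
    then show "card ((UNIV - {Some one_idx, Some eps}) \<times> pivs i0) \<le> 99"
      using card_pivs[of i0] by (simp add: card_cartesian_product)
    show "card (eps_zeros i0) \<le> 60" using card_eps_zeros[of i0] by simp
    show "card {OT (Some x_idx) None None, OT (Some x_idx) (Some (i0, True)) None} \<le> 2" by simp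
  qed simp_all
  then show "card (base i0 j0) \<le> 337" by simp
qed

lemma base_outs: "base i0 j0 \<subseteq> outs"
  by (auto simp: base_def outsI)

lemma sum_blocks: "(\<Sum>m\<in>UNIV. F m) = (\<Sum>k\<in>UNIV. F (k, False)) + (\<Sum>k\<in>UNIV. F (k, True))"
  for F :: "idx \<Rightarrow> 'a::comm_monoid_add"
proof -
  have "(\<Sum>m\<in>UNIV. F m) = (\<Sum>k\<in>UNIV. \<Sum>s\<in>UNIV. F (k, s))"
    by (simp add: sum.cartesian_product)
  then show ?thesis by (simp add: UNIV_bool sum.distrib)
qed

lemma at_mul_one: "at_mul f u (Some one_idx) = f (Some u)"
  by (cases u) (simp add: at_mul_def mul_def)

lemma leit_comb_piv: "leit_comb l (fst (piv k)) (snd (piv k)) = l k"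
  by (cases k) (simp_all add: leit_comb_def leit_def sum_five)

lemma leit_comb_15: "leit_comb l E1 E5 = 0"
  by (simp add: leit_comb_def leit_def sum_five)

lemma nilp_gens: "f \<in> nilp \<Longrightarrow> (f, False) \<in> gens"
  by (auto simp: nilp_def gens_def)

section \<open>From the residue equations to five by five blocks\<close>

locale solution =
  fixes p q :: "idx \<Rightarrow> complex" and v :: "outc \<Rightarrow> complex" and i0 j0 :: five
  assumes p_supp: "\<And>i. p i \<noteq> 0 \<Longrightarrow> fst i \<in> {E1, E2} \<and> \<not> snd i"
    and q_supp: "\<And>j. q j \<noteq> 0 \<Longrightarrow> fst j \<in> {E4, E5} \<and> snd j"
    and p0: "p (i0, False) \<noteq> 0" and q0: "q (j0, True) \<noteq> 0"
    and eqB: "\<And>u g i j. u \<in> gens \<Longrightarrow> at_mul (\<lambda>h. v (OT h i j)) u g + (\<Sum>h\<in>UNIV. v (OA u g h) * res3 p q h i j)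
      = (\<Sum>m\<in>UNIV. v (OT g i m) * res3 p q (Some u) m j) + (\<Sum>m\<in>UNIV. res3 p q g i m * v (OB u m j))"
    and eqC: "\<And>u g i j. u \<in> gens \<Longrightarrow> at_mul (\<lambda>h. v (OT h i j)) u g + (\<Sum>h\<in>UNIV. v (OA u g h) * res3 p q h i j)
      = (\<Sum>m\<in>UNIV. res3 p q (Some u) i m * v (OT g m j)) + (\<Sum>m\<in>UNIV. v (OC u i m) * res3 p q g m j)"
    and base_zero: "\<And>out. out \<in> base i0 j0 \<Longrightarrow> v out = 0"
begin

abbreviation "t g i j \<equiv> v (OT g i j)"

lemma p_True: "p (i, True) = 0" and q_False: "q (j, False) = 0"
  using p_supp[of "(i, True)"] q_supp[of "(j, False)"] by auto

lemma p_out: "p (E3, s) = 0" "p (E4, s) = 0" "p (E5, s) = 0"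
  using p_supp[of "(E3, s)"] p_supp[of "(E4, s)"] p_supp[of "(E5, s)"] by auto

lemma q_out: "q (E1, s) = 0" "q (E2, s) = 0" "q (E3, s) = 0"
  using q_supp[of "(E1, s)"] q_supp[of "(E2, s)"] q_supp[of "(E3, s)"] by auto

lemma lhs: "(\<Sum>h\<in>UNIV. A h * res3 p q h (Some (i, s)) (Some (j, s')))
    = (if s = s' then leit_comb (\<lambda>k. A (Some (k, False))) i j else if s then 0
       else leit_comb (\<lambda>k. A (Some (k, True))) i j + A None * of_bool (i = E1 \<and> j = E5))"
proof -
  have "(\<Sum>h\<in>UNIV. A h * res3 p q h (Some (i, s)) (Some (j, s')))
      = A None * e15 True (i, s) (j, s') + comb (\<lambda>g. A (Some g)) (i, s) (j, s')"
    by (simp add: sum_option res3_def comb_def)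
  then show ?thesis by (simp add: comb_explicit e15_def dual_def leit_comb_def)
qed

lemma lhs_border:
  "(\<Sum>h\<in>UNIV. A h * res3 p q h (Some i) None) = A (Some x_idx) * p i"
  "(\<Sum>h\<in>UNIV. A h * res3 p q h None (Some j)) = A (Some x_idx) * q j"
  "(\<Sum>h\<in>UNIV. A h * res3 p q h None None) = 0"
  by (simp_all add: res3_def if_distrib[of "\<lambda>x. _ * x"] cong: if_cong)

lemma rmul:
  "(\<Sum>m\<in>UNIV. F m * res3 p q (Some u) m (Some (j, s))) =
    (if snd u then (if s then \<Sum>k\<in>UNIV. F (Some (k, False)) * leit (fst u) k j else 0)
     else \<Sum>k\<in>UNIV. F (Some (k, s)) * leit (fst u) k j) + (if u = x_idx then F None * q (j, s) else 0)"
  "(\<Sum>m\<in>UNIV. F m * res3 p q (Some u) m None) = (if u = x_idx then \<Sum>k\<in>UNIV. F (Some (k, False)) * p (k, False) else 0)"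
  by (cases s; simp add: sum_option sum_blocks res3_def std_def dual_def)
    (simp add: sum_option sum_blocks res3_def p_True)

lemma lmul:
  "(\<Sum>m\<in>UNIV. res3 p q (Some u) (Some (i, s)) m * F m) =
    (if snd u then (if s then 0 else \<Sum>k\<in>UNIV. leit (fst u) i k * F (Some (k, True)))
     else \<Sum>k\<in>UNIV. leit (fst u) i k * F (Some (k, s))) + (if u = x_idx then p (i, s) * F None else 0)"
  "(\<Sum>m\<in>UNIV. res3 p q (Some u) None m * F m) = (if u = x_idx then \<Sum>k\<in>UNIV. q (k, True) * F (Some (k, True)) else 0)"
  by (cases s; simp add: sum_option sum_blocks res3_def std_def dual_def)
    (simp add: sum_option sum_blocks res3_def q_False)

lemma leit_E1: "(\<Sum>k\<in>UNIV. leit E1 i k * F k) = F i" "(\<Sum>k\<in>UNIV. F k * leit E1 k i) = F i"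
  by (simp_all add: leit_def)

lemma pivot_zero:
  assumes "g \<noteq> Some one_idx"
  shows "h \<noteq> x_idx \<Longrightarrow> t g (Some (fst (pivot h))) (Some (snd (pivot h))) = 0"
    "t g (Some (i0, False)) None = 0" "t g (Some (E1, False)) (Some (E5, True)) = 0"
proof -
  have m: "t g i j = 0" if "(i, j) \<in> pivs i0" for i j
  proof (cases "g = Some eps")
    case True
    have *: "(Some (i, False), Some (j, s)) \<in> eps_zeros i0" for i j s
      unfolding eps_zeros_def using imageI[of "(i, j, s)" UNIV "\<lambda>(i, j, s). (Some (i, False), Some (j, s))"] by simp
    have "(i, j) \<in> eps_zeros i0"
      using that unfolding pivs_def by (elim insertE imageE) (simp_all add: * pivot_def, simp add: eps_zeros_def)
    then have "OT (Some eps) i j \<in> (\<lambda>(i, j). OT (Some eps) i j) ` eps_zeros i0"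
      by (intro image_eqI[of _ _ "(i, j)"]) simp_all
    then show ?thesis unfolding True by (intro base_zero) (simp add: base_def)
  next
    case False
    then have "OT g i j \<in> (\<lambda>(g, i, j). OT g i j) ` ((UNIV - {Some one_idx, Some eps}) \<times> pivs i0)"
      using that assms by (intro image_eqI[of _ _ "(g, i, j)"]) simp_all
    then show ?thesis by (intro base_zero) (simp add: base_def)
  qed
  show "h \<noteq> x_idx \<Longrightarrow> t g (Some (fst (pivot h))) (Some (snd (pivot h))) = 0"
    "t g (Some (i0, False)) None = 0" "t g (Some (E1, False)) (Some (E5, True)) = 0"
    by (rule m, simp add: pivs_def)+
qed

lemma one_zero: "t (Some one_idx) i j = 0"
  using imageI[of "(i, j)" UNIV "\<lambda>(i, j). OT (Some one_idx) i j"] by (intro base_zero) (simp add: base_def)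

text \<open>\<open>base\<close> covers all coefficients except that of x, and the entry (i0, None)
  of the equation for the unit slice isolates this one, multiplied by
  \<open>p (i0, False)\<close>.\<close>

lemma OA_one: "u \<in> gens \<Longrightarrow> v (OA u (Some one_idx) h) = 0"
proof -
  assume u: "u \<in> gens"
  then have ux: "u \<noteq> x_idx" "u \<noteq> one_idx" by (auto simp: gens_def)
  have z: "v (OA u (Some one_idx) h) = 0" if "h \<noteq> Some x_idx" for h
    using imageI[of "(u, h)" "gens \<times> (UNIV - {Some x_idx})" "\<lambda>(u, h). OA u (Some one_idx) h"] that u
    by (intro base_zero) (simp add: base_def)
  have "v (OA u (Some one_idx) (Some x_idx)) * p (i0, False) = 0"
    using eqC[OF u, of "Some (i0, False)" None "Some one_idx"] ux
    by (simp add: at_mul_one lhs_border rmul lmul one_zero pivot_zero)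
  then show "v (OA u (Some one_idx) h) = 0" using z p0 by (cases "h = Some x_idx") auto
qed

text \<open>In the equations for the unit slice nothing is left of the variation of that slice and
  of \<open>OA\<close>. They identify the operators \<open>OB\<close> and \<open>OC\<close> with the
  varied slice of \<open>u\<close>, and where the unit slice of \<open>res3\<close> has its zero
  border they make the border of \<open>u\<close> vanish.\<close>

lemma gen_border: "u \<in> gens \<Longrightarrow> t (Some u) i None = 0" "u \<in> gens \<Longrightarrow> t (Some u) None j = 0"
  and OB_Some: "u \<in> gens \<Longrightarrow> v (OB u (Some m) j) = t (Some u) (Some m) j"
  and OC_Some: "u \<in> gens \<Longrightarrow> v (OC u i (Some m)) = t (Some u) i (Some m)"
proof -
  assume u: "u \<in> gens"
  then have ux: "u \<noteq> x_idx" "u \<noteq> one_idx" by (auto simp: gens_def)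
  show b: "t (Some u) None j = 0" for j
    using eqB[OF u, of None j "Some one_idx"] ux by (simp add: at_mul_one OA_one[OF u] one_zero lmul)
  show "t (Some u) i None = 0" for i
    using eqC[OF u, of i None "Some one_idx"] ux by (simp add: at_mul_one OA_one[OF u] one_zero rmul)
  show "v (OB u (Some m) j) = t (Some u) (Some m) j"
    using eqB[OF u, of "Some m" j "Some one_idx"] ux
    by (cases m) (simp add: at_mul_one OA_one[OF u] one_zero lmul leit_E1)
  show "v (OC u i (Some m)) = t (Some u) i (Some m)"
    using eqC[OF u, of i "Some m" "Some one_idx"] ux
    by (cases m) (simp add: at_mul_one OA_one[OF u] one_zero rmul leit_E1)
qed

lemma gens_mem [simp]: "eps \<in> gens" "y_idx \<in> gens"
  by (simp_all add: gens_def)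

lemmas blocks = lhs lhs_border rmul lmul OB_Some OC_Some gen_border p_True q_False leit_E1

lemma at_mul_simps [simp]:
  "at_mul f eps (Some eps) = 0" "at_mul f eps (Some y_idx) = 0" "at_mul f eps (Some x_idx) = f (Some y_idx)"
  "at_mul f y_idx (Some y_idx) = 0" "at_mul f y_idx (Some x_idx) = f None" "at_mul f u None = 0"
  "g \<in> nilp \<Longrightarrow> at_mul f eps (Some (g, False)) = f (Some (g, True))"
  "g \<in> nilp \<Longrightarrow> at_mul f (g, False) (Some x_idx) = 0"
  "g \<in> nilp \<Longrightarrow> h \<in> nilp \<Longrightarrow> at_mul f (g, False) (Some (h, False)) = 0"
  by (auto simp: at_mul_def mul_def nilp_def)

text \<open>The relation \<epsilon>^2 = 0 makes the lower blocks combinations of residue slices.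
  Pivots remove all coefficients but \<open>l E1\<close> and \<open>l E2\<close>; then \<epsilon> y
  = 0 removes \<open>l E2\<close>, and \<epsilon> x = y together with y^2 = 0 removes
  \<open>l E1\<close>.\<close>

lemma eps_zero: "t (Some eps) i j = 0"
proof -
  have base: "t (Some eps) i j = 0" if "(i, j) \<in> eps_zeros i0" for i j
    using imageI[OF that, of "\<lambda>(i, j). OT (Some eps) i j"] by (intro base_zero) (simp add: base_def)
  have top: "t (Some eps) (Some (i, False)) (Some (j, s)) = 0" for i j s
    using imageI[of "(i, j, s)" UNIV "\<lambda>(i, j, s). (Some (i, False), Some (j, s))"] by (intro base) (simp add: eps_zeros_def)
  have BLz: "t (Some eps) (Some (fst (piv k), True)) (Some (snd (piv k), False)) = 0" if "k \<in> nilp" for k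
    using imageI[OF that, of "\<lambda>k. (Some (fst (piv k), True), Some (snd (piv k), False))"] by (intro base) (simp add: eps_zeros_def)
  have BRz: "t (Some eps) (Some (fst (piv k), True)) (Some (snd (piv k), True)) = 0" for k
    using imageI[of k UNIV "\<lambda>k. (Some (fst (piv k), True), Some (snd (piv k), True))"] by (intro base) (simp add: eps_zeros_def)
  have BRz': "t (Some eps) (Some (E1, True)) (Some (E5, True)) = 0"
    by (intro base) (simp add: eps_zeros_def)
  define l where "l = (\<lambda>k. v (OA eps (Some eps) (Some (k, False))))"
  define l' where "l' = (\<lambda>k. v (OA eps (Some eps) (Some (k, True))))"
  have BL: "t (Some eps) (Some (i, True)) (Some (j, False)) = leit_comb l i j" for i j
    using eqB[of eps "Some (i, False)" "Some (j, False)" "Some eps"] by (simp add: blocks l_def)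
  have BR: "t (Some eps) (Some (i, True)) (Some (j, True))
      = leit_comb l' i j + v (OA eps (Some eps) None) * of_bool (i = E1 \<and> j = E5)" for i j
    using eqB[of eps "Some (i, False)" "Some (j, True)" "Some eps"] by (simp add: blocks l'_def top)
  have l_nilp: "l k = 0" if "k \<in> nilp" for k
    using BLz[OF that] unfolding BL leit_comb_piv .
  have l2: "l E2 = 0"
    using eqB[of eps "Some (E1, False)" "Some (E5, False)" "Some y_idx"]
    by (simp add: blocks leit_comb_15 BL) (simp add: sum_five leit_def leit_comb_def)
  have y: "t (Some y_idx) (Some (E3, True)) (Some (E5, False)) = l E1"
    using eqB[of eps "Some (E3, True)" "Some (E5, False)" "Some x_idx"]
    by (simp add: blocks BL) (simp add: sum_five leit_def leit_comb_def)
  have l1: "l E1 = 0"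
    using eqB[of y_idx "Some (E1, False)" "Some (E5, False)" "Some y_idx"]
    by (simp add: blocks leit_comb_15) (simp add: sum_five leit_def y)
  have l: "l = (\<lambda>_. 0)" using l_nilp l1 l2 by (intro ext) (metis five.exhaust nilp_simps)
  have "l' k = 0" for k
    using BRz[of k] unfolding BR leit_comb_piv by (cases k) simp_all
  then have l': "l' = (\<lambda>_. 0)" by (intro ext)
  have "v (OA eps (Some eps) None) = 0"
    using BRz' unfolding BR leit_comb_15 by simp
  then have "t (Some eps) (Some (i, s)) (Some (j, s')) = 0" for i j s s'
    using top BL[of i j] BR[of i j] by (cases s; cases s') (simp_all add: l l' leit_comb_def)
  then show ?thesis by (cases i; cases j) (auto simp: gen_border)
qed

text \<open>As the \<epsilon> slice does not vary, its two equations say that the varied slice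
  \<open>f\<close> commutes with \<epsilon>, hence is block upper triangular with equal diagonal
  blocks.\<close>

lemma nilp_blocks:
  assumes f: "f \<in> nilp"
  shows "t (Some (f, False)) (Some (i, True)) (Some (j, False)) = 0"
    "t (Some (f, False)) (Some (i, True)) (Some (j, True)) = t (Some (f, False)) (Some (i, False)) (Some (j, False))"
  using eqB[of eps "Some (i, False)" "Some (j, False)" "Some (f, False)"]
    eqC[of eps "Some (i, False)" "Some (j, False)" "Some (f, False)"]
    eqB[of eps "Some (i, False)" "Some (j, True)" "Some (f, False)"]
    eqC[of eps "Some (i, False)" "Some (j, True)" "Some (f, False)"] f
  by (auto simp: blocks eps_zero nilp_def)

text \<open>The relation for \<epsilon> x shows that the part of the column in question is a
  multiple of \<open>p\<close>; \<open>base\<close> sets its entry at \<open>i0\<close> to zero. The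
  same coefficient governs the row.\<close>

lemma x_borders: "t (Some x_idx) (Some (i, True)) None = 0" "t (Some x_idx) None (Some (j, False)) = 0"
proof -
  have z: "t (Some x_idx) (Some (i0, True)) None = 0"
    by (intro base_zero) (simp add: base_def)
  have c: "v (OA eps (Some x_idx) (Some x_idx)) * p (i, False) = t (Some x_idx) (Some (i, True)) None" for i
    using eqC[of eps "Some (i, False)" None "Some x_idx"] by (simp add: blocks eps_zero)
  have a: "v (OA eps (Some x_idx) (Some x_idx)) = 0" using c[of i0] p0 z by simp
  show "t (Some x_idx) (Some (i, True)) None = 0" using c[of i] a by simp
  show "t (Some x_idx) None (Some (j, False)) = 0"
    using eqB[of eps None "Some (j, True)" "Some x_idx"] by (simp add: blocks eps_zero a)
qed

sublocale reduced v "\<lambda>i. p (i, False)" "\<lambda>j. q (j, True)"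
    "\<lambda>j. v (OB eps None (Some (j, False)))" "\<lambda>j. v (OB eps None (Some (j, True)))"
    "\<lambda>i. v (OC eps (Some (i, False)) None)" "\<lambda>i. v (OC eps (Some (i, True)) None)"
    "\<lambda>f j. v (OB (f, False) None (Some (j, False)))" "\<lambda>f j. v (OB (f, False) None (Some (j, True)))"
    "\<lambda>f i. v (OC (f, False) (Some (i, False)) None)" "\<lambda>f i. v (OC (f, False) (Some (i, True)) None)"
    "\<lambda>f k. v (OA (f, False) (Some x_idx) (Some (k, False)))" "\<lambda>f k. v (OA (f, False) (Some x_idx) (Some (k, True)))"
    "\<lambda>f. v (OA (f, False) (Some x_idx) None)"
    "\<lambda>f g k. v (OA (f, False) (Some (g, False)) (Some (k, False)))" "\<lambda>f g k. v (OA (f, False) (Some (g, False)) (Some (k, True)))"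
    "\<lambda>f g. v (OA (f, False) (Some (g, False)) None)" .

lemma reduced_system:
  assumes common: "list_all (\<lambda>out. v out = 0) common"
  shows "reduced_system v (\<lambda>i. p (i, False)) (\<lambda>j. q (j, True))
    (\<lambda>j. v (OB eps None (Some (j, False)))) (\<lambda>j. v (OB eps None (Some (j, True))))
    (\<lambda>i. v (OC eps (Some (i, False)) None)) (\<lambda>i. v (OC eps (Some (i, True)) None))
    (\<lambda>f j. v (OB (f, False) None (Some (j, False)))) (\<lambda>f j. v (OB (f, False) None (Some (j, True))))
    (\<lambda>f i. v (OC (f, False) (Some (i, False)) None)) (\<lambda>f i. v (OC (f, False) (Some (i, True)) None))
    (\<lambda>f k. v (OA (f, False) (Some x_idx) (Some (k, False)))) (\<lambda>f k. v (OA (f, False) (Some x_idx) (Some (k, True))))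
    (\<lambda>f. v (OA (f, False) (Some x_idx) None))
    (\<lambda>f g k. v (OA (f, False) (Some (g, False)) (Some (k, False)))) (\<lambda>f g k. v (OA (f, False) (Some (g, False)) (Some (k, True))))
    (\<lambda>f g. v (OA (f, False) (Some (g, False)) None))"
proof (unfold_locales, unfold p_out q_out)
  fix f g :: five and i j k
  have pv: "t g (Some (fst (piv k), False)) (Some (snd (piv k), s)) = 0"
    if "g \<noteq> Some one_idx" "(k, s) \<noteq> x_idx" for g s
    using pivot_zero(1)[OF that] by (simp add: pivot_def)
  show "S i j = p (i, False) * v (OB eps None (Some (j, False)))"
    using eqB[of eps "Some (i, False)" "Some (j, False)" "Some x_idx"]
      eqC[of eps "Some (i, False)" "Some (j, False)" "Some x_idx"] by (simp add: blocks eps_zero)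
  show "S i j = v (OC eps (Some (i, True)) None) * q (j, True)"
    using eqB[of eps "Some (i, True)" "Some (j, True)" "Some x_idx"]
      eqC[of eps "Some (i, True)" "Some (j, True)" "Some x_idx"] by (simp add: blocks eps_zero)
  show "P i j + p (i, False) * v (OB eps None (Some (j, True))) = T i j + v (OC eps (Some (i, False)) None) * q (j, True)"
    using eqB[of eps "Some (i, False)" "Some (j, True)" "Some x_idx"]
      eqC[of eps "Some (i, False)" "Some (j, True)" "Some x_idx"] by (simp add: blocks eps_zero)
  show "P (fst (piv k)) (snd (piv k)) = 0" if "k \<noteq> E2" using pv that by simp
  show "Q (fst (piv k)) (snd (piv k)) = 0" using pv by simp
  show "Q E1 E5 = 0" by (simp add: pivot_zero)
  show "list_all (\<lambda>out. v out = 0) common" by (rule common)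
  assume f: "f \<in> nilp"
  then have f': "(f, False) \<noteq> one_idx" "(f, False) \<noteq> x_idx" "f \<noteq> E2" "f \<noteq> E1" by (auto simp: nilp_def)
  note f_gens = nilp_gens[OF f]
  show "A f (fst (piv k)) (snd (piv k)) = 0" if "k \<noteq> E2" using pv that f' by simp
  show "B f (fst (piv k)) (snd (piv k)) = 0" using pv f' by simp
  show "B f E1 E5 = 0" using f' by (simp add: pivot_zero)
  note s = blocks f f' f_gens nilp_blocks[OF f]
  show "(\<Sum>k\<in>UNIV. P i k * leit f k j) + (\<Sum>k\<in>UNIV. leit E2 i k * A f k j) + p (i, False) * v (OB (f, False) None (Some (j, False)))
      = leit_comb (\<lambda>k. v (OA (f, False) (Some x_idx) (Some (k, False)))) i j"
    using eqB[OF f_gens, of "Some (i, False)" "Some (j, False)" "Some x_idx"] by (simp add: s)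
  show "(\<Sum>k\<in>UNIV. leit f i k * P k j) + (\<Sum>k\<in>UNIV. A f i k * leit E2 k j)
      = leit_comb (\<lambda>k. v (OA (f, False) (Some x_idx) (Some (k, False)))) i j"
    using eqC[OF f_gens, of "Some (i, False)" "Some (j, False)" "Some x_idx"] by (simp add: s)
  show "(\<Sum>k\<in>UNIV. T i k * leit f k j) + (\<Sum>k\<in>UNIV. leit E2 i k * A f k j)
      = leit_comb (\<lambda>k. v (OA (f, False) (Some x_idx) (Some (k, False)))) i j"
    using eqB[OF f_gens, of "Some (i, True)" "Some (j, True)" "Some x_idx"] by (simp add: s)
  show "(\<Sum>k\<in>UNIV. leit f i k * T k j) + (\<Sum>k\<in>UNIV. A f i k * leit E2 k j) + v (OC (f, False) (Some (i, True)) None) * q (j, True)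
      = leit_comb (\<lambda>k. v (OA (f, False) (Some x_idx) (Some (k, False)))) i j"
    using eqC[OF f_gens, of "Some (i, True)" "Some (j, True)" "Some x_idx"] by (simp add: s)
  show "(\<Sum>k\<in>UNIV. Q i k * leit f k j) + (\<Sum>k\<in>UNIV. leit E2 i k * B f k j) + p (i, False) * v (OB (f, False) None (Some (j, True)))
      = leit_comb (\<lambda>k. v (OA (f, False) (Some x_idx) (Some (k, True)))) i j
        + v (OA (f, False) (Some x_idx) None) * of_bool (i = E1 \<and> j = E5)"
    using eqB[OF f_gens, of "Some (i, False)" "Some (j, True)" "Some x_idx"] by (simp add: s)
  show "(\<Sum>k\<in>UNIV. leit f i k * Q k j) + (\<Sum>k\<in>UNIV. B f i k * leit E2 k j) + v (OC (f, False) (Some (i, False)) None) * q (j, True)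
      = leit_comb (\<lambda>k. v (OA (f, False) (Some x_idx) (Some (k, True)))) i j
        + v (OA (f, False) (Some x_idx) None) * of_bool (i = E1 \<and> j = E5)"
    using eqC[OF f_gens, of "Some (i, False)" "Some (j, True)" "Some x_idx"] by (simp add: s)
  show "(\<Sum>k\<in>UNIV. leit f i k * \<pi> k) + (\<Sum>k\<in>UNIV. A f i k * p (k, False))
      = v (OA (f, False) (Some x_idx) (Some (E2, False))) * p (i, False)"
    using eqC[OF f_gens, of "Some (i, False)" None "Some x_idx"] by (simp add: s)
  show "(\<Sum>k\<in>UNIV. \<theta> k * leit f k j) + (\<Sum>k\<in>UNIV. q (k, True) * A f k j)
      = v (OA (f, False) (Some x_idx) (Some (E2, False))) * q (j, True)"
    using eqB[OF f_gens, of None "Some (j, True)" "Some x_idx"] by (simp add: s)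
  assume g: "g \<in> nilp"
  then have g': "(g, False) \<noteq> x_idx" "g \<noteq> E2" "g \<noteq> E1" by (auto simp: nilp_def)
  note s = s g g' nilp_blocks[OF g]
  show "(\<Sum>k\<in>UNIV. A g i k * leit f k j) + (\<Sum>k\<in>UNIV. leit g i k * A f k j)
      = leit_comb (\<lambda>k. v (OA (f, False) (Some (g, False)) (Some (k, False)))) i j"
    using eqB[OF f_gens, of "Some (i, False)" "Some (j, False)" "Some (g, False)"] by (simp add: s)
  show "(\<Sum>k\<in>UNIV. leit f i k * A g k j) + (\<Sum>k\<in>UNIV. A f i k * leit g k j)
      = leit_comb (\<lambda>k. v (OA (f, False) (Some (g, False)) (Some (k, False)))) i j"
    using eqC[OF f_gens, of "Some (i, False)" "Some (j, False)" "Some (g, False)"] by (simp add: s)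
  show "(\<Sum>k\<in>UNIV. B g i k * leit f k j) + (\<Sum>k\<in>UNIV. leit g i k * B f k j)
      = leit_comb (\<lambda>k. v (OA (f, False) (Some (g, False)) (Some (k, True)))) i j
        + v (OA (f, False) (Some (g, False)) None) * of_bool (i = E1 \<and> j = E5)"
    using eqB[OF f_gens, of "Some (i, False)" "Some (j, True)" "Some (g, False)"] by (simp add: s)
  show "(\<Sum>k\<in>UNIV. leit f i k * B g k j) + (\<Sum>k\<in>UNIV. B f i k * leit g k j)
      = leit_comb (\<lambda>k. v (OA (f, False) (Some (g, False)) (Some (k, True)))) i j
        + v (OA (f, False) (Some (g, False)) None) * of_bool (i = E1 \<and> j = E5)"
    using eqC[OF f_gens, of "Some (i, False)" "Some (j, True)" "Some (g, False)"] by (simp add: s)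
qed simp_all

text \<open>The positions of \<open>pivs\<close> detect the slices of \<open>res3\<close>
  separately, so each coefficient \<open>K h\<close> vanishes, and then \<open>H\<close>
  does.\<close>

lemma kill:
  assumes e: "\<And>i j. H i j + (\<Sum>h\<in>UNIV. K h * res3 p q h i j) = 0"
    and H: "\<And>h. h \<noteq> x_idx \<Longrightarrow> H (Some (fst (pivot h))) (Some (snd (pivot h))) = 0"
      "H (Some (i0, False)) None = 0" "H (Some (E1, False)) (Some (E5, True)) = 0"
  shows "K h = 0" "H i j = 0"
proof -
  have x: "K (Some x_idx) = 0" using e[of "Some (i0, False)" None] H(2) p0 by (simp add: lhs_border)
  have g: "K (Some g) = 0" if "g \<noteq> x_idx" for g
  proof -
    have "(\<Sum>h\<in>UNIV. K h * res3 p q h (Some (fst (pivot g))) (Some (snd (pivot g)))) = K (Some g)"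
      by (simp add: sum_option res3_def e15_pivot std_pivot if_distrib[of "\<lambda>x. _ * x"] cong: if_cong)
    then show ?thesis using e[of "Some (fst (pivot g))" "Some (snd (pivot g))"] H(1)[OF that] by simp
  qed
  have n: "K None = 0" using e[of "Some (E1, False)" "Some (E5, True)"] H(3) by (simp add: lhs leit_comb_15)
  show K: "K h = 0" for h using x g n by (cases h) (case_tac "a = x_idx"; simp)+
  show "H i j = 0" using e[of i j] by (simp add: K)
qed

text \<open>The slices not covered by \<open>all_zero\<close> are products: y = \<epsilon> x, then
  \<epsilon> times a nilpotent slice, then y x for the new one. Each relation determines its slice
  up to a combination of residue slices, which \<open>kill\<close> excludes.\<close>

lemma all_outs_zero:
  assumes all_zero "out \<in> outs"
  shows "v out = 0"
proof -
  have x_zero: "t (Some x_idx) i j = 0" for i j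
  proof -
    have "t (Some x_idx) None None = 0" by (intro base_zero) (simp add: base_def)
    moreover have "t (Some x_idx) (Some (i, s)) None = 0" "t (Some x_idx) None (Some (i, s)) = 0" for i s
      using assms(1) x_borders by (cases s; simp add: all_zero_def)+
    moreover have "t (Some x_idx) (Some (i, s)) (Some (j, s')) = 0" for i j s s'
      using assms(1) by (cases s; cases s'; simp add: all_zero_def)
    ultimately show ?thesis by (cases i; cases j) auto
  qed
  have f_zero: "t (Some (f, False)) i j = 0" if f: "f \<in> nilp" for f i j
  proof -
    have "t (Some (f, False)) (Some (i, s)) (Some (j, s')) = 0" for i j s s'
      using assms(1) f nilp_blocks[OF f, of i j] by (cases s; cases s'; simp add: all_zero_def)
    then show ?thesis by (cases i; cases j) (auto simp: gen_border nilp_gens[OF f])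
  qed
  have bc: "v (OB u None j) = 0 \<and> v (OC u j None) = 0" if u: "u \<in> gens" and tu: "\<And>i j. t (Some u) i j = 0" for u j
  proof -
    have ux: "u \<noteq> x_idx" using u by (auto simp: gens_def)
    \<comment> \<open>Since the slice x no longer varies, its two equations relate the border row of
      \<open>OB\<close> to the border column of \<open>OC\<close>; the zero of \<open>base\<close>
      at \<open>j0\<close> then makes both vanish.\<close>
    have e: "p i * v (OB u None (Some j)) = v (OC u (Some i) None) * q j" for i j
      using eqB[OF u, of "Some i" "Some j" "Some x_idx"] eqC[OF u, of "Some i" "Some j" "Some x_idx"] u tu
      by (cases i; cases j) (simp add: x_zero OB_Some OC_Some lmul rmul)
    have "v (OB u None (Some (j0, True))) = 0" using u by (intro base_zero) (force simp: base_def)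
    then have C: "v (OC u (Some i) None) = 0" for i using e[of i "(j0, True)"] q0 by simp
    then have B: "v (OB u None (Some j)) = 0" for j using e[of "(i0, False)" j] p0 by simp
    have "p (i0, False) * v (OB u None None) = 0"
      using eqB[OF u, of "Some (i0, False)" None "Some x_idx"] eqC[OF u, of "Some (i0, False)" None "Some x_idx"] u tu
      by (simp add: x_zero OB_Some OC_Some lmul rmul)
    moreover have "v (OC u None None) * q (j0, True) = 0"
      using eqB[OF u, of None "Some (j0, True)" "Some x_idx"] eqC[OF u, of None "Some (j0, True)" "Some x_idx"] u tu
      by (simp add: x_zero OB_Some OC_Some lmul rmul)
    ultimately show ?thesis using B C p0 q0 by (cases j) auto
  qed
  have OB_zero: "v (OB u m j) = 0" if u: "u \<in> gens" and tu: "\<And>i j. t (Some u) i j = 0" for u m j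
    using bc[OF u tu, of j] OB_Some[OF u] tu by (cases m) auto
  have y_zero: "t (Some y_idx) i j = 0" for i j
  proof (rule kill(2))
    show "t (Some y_idx) i j + (\<Sum>h\<in>UNIV. v (OA eps (Some x_idx) h) * res3 p q h i j) = 0" for i j
      using eqB[of eps i j "Some x_idx"] by (simp add: x_zero OB_zero eps_zero)
  qed (simp_all add: pivot_zero)
  have f'_zero: "t (Some (f, True)) i j = 0" if f: "f \<in> nilp" for f i j
  proof (rule kill(2))
    show "t (Some (f, True)) i j + (\<Sum>h\<in>UNIV. v (OA eps (Some (f, False)) h) * res3 p q h i j) = 0" for i j
      using eqB[of eps i j "Some (f, False)"] f by (simp add: f_zero OB_zero eps_zero)
  qed (use f in \<open>auto simp: pivot_zero\<close>)
  have n_zero: "t None i j = 0" for i j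
  proof (rule kill(2))
    show "t None i j + (\<Sum>h\<in>UNIV. v (OA y_idx (Some x_idx) h) * res3 p q h i j) = 0" for i j
      using eqB[of y_idx i j "Some x_idx"] by (simp add: x_zero OB_zero y_zero)
  qed (simp_all add: pivot_zero)
  have T: "t g i j = 0" for g i j
  proof (cases g)
    case (Some h)
    obtain k s where "h = (k, s)" by (cases h)
    then show ?thesis using Some
      by (cases k; cases s) (simp_all add: x_zero y_zero eps_zero one_zero f_zero f'_zero)
  qed (simp add: n_zero)
  have OA_zero: "v (OA u g h) = 0" if u: "u \<in> gens" for u g h
  proof (rule kill(1)[of "\<lambda>_ _. 0"])
    show "0 + (\<Sum>h\<in>UNIV. v (OA u g h) * res3 p q h i j) = 0" for i j
      using eqB[OF u, of i j g] by (simp add: T OB_zero[OF u] at_mul_def split: option.splits)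
  qed simp_all
  have OC_zero: "v (OC u i m) = 0" if u: "u \<in> gens" for u i m
    using bc[OF u T, of i] OC_Some[OF u] T by (cases m) auto
  show ?thesis
    using assms(2) T OA_zero OB_zero[OF _ T] OC_zero by (auto simp: outs_def)
qed

end

section \<open>Counting conditions, and the contradiction\<close>

context normal_form
begin

lemma contradiction_from:
  assumes p0: "p (i0, False) \<noteq> 0" and q0: "q (j0, True) \<noteq> 0" and len: "length chosen \<le> 58 - length common"
    and sub: "set common \<union> set chosen \<subseteq> outs" and com: "length common \<le> 58"
    and zero: "\<And>v. solution p q v i0 j0 \<Longrightarrow> list_all (\<lambda>out. v out = 0) common \<Longrightarrow> list_all (\<lambda>out. v out = 0) chosen
        \<Longrightarrow> reduced.all_zero v"
  shows False
proof -
  define J where "J = base i0 j0 \<union> (set common \<union> set chosen)"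
  \<comment> \<open>With at most 58 searched coordinates this is at most 395, one less than the
    number of parameters.\<close>
  have "card J \<le> 337 + (length common + length chosen)"
    unfolding J_def by (intro card_Un_bound base card_length)
  then have J: "finite J" "card J < 396" using len com base(1)[of i0 j0] by (auto simp: J_def)
  obtain f where f: "\<exists>out\<in>outs. f out \<noteq> 0" "\<forall>out\<in>J \<inter> outs. f out = 0" and
    eqs: "\<forall>u g i j. u \<in> gens \<longrightarrow>
      at_mul (\<lambda>h. f (OT h i j)) u g + (\<Sum>h\<in>UNIV. f (OA u g h) * res3 p q h i j)
        = (\<Sum>m\<in>UNIV. f (OT g i m) * res3 p q (Some u) m j) + (\<Sum>m\<in>UNIV. res3 p q g i m * f (OB u m j)) \<and>
      at_mul (\<lambda>h. f (OT h i j)) u g + (\<Sum>h\<in>UNIV. f (OA u g h) * res3 p q h i j)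
        = (\<Sum>m\<in>UNIV. res3 p q (Some u) i m * f (OT g m j)) + (\<Sum>m\<in>UNIV. f (OC u i m) * res3 p q g m j)"
    using residue_solution[OF J] by (elim exE conjE) (rule that)
  have "J \<subseteq> outs" using sub base_outs[of i0 j0] by (simp add: J_def)
  then have fJ: "f out = 0" if "out \<in> J" for out
    using bspec[OF f(2), of out] subsetD[of J outs out] that by simp
  have sol: "solution p q f i0 j0"
  proof
    show "f out = 0" if "out \<in> base i0 j0" for out using fJ that by (simp add: J_def)
    fix u :: idx and g i j assume u: "u \<in> gens"
    note e = eqs[rule_format, OF u, of i j g]
    show "at_mul (\<lambda>h. f (OT h i j)) u g + (\<Sum>h\<in>UNIV. f (OA u g h) * res3 p q h i j)
        = (\<Sum>m\<in>UNIV. f (OT g i m) * res3 p q (Some u) m j) + (\<Sum>m\<in>UNIV. res3 p q g i m * f (OB u m j))"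
      using e by (rule conjunct1)
    show "at_mul (\<lambda>h. f (OT h i j)) u g + (\<Sum>h\<in>UNIV. f (OA u g h) * res3 p q h i j)
        = (\<Sum>m\<in>UNIV. res3 p q (Some u) i m * f (OT g m j)) + (\<Sum>m\<in>UNIV. f (OC u i m) * res3 p q g m j)"
      using e by (rule conjunct2)
  qed (fact p_supp q_supp p0 q0)+
  have "list_all (\<lambda>out. f out = 0) common" "list_all (\<lambda>out. f out = 0) chosen"
    using fJ by (simp_all add: J_def list_all_iff)
  then have "reduced.all_zero f" by (intro zero sol)
  then have "f out = 0" if "out \<in> outs" for out
    using that by (rule solution.all_outs_zero[OF sol])
  then show False using f(1) by simp
qed

lemma pi0: "solution p q v i0 j0 \<Longrightarrow> v (t\<pi> i0) = 0"
  using solution.pivot_zero(2)[of p q v i0 j0 "Some x_idx"] by simp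

lemma contradiction: False
proof -
  note ctr = contradiction_from
  obtain i where i: "p i \<noteq> 0" using p_nz by (rule exE)
  obtain j where j: "q j \<noteq> 0" using q_nz by (rule exE)
  have p: "p (E1, False) \<noteq> 0 \<or> p (E1, False) = 0 \<and> p (E2, False) \<noteq> 0"
    using i p_supp[OF i] by (cases i) auto
  have q: "q (E4, True) \<noteq> 0 \<or> q (E4, True) = 0 \<and> q (E5, True) \<noteq> 0"
    using j q_supp[OF j] by (cases j) auto
  from p q show False
  proof (elim disjE conjE)
    assume pq: "p (E1, False) \<noteq> 0" "q (E4, True) \<noteq> 0"
    have "reduced.all_zero v" if "solution p q v E1 E4" "list_all (\<lambda>out. v out = 0) common"
      "list_all (\<lambda>out. v out = 0) chosen14" for v
      by (rule reduced_system.zero_14[OF solution.reduced_system[OF that(1,2)] pq that(3) pi0[OF that(1)]])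
    then show False
      by (intro ctr[where chosen = chosen14, OF pq(1,2)]) (simp_all add: chosen14_def common_def outsI)
  next
    assume pq: "p (E1, False) \<noteq> 0" "q (E4, True) = 0" "q (E5, True) \<noteq> 0"
    have "reduced.all_zero v" if "solution p q v E1 E5" "list_all (\<lambda>out. v out = 0) common"
      "list_all (\<lambda>out. v out = 0) chosen15" for v
      by (rule reduced_system.zero_15[OF solution.reduced_system[OF that(1,2)] pq that(3) pi0[OF that(1)]])
    then show False
      by (intro ctr[where chosen = chosen15, OF pq(1,3)]) (simp_all add: chosen15_def common_def outsI)
  next
    assume pq: "p (E1, False) = 0" "p (E2, False) \<noteq> 0" "q (E4, True) \<noteq> 0"
    have "reduced.all_zero v" if "solution p q v E2 E4" "list_all (\<lambda>out. v out = 0) common"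
      "list_all (\<lambda>out. v out = 0) chosen24" for v
      by (rule reduced_system.zero_24[OF solution.reduced_system[OF that(1,2)] pq that(3) pi0[OF that(1)]])
    then show False
      by (intro ctr[where chosen = chosen24, OF pq(2,3)]) (simp_all add: chosen24_def common_def outsI)
  next
    assume pq: "p (E1, False) = 0" "p (E2, False) \<noteq> 0" "q (E4, True) = 0" "q (E5, True) \<noteq> 0"
    have "reduced.all_zero v" if "solution p q v E2 E5" "list_all (\<lambda>out. v out = 0) common"
      "list_all (\<lambda>out. v out = 0) chosen25" for v
      by (rule reduced_system.zero_25[OF solution.reduced_system[OF that(1,2)] pq that(3) pi0[OF that(1)]])
    then show False
      by (intro ctr[where chosen = chosen25, OF pq(2,4)]) (simp_all add: chosen25_def common_def outsI)
  qed
qed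

end

section \<open>Lower bound\<close>

text \<open>\<open>idx option\<close> has eleven elements, so the hypothesis places
  \<open>std\<close> in the closure of the tensors of rank at most 11.\<close>

lemma std_not_limit:
  assumes "\<And>e. (\<And>x y z :: idx option \<Rightarrow> idx \<Rightarrow> complex.
      pexp_val id (\<lambda>g i j. \<Sum>k\<in>UNIV. x k g * y k i * z k j) e = 0) \<Longrightarrow> pexp_val id std e = 0"
  shows False
proof (rule place_of_closure[where \<tau> = std])
  show "pexp_val id std e = 0"
    if "\<And>x y z :: idx option \<Rightarrow> idx \<Rightarrow> complex. pexp_val id (\<lambda>g i j. \<Sum>k\<in>UNIV. x k g * y k i * z k j) e = 0" for e
    using that by (rule assms)
  show "CARD(idx) > 1" by simp
  fix V :: "mpoly fract set" and r and \<alpha> \<beta> \<gamma> :: "idx option \<Rightarrow> idx \<Rightarrow> mpoly fract"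
  assume "place V r"
    and int: "\<And>g i j. (\<Sum>k\<in>UNIV. \<alpha> k g * \<beta> k i * \<gamma> k j) \<in> V"
    and res: "\<And>g i j. r (\<Sum>k\<in>UNIV. \<alpha> k g * \<beta> k i * \<gamma> k j) = std g i j"
    and nz: "\<And>k g. \<alpha> k g \<noteq> 0"
    and ind: "\<And>\<kappa>. (\<And>i j. (\<Sum>k\<in>UNIV. \<kappa> k * (\<beta> k i * \<gamma> k j)) = 0) \<Longrightarrow> \<kappa> = (\<lambda>_. 0)"
  interpret place V r by fact
  show False
  proof (rule normalize_unit_slice[of \<alpha> \<beta> \<gamma> one_idx])
    show "tens \<alpha> \<beta> \<gamma> g i j \<in> V" for g i j unfolding tens_def by (rule int)
    show "r (tens \<alpha> \<beta> \<gamma> one_idx i j) = (if i = j then 1 else 0)" for i j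
      by (simp add: tens_def res std_one)
    show "\<kappa> = (\<lambda>_. 0)" if "\<And>i j. (\<Sum>k\<in>UNIV. \<kappa> k * (\<beta> k i * \<gamma> k j)) = 0" for \<kappa>
      using that by (rule ind)
    fix \<gamma>' assume g1: "\<And>g i j. tens \<alpha> \<beta> \<gamma>' g i j \<in> V"
      and g2: "\<And>g i j. r (tens \<alpha> \<beta> \<gamma>' g i j) = r (tens \<alpha> \<beta> \<gamma> g i j)"
      and g3: "\<And>i j. tens \<alpha> \<beta> \<gamma>' one_idx i j = (if i = j then 1 else 0)"
      and g4: "\<And>\<kappa>. (\<And>i j. (\<Sum>k\<in>UNIV. \<kappa> k * (\<beta> k i * \<gamma>' k j)) = 0) \<Longrightarrow> \<kappa> = (\<lambda>_. 0)"
    have res': "r (tens \<alpha> \<beta> \<gamma>' g i j) = std g i j" for g i j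
      unfolding g2 unfolding tens_def by (rule res)
    let ?w = "\<lambda>k (i, j). \<beta> k i * \<gamma>' k j"
    show False
    proof (rule extend_slices[of ?w "\<lambda>g k. \<alpha> k g" pivot])
      fix \<kappa> assume z: "\<And>d. (\<Sum>k\<in>UNIV. \<kappa> k * ?w k d) = 0"
      show "\<kappa> = (\<lambda>_. 0)" by (rule g4) (use z[of "(_, _)"] in simp)
    next
      fix g d
      show "(\<Sum>k\<in>UNIV. \<alpha> k g * ?w k d) \<in> V"
        using g1[of g "fst d" "snd d"] unfolding tens_def by (cases d) (simp add: mult.assoc)
    next
      fix g g'
      have "(\<Sum>k\<in>UNIV. \<alpha> k g * ?w k (pivot g')) = tens \<alpha> \<beta> \<gamma>' g (fst (pivot g')) (snd (pivot g'))"
        unfolding tens_def by (cases "pivot g'") (simp add: mult.assoc)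
      then show "r (\<Sum>k\<in>UNIV. \<alpha> k g * ?w k (pivot g')) = (if g = g' then 1 else 0)"
        by (simp add: res' std_pivot)
    next
      fix t assume t1: "\<And>d. (\<Sum>k\<in>UNIV. t k * ?w k d) \<in> V" and t2: "\<exists>d. r (\<Sum>k\<in>UNIV. t k * ?w k d) \<noteq> 0"
        and t3: "\<And>g. (\<Sum>k\<in>UNIV. t k * ?w k (pivot g)) = 0"
        and t4: "\<And>\<kappa>. (\<And>k. (\<Sum>g\<in>UNIV. \<kappa> g * (case g of None \<Rightarrow> t k | Some i \<Rightarrow> \<alpha> k i)) = 0) \<Longrightarrow> \<kappa> = (\<lambda>_. 0)"
      define a where "a k = case_option (t k) (\<alpha> k)" for k
      have a: "rows_indep a"
        unfolding rows_indep_def a_def by (intro allI impI t4) (rule spec)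
      have aS: "a k (Some g) = \<alpha> k g" and aN: "a k None = t k" for k g by (simp_all add: a_def)
      have Ta: "tens a \<beta> \<gamma>' (Some g) i j = tens \<alpha> \<beta> \<gamma>' g i j"
        and TN: "tens a \<beta> \<gamma>' None i j = (\<Sum>k\<in>UNIV. t k * ?w k (i, j))" for g i j
        by (simp_all add: tens_def aS aN mult.assoc)
      have intT: "tens a \<beta> \<gamma>' g i j \<in> V" for g i j
        using g1 t1[of "(i, j)"] by (cases g) (simp_all only: Ta TN)
      \<comment> \<open>A vanishing rank-one term would contradict independence; so every
        \<open>\<beta> k\<close> and every \<open>\<gamma>' k\<close> is nonzero, as
        \<open>extend_side\<close> requires.\<close>
      have indicator: False if "\<And>i j. \<beta> k i * \<gamma>' k j = 0" for k
      proof -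
        have "(\<lambda>l. if l = k then 1 else 0) = (\<lambda>_. 0 :: mpoly fract)"
          by (rule g4) (simp add: that if_distrib[of "\<lambda>x. x * _"] cong: if_cong)
        from fun_cong[OF this, of k] show False by simp
      qed
      have nzc: "\<exists>j. \<gamma>' k j \<noteq> 0" for k using indicator[of k] by auto
      have nzb: "\<exists>j. \<beta> k j \<noteq> 0" for k using indicator[of k] by auto
      obtain tb where b1: "rows_indep (\<lambda>k. case_option (tb k) (\<beta> k))"
        and b2: "\<And>g j. (\<Sum>k\<in>UNIV. a k g * tb k * \<gamma>' k j) \<in> V"
        and b3: "\<exists>g j. r (\<Sum>k\<in>UNIV. a k g * tb k * \<gamma>' k j) \<noteq> 0"
        and b4: "\<And>j. (\<Sum>k\<in>UNIV. a k (Some one_idx) * tb k * \<gamma>' k j) = 0"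
        by (rule extend_side[of a \<gamma>' \<beta> "Some one_idx", OF a nzc intT], simp add: Ta g3, rule that, assumption+)
      \<comment> \<open>The third factor is extended by exchanging the roles of the second and the
        third.\<close>
      have sw: "tens a \<gamma>' \<beta> g i j = tens a \<beta> \<gamma>' g j i" for g i j
        by (simp add: tens_def mult_ac)
      obtain tc where c1: "rows_indep (\<lambda>k. case_option (tc k) (\<gamma>' k))"
        and c2: "\<And>g j. (\<Sum>k\<in>UNIV. a k g * tc k * \<beta> k j) \<in> V"
        and c3: "\<exists>g j. r (\<Sum>k\<in>UNIV. a k g * tc k * \<beta> k j) \<noteq> 0"
        and c4: "\<And>j. (\<Sum>k\<in>UNIV. a k (Some one_idx) * tc k * \<beta> k j) = 0"
        by (rule extend_side[of a \<beta> \<gamma>' "Some one_idx", OF a nzb], simp add: sw intT, simp add: sw Ta g3, rule that, assumption+)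
      define b where "b k = case_option (tb k) (\<beta> k)" for k
      define c where "c k = case_option (tc k) (\<gamma>' k)" for k
      have T1: "tens a b c g (Some i) (Some j) = tens a \<beta> \<gamma>' g i j"
        and T2: "tens a b c g (Some i) None = (\<Sum>k\<in>UNIV. a k g * tc k * \<beta> k i)"
        and T3: "tens a b c g None (Some j) = (\<Sum>k\<in>UNIV. a k g * tb k * \<gamma>' k j)" for g i j
        by (simp_all add: tens_def b_def c_def mult_ac)
      have TN': "tens a b c None (Some (fst d)) (Some (snd d)) = (\<Sum>k\<in>UNIV. t k * ?w k d)" for d
        unfolding T1 TN by simp
      interpret extended V r a b c
      proof
        show "rows_indep a" by (rule a)
        show "rows_indep b" using b1 unfolding b_def .
        show "rows_indep c" using c1 unfolding c_def .
        show "a k (Some one_idx) \<noteq> 0" for k using nz by (simp add: aS)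
        show "tens a b c (Some one_idx) (Some i) (Some j) = (if i = j then 1 else 0)" for i j
          by (simp add: T1 Ta g3)
        show "tens a b c (Some one_idx) (Some i) None = 0" for i by (simp add: T2 c4)
        show "tens a b c (Some one_idx) None (Some j) = 0" for j by (simp add: T3 b4)
        show "tens a b c g (Some i) (Some j) \<in> V" for g i j by (simp add: T1 intT)
        show "r (tens a b c (Some g) (Some i) (Some j)) = std g i j" for g i j by (simp add: T1 Ta res')
        show "tens a b c None (Some (fst (pivot g))) (Some (snd (pivot g))) = 0" for g by (simp only: TN' t3)
        obtain d where "r (\<Sum>k\<in>UNIV. t k * ?w k d) \<noteq> 0" using t2 by (rule exE)
        then have "r (tens a b c None (Some (fst d)) (Some (snd d))) \<noteq> 0" by (simp only: TN' not_False_eq_True)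
        then show "\<exists>i j. r (tens a b c None (Some i) (Some j)) \<noteq> 0" by (rule_tac exI, rule_tac exI)
        show "tens a b c g (Some i) None \<in> V" for g i by (simp add: T2 c2)
        show "\<exists>g i. r (tens a b c g (Some i) None) \<noteq> 0" using c3 by (simp add: T2)
        show "tens a b c g None (Some j) \<in> V" for g j by (simp add: T3 b2)
        show "\<exists>g j. r (tens a b c g None (Some j)) \<noteq> 0" using b3 by (simp add: T3)
      qed
      obtain a' p q where "normal_form V r a' b c p q" using normal_form_exists by (elim exE) (rule that)
      then show False by (rule normal_form.contradiction)
    qed
  qed
qed

section \<open>Zariski closure, and coordinates in arbitrary bases\<close>

lemma polynomial_functions_sum:
  "(\<And>i. i \<in> I \<Longrightarrow> f i \<in> polynomial_functions) \<Longrightarrow> (\<lambda>X. \<Sum>i\<in>I. f i X) \<in> polynomial_functions"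
  by (induction I rule: infinite_finite_induct) (auto intro: polynomial_functions.intros)

lemma pexp_val_polynomial:
  assumes "\<And>g i j. (\<lambda>X. \<tau> X g i j) \<in> polynomial_functions"
  shows "(\<lambda>X. pexp_val id (\<tau> X) e) \<in> polynomial_functions"
  by (induction e) (auto intro: assms polynomial_functions.intros)

text \<open>The common zeros of all polynomials vanishing on \<open>S\<close> form the smallest
  closed set containing \<open>S\<close>.\<close>

lemma zariski_closure_iff:
  "T \<in> zariski_closure S \<longleftrightarrow> (\<forall>p\<in>polynomial_functions. (\<forall>X\<in>S. p X = 0) \<longrightarrow> p T = 0)"
proof
  assume T: "T \<in> zariski_closure S"
  let ?P = "{p \<in> polynomial_functions. \<forall>X\<in>S. p X = 0}"
  have "zariski_closed {T. \<forall>p\<in>?P. p T = 0}"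
    unfolding zariski_closed_def by (rule exI[of _ ?P]) simp
  moreover have "S \<subseteq> {T. \<forall>p\<in>?P. p T = 0}" by auto
  ultimately have "zariski_closure S \<subseteq> {T. \<forall>p\<in>?P. p T = 0}"
    unfolding zariski_closure_def by (intro hull_minimal)
  then show "\<forall>p\<in>polynomial_functions. (\<forall>X\<in>S. p X = 0) \<longrightarrow> p T = 0" using T by auto
next
  assume T: "\<forall>p\<in>polynomial_functions. (\<forall>X\<in>S. p X = 0) \<longrightarrow> p T = 0"
  have "T \<in> Z" if Z: "zariski_closed Z" "S \<subseteq> Z" for Z
  proof -
    obtain P where "P \<subseteq> polynomial_functions" "Z = {T. \<forall>p\<in>P. p T = 0}"
      using Z(1) unfolding zariski_closed_def by (elim exE conjE) (rule that)
    then show ?thesis using T Z(2) by auto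
  qed
  then show "T \<in> zariski_closure S" unfolding zariski_closure_def hull_def by simp
qed

text \<open>For \<open>x\<close>, \<open>y\<close>, \<open>z\<close> taken from dual bases this is a
  coordinate of the tensor in the given bases. It is polynomial in the standard coordinates, so
  polynomial conditions carry over.\<close>

definition contract ::
    "('a::finite \<Rightarrow> complex) \<Rightarrow> ('b::finite \<Rightarrow> complex) \<Rightarrow> ('c::finite \<Rightarrow> complex) \<Rightarrow> ('a, 'b, 'c) tensor3 \<Rightarrow> complex" where
  "contract x y z T = (\<Sum>(i, j, k)\<in>UNIV. x i * y j * z k * T $ i $ j $ k)"

lemma contract_add: "contract x y z (S + T) = contract x y z S + contract x y z T"
  by (simp add: contract_def case_prod_unfold distrib_left sum.distrib)

lemma contract_sum: "contract x y z (\<Sum>i\<in>I. T i) = (\<Sum>i\<in>I. contract x y z (T i))"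
  by (induction I rule: infinite_finite_induct) (simp_all add: contract_add, simp_all add: contract_def)

lemma contract_simple:
  "contract x y z (simple_tensor a b c) = (\<Sum>i\<in>UNIV. x i * a $ i) * (\<Sum>j\<in>UNIV. y j * b $ j) * (\<Sum>k\<in>UNIV. z k * c $ k)"
proof -
  have "(\<Sum>i\<in>UNIV. x i * a $ i) * (\<Sum>j\<in>UNIV. y j * b $ j) * (\<Sum>k\<in>UNIV. z k * c $ k)
      = (\<Sum>i\<in>UNIV. \<Sum>j\<in>UNIV. \<Sum>k\<in>UNIV. x i * y j * z k * (a $ i * b $ j * c $ k))"
    by (simp add: sum_product sum_distrib_right sum_distrib_left mult_ac) (rule sum.swap)
  also have "\<dots> = (\<Sum>i\<in>UNIV. \<Sum>d\<in>UNIV. case d of (j, k) \<Rightarrow> x i * y j * z k * (a $ i * b $ j * c $ k))"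
    by (simp only: sum.cartesian_product UNIV_Times_UNIV)
  also have "\<dots> = contract x y z (simple_tensor a b c)"
    by (simp add: contract_def simple_tensor_def sum.cartesian_product case_prod_unfold)
  finally show ?thesis ..
qed

lemma contract_polynomial: "contract x y z \<in> polynomial_functions"
  unfolding contract_def case_prod_unfold
  by (intro polynomial_functions_sum polynomial_functions.intros)

lemma contract_kronecker:
  "contract (\<lambda>(i, i'). x i * x' i') (\<lambda>(j, j'). y j * y' j') (\<lambda>(k, k'). z k * z' k') (S \<boxtimes> T)
    = contract x y z S * contract x' y' z' T"
proof -
  have "contract x y z S * contract x' y' z' T = (\<Sum>((i, j, k), (i', j', k'))\<in>UNIV.
      (x i * y j * z k * S $ i $ j $ k) * (x' i' * y' j' * z' k' * T $ i' $ j' $ k'))"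
    unfolding contract_def sum_product sum.cartesian_product UNIV_Times_UNIV
    by (simp add: case_prod_unfold)
  also have "\<dots> = contract (\<lambda>(i, i'). x i * x' i') (\<lambda>(j, j'). y j * y' j') (\<lambda>(k, k'). z k * z' k') (S \<boxtimes> T)"
    unfolding contract_def
    by (rule sum.reindex_bij_witness[of _ "\<lambda>((i, i'), (j, j'), (k, k')). ((i, j, k), (i', j', k'))"
          "\<lambda>((i, j, k), (i', j', k')). ((i, i'), (j, j'), (k, k'))"])
      (auto simp: kronecker_def)
  finally show ?thesis ..
qed

lemma dual_basis:
  fixes v :: "nat \<Rightarrow> complex^'n"
  assumes "is_basis v"
  shows "\<exists>D. \<forall>m\<in>{1..CARD('n)}. \<forall>n\<in>{1..CARD('n)}. (\<Sum>i\<in>UNIV. D m i * v n $ i) = of_bool (m = n)"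
proof -
  have inj: "inj_on v {1..CARD('n)}" and ind: "vec.independent (v ` {1..CARD('n)})"
    using assms by (simp_all add: is_basis_def)
  have "\<exists>d. \<forall>n\<in>{1..CARD('n)}. (\<Sum>i\<in>UNIV. d i * v n $ i) = of_bool (m = n)" if m: "m \<in> {1..CARD('n)}" for m
  proof -
    obtain g :: "complex^'n \<Rightarrow> complex^'n" where lin: "Vector_Spaces.linear (*s) (*s) g"
      and g: "\<forall>x\<in>v ` {1..CARD('n)}. g x = (if x = v m then 1 else 0)"
      using vec.linear_independent_extend[OF ind, of "\<lambda>x. if x = v m then 1 else 0"] by blast
    have eq: "g x $ c = (\<Sum>i\<in>UNIV. matrix g $ c $ i * x $ i)" for x c
      using arg_cong[OF matrix_works[OF lin, of x], of "\<lambda>y. y $ c"] by (simp add: matrix_vector_mult_def)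
    have "(\<Sum>i\<in>UNIV. matrix g $ c $ i * v n $ i) = of_bool (m = n)" if n: "n \<in> {1..CARD('n)}" for n c
      unfolding eq[symmetric] using g n inj_onD[OF inj _ n m] by auto
    \<comment> \<open>The functional is a row of the matrix of \<open>g\<close>. As \<open>1\<close>
      is the vector with all entries 1, any row will do, and \<open>undefined\<close> names
      one.\<close>
    then show ?thesis by (intro exI[of _ "\<lambda>i. matrix g $ undefined $ i"]) simp
  qed
  then show ?thesis by (intro bchoice) blast
qed

lemma sum_in_rank_at_most:
  assumes "finite I" "card I \<le> n"
  shows "(\<Sum>i\<in>I. simple_tensor (x i) (y i) (z i)) \<in> rank_at_most n"
proof -
  obtain h where h: "bij_betw h {..<card I} I" using ex_bij_betw_nat_finite[OF assms(1)] by (auto simp: atLeast0LessThan)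
  \<comment> \<open>Zero first factors pad the sum up to \<open>n\<close> terms.\<close>
  let ?x = "\<lambda>k. if k < card I then x (h k) else 0"
  have z: "simple_tensor 0 y z = 0" for y z by (simp add: simple_tensor_def vec_eq_iff)
  have "(\<Sum>i\<in>I. simple_tensor (x i) (y i) (z i)) = (\<Sum>k<card I. simple_tensor (x (h k)) (y (h k)) (z (h k)))"
    using sum.reindex_bij_betw[OF h, of "\<lambda>i. simple_tensor (x i) (y i) (z i)"] by simp
  also have "\<dots> = (\<Sum>k<n. simple_tensor (?x k) (y (h k)) (z (h k)))"
    by (rule sum.mono_neutral_cong_left) (use assms(2) in \<open>auto simp: z\<close>)
  finally have *: "(\<Sum>i\<in>I. simple_tensor (x i) (y i) (z i)) = (\<Sum>k<n. simple_tensor (?x k) (y (h k)) (z (h k)))" .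
  show ?thesis unfolding rank_at_most_def mem_Collect_eq
    by (rule exI[of _ ?x], rule exI[of _ "\<lambda>k. y (h k)"], rule exI[of _ "\<lambda>k. z (h k)"]) (simp only: *)
qed

fun num5 :: "five \<Rightarrow> nat" where
  "num5 E1 = 1" | "num5 E2 = 2" | "num5 E3 = 3" | "num5 E4 = 4" | "num5 E5 = 5"

lemma num5: "num5 g \<in> {1..CARD(5)}"
  by (cases g) simp_all

lemma contract_sum_simple:
  "contract x y z (\<Sum>l<r. simple_tensor (X l) (Y l) (Z l))
    = (\<Sum>l<r. (\<Sum>i\<in>UNIV. x i * X l $ i) * (\<Sum>i\<in>UNIV. y i * Y l $ i) * (\<Sum>i\<in>UNIV. z i * Z l $ i))"
  by (simp add: contract_sum contract_simple)

lemma lower_bound: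
  fixes a b c :: "nat \<Rightarrow> complex^5" and a' b' c' :: "nat \<Rightarrow> complex^2"
  assumes bases: "is_basis a" "is_basis b" "is_basis c" "is_basis a'" "is_basis b'" "is_basis c'"
    and r: "T_Leit5 a b c \<boxtimes> W_tensor a' b' c' \<in> zariski_closure (rank_at_most r)"
  shows "12 \<le> r"
proof (rule ccontr)
  assume "\<not> 12 \<le> r"
  then have r11: "r \<le> 11" by simp
  obtain A where A: "\<forall>m\<in>{1..CARD(5)}. \<forall>n\<in>{1..CARD(5)}. (\<Sum>i\<in>UNIV. A m i * a n $ i) = of_bool (m = n)"
    using dual_basis[OF bases(1)] by (rule exE)
  obtain B where B: "\<forall>m\<in>{1..CARD(5)}. \<forall>n\<in>{1..CARD(5)}. (\<Sum>i\<in>UNIV. B m i * b n $ i) = of_bool (m = n)"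
    using dual_basis[OF bases(2)] by (rule exE)
  obtain C where C: "\<forall>m\<in>{1..CARD(5)}. \<forall>n\<in>{1..CARD(5)}. (\<Sum>i\<in>UNIV. C m i * c n $ i) = of_bool (m = n)"
    using dual_basis[OF bases(3)] by (rule exE)
  obtain A' where A': "\<forall>m\<in>{1..CARD(2)}. \<forall>n\<in>{1..CARD(2)}. (\<Sum>i\<in>UNIV. A' m i * a' n $ i) = of_bool (m = n)"
    using dual_basis[OF bases(4)] by (rule exE)
  obtain B' where B': "\<forall>m\<in>{1..CARD(2)}. \<forall>n\<in>{1..CARD(2)}. (\<Sum>i\<in>UNIV. B' m i * b' n $ i) = of_bool (m = n)"
    using dual_basis[OF bases(5)] by (rule exE)
  obtain C' where C': "\<forall>m\<in>{1..CARD(2)}. \<forall>n\<in>{1..CARD(2)}. (\<Sum>i\<in>UNIV. C' m i * c' n $ i) = of_bool (m = n)"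
    using dual_basis[OF bases(6)] by (rule exE)
  \<comment> \<open>\<open>?n'\<close> exchanges the two basis vectors of the third factor of
    \<open>W\<close>, as in the definition of \<open>dual\<close>.\<close>
  let ?n = "\<lambda>s. if s then 2 else 1 :: nat" and ?n' = "\<lambda>s. if s then 1 else 2 :: nat"
  define xa where "xa g = (\<lambda>(i, i'). A (num5 (fst g)) i * A' (?n (snd g)) i')" for g :: idx
  define xb where "xb g = (\<lambda>(i, i'). B (num5 (fst g)) i * B' (?n (snd g)) i')" for g :: idx
  define xc where "xc g = (\<lambda>(i, i'). C (num5 (fst g)) i * C' (?n' (snd g)) i')" for g :: idx
  define \<tau> where "\<tau> X g i j = contract (xa g) (xb i) (xc j) X" for X g i j
  have five: "{1..5} = {1, 2, 3, 4, 5 :: nat}" by auto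
  have A5: "(\<Sum>i\<in>UNIV. A (num5 g) i * a n $ i) = of_bool (num5 g = n)" if "n \<in> {1, 2, 3, 4, 5}" for g n
    by (rule bspec[OF bspec[OF A num5]]) (use that in auto)
  have B5: "(\<Sum>i\<in>UNIV. B (num5 g) i * b n $ i) = of_bool (num5 g = n)" if "n \<in> {1, 2, 3, 4, 5}" for g n
    by (rule bspec[OF bspec[OF B num5]]) (use that in auto)
  have C5: "(\<Sum>i\<in>UNIV. C (num5 g) i * c n $ i) = of_bool (num5 g = n)" if "n \<in> {1, 2, 3, 4, 5}" for g n
    by (rule bspec[OF bspec[OF C num5]]) (use that in auto)
  have A'2: "(\<Sum>i\<in>UNIV. A' m i * a' n $ i) = of_bool (m = n)" if "m \<in> {1, 2}" "n \<in> {1, 2}" for m n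
    by (rule bspec[OF bspec[OF A']]) (use that in auto)
  have B'2: "(\<Sum>i\<in>UNIV. B' m i * b' n $ i) = of_bool (m = n)" if "m \<in> {1, 2}" "n \<in> {1, 2}" for m n
    by (rule bspec[OF bspec[OF B']]) (use that in auto)
  have C'2: "(\<Sum>i\<in>UNIV. C' m i * c' n $ i) = of_bool (m = n)" if "m \<in> {1, 2}" "n \<in> {1, 2}" for m n
    by (rule bspec[OF bspec[OF C']]) (use that in auto)
  have L: "contract (A (num5 g)) (B (num5 i)) (C (num5 j)) (T_Leit5 a b c) = leit g i j" for g i j
  proof -
    have "contract (A (num5 g)) (B (num5 i)) (C (num5 j)) (T_Leit5 a b c)
      = (\<Sum>l\<in>{1, 2, 3, 4, 5}. of_bool (num5 g = 1) * of_bool (num5 i = l) * of_bool (num5 j = l))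
        + of_bool (num5 g = 2) * of_bool (num5 i = 1) * of_bool (num5 j = 3)
        + of_bool (num5 g = 2) * of_bool (num5 i = 3) * of_bool (num5 j = 5)
        + of_bool (num5 g = 3) * of_bool (num5 i = 1) * of_bool (num5 j = 4)
        + of_bool (num5 g = 4) * of_bool (num5 i = 2) * of_bool (num5 j = 4)
        + of_bool (num5 g = 5) * of_bool (num5 i = 2) * of_bool (num5 j = 5)"
      unfolding T_Leit5_def contract_add contract_sum contract_simple five
      by (intro arg_cong2[of _ _ _ _ "(+)"] sum.cong refl) (simp_all only: A5 B5 C5 insert_iff simp_thms)
    also have "\<dots> = leit g i j" by (cases g; cases i; cases j; simp add: leit_def)
    finally show ?thesis .
  qed
  have W: "contract (A' (?n g)) (B' (?n i)) (C' (?n' j)) (W_tensor a' b' c') = dual g i j" for g i j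
    unfolding W_tensor_def contract_add contract_simple
    by (cases g; cases i; cases j; simp add: A'2 B'2 C'2 dual_def)
  have \<tau>: "\<tau> (T_Leit5 a b c \<boxtimes> W_tensor a' b' c') = std"
    by (intro ext) (simp only: \<tau>_def xa_def xb_def xc_def contract_kronecker L W std_def)
  show False
  proof (rule std_not_limit)
    fix e
    assume e: "\<And>x y z :: idx option \<Rightarrow> idx \<Rightarrow> complex. pexp_val id (\<lambda>g i j. \<Sum>k\<in>UNIV. x k g * y k i * z k j) e = 0"
    have poly: "(\<lambda>X. pexp_val id (\<tau> X) e) \<in> polynomial_functions"
      by (rule pexp_val_polynomial) (simp add: \<tau>_def contract_polynomial)
    have "pexp_val id (\<tau> X) e = 0" if X: "X \<in> rank_at_most r" for X
    proof -
      obtain x y z where X: "X = (\<Sum>l<r. simple_tensor (x l) (y l) (z l))"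
        using X unfolding rank_at_most_def by auto
      obtain h :: "nat \<Rightarrow> idx option" where h: "bij_betw h {..<11} UNIV"
        using ex_bij_betw_nat_finite[of "UNIV :: idx option set"] card_idx_option by (auto simp: atLeast0LessThan)
      define l where "l = inv_into {..<11} h"
      have l: "bij_betw l UNIV {..<11}" unfolding l_def using h by (rule bij_betw_inv_into)
      \<comment> \<open>The terms are indexed by the eleven elements of \<open>idx option\<close>;
        those beyond \<open>r\<close> get a zero first factor.\<close>
      have "\<tau> X g i j = (\<Sum>k\<in>UNIV. (if l k < r then \<Sum>d\<in>UNIV. xa g d * x (l k) $ d else 0)
          * (\<Sum>d\<in>UNIV. xb i d * y (l k) $ d) * (\<Sum>d\<in>UNIV. xc j d * z (l k) $ d))" for g i j
      proof -
        have "\<tau> X g i j = (\<Sum>l<r. (\<Sum>d\<in>UNIV. xa g d * x l $ d) * (\<Sum>d\<in>UNIV. xb i d * y l $ d) * (\<Sum>d\<in>UNIV. xc j d * z l $ d))"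
          unfolding \<tau>_def X by (rule contract_sum_simple)
        also have "\<dots> = (\<Sum>l<11. (if l < r then \<Sum>d\<in>UNIV. xa g d * x l $ d else 0)
            * (\<Sum>d\<in>UNIV. xb i d * y l $ d) * (\<Sum>d\<in>UNIV. xc j d * z l $ d))"
          by (rule sum.mono_neutral_cong_left) (use r11 in auto)
        finally show ?thesis by (simp only: sum.reindex_bij_betw[OF l, symmetric])
      qed
      then have eq: "\<tau> X = (\<lambda>g i j. \<Sum>k\<in>UNIV. (if l k < r then \<Sum>d\<in>UNIV. xa g d * x (l k) $ d else 0)
          * (\<Sum>d\<in>UNIV. xb i d * y (l k) $ d) * (\<Sum>d\<in>UNIV. xc j d * z (l k) $ d))"
        by (intro ext)
      show ?thesis unfolding eq by (rule e)
    qed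
    then have "pexp_val id (\<tau> (T_Leit5 a b c \<boxtimes> W_tensor a' b' c')) e = 0"
      using bspec[OF r[unfolded zariski_closure_iff] poly] by simp
    then show "pexp_val id std e = 0" unfolding \<tau> .
  qed
qed

section \<open>Upper bound\<close>

lemma simple_tensor_nth [simp]: "simple_tensor x y z $ i $ j $ k = x $ i * y $ j * z $ k"
  by (simp add: simple_tensor_def)

lemma kronecker_rank:
  assumes "S \<in> rank_at_most m" "T \<in> rank_at_most n"
  shows "S \<boxtimes> T \<in> rank_at_most (m * n)"
proof -
  obtain x y z where S: "S = (\<Sum>i<m. simple_tensor (x i) (y i) (z i))"
    using assms(1) unfolding rank_at_most_def by auto
  obtain x' y' z' where T: "T = (\<Sum>i<n. simple_tensor (x' i) (y' i) (z' i))"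
    using assms(2) unfolding rank_at_most_def by auto
  let ?k = "\<lambda>u u'. \<chi> i. u $ fst i * u' $ snd i"
  have "S \<boxtimes> T = (\<Sum>d\<in>{..<m} \<times> {..<n}. simple_tensor (?k (x (fst d)) (x' (snd d))) (?k (y (fst d)) (y' (snd d)))
      (?k (z (fst d)) (z' (snd d))))"
    by (simp add: vec_eq_iff kronecker_def S T sum_product sum.cartesian_product case_prod_unfold mult_ac)
  also have "\<dots> \<in> rank_at_most (m * n)" by (rule sum_in_rank_at_most) auto
  finally show ?thesis .
qed

text \<open>Polynomials are continuous along the curve, so one that vanishes at all nonzero
  parameters vanishes at 0.\<close>

lemma zariski_closure_curve:
  fixes K :: "complex \<Rightarrow> ('a::finite, 'b::finite, 'c::finite) tensor3"
  assumes cont: "\<And>i j k. isCont (\<lambda>s. K s $ i $ j $ k) 0"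
    and mem: "\<And>s. s \<noteq> 0 \<Longrightarrow> K s \<in> S"
  shows "K 0 \<in> zariski_closure S"
  unfolding zariski_closure_iff
proof (intro ballI impI)
  fix p :: "('a, 'b, 'c) tensor3 \<Rightarrow> complex"
  assume p: "p \<in> polynomial_functions" and z: "\<forall>X\<in>S. p X = 0"
  have "isCont (\<lambda>s. p (K s)) 0"
    using p by (induction rule: polynomial_functions.induct) (auto intro: cont continuous_intros)
  then have "((\<lambda>s. p (K s)) \<longlongrightarrow> p (K 0)) (at 0)" by (simp add: isCont_def)
  moreover have "eventually (\<lambda>s. p (K s) = 0) (at 0)"
    using z mem by (auto simp: eventually_at_filter)
  then have "((\<lambda>s. p (K s)) \<longlongrightarrow> 0) (at 0)" by (rule tendsto_eventually)
  ultimately show "p (K 0) = 0" by (rule tendsto_unique[OF trivial_limit_at])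
qed

definition scale3 :: "complex \<Rightarrow> ('a::finite, 'b::finite, 'c::finite) tensor3 \<Rightarrow> ('a, 'b, 'c) tensor3" where
  "scale3 u T = (\<chi> i j k. u * T $ i $ j $ k)"

lemma scale3_rank:
  assumes "u \<noteq> 0" "scale3 u T \<in> rank_at_most n"
  shows "T \<in> rank_at_most n"
proof -
  obtain x y z where e: "scale3 u T = (\<Sum>i<n. simple_tensor (x i) (y i) (z i))"
    using assms(2) unfolding rank_at_most_def by auto
  have "T = (\<Sum>i<n. simple_tensor (\<chi> d. x i $ d / u) (y i) (z i))"
  proof -
    have "T $ i $ j $ k = (\<Sum>l<n. simple_tensor (\<chi> d. x l $ d / u) (y l) (z l)) $ i $ j $ k" for i j k
    proof -
      have "u * T $ i $ j $ k = (\<Sum>l<n. simple_tensor (x l) (y l) (z l)) $ i $ j $ k"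
        unfolding e[symmetric] by (simp add: scale3_def)
      then have "T $ i $ j $ k = (\<Sum>l<n. x l $ i * y l $ j * z l $ k) / u"
        using assms(1) by (simp add: field_simps)
      then show ?thesis by (simp add: sum_divide_distrib)
    qed
    then show ?thesis by (simp add: vec_eq_iff)
  qed
  then show ?thesis unfolding rank_at_most_def mem_Collect_eq by (intro exI conjI TrueI)
qed

lemma sum_list_rank:
  assumes "length xs = n"
  shows "(\<Sum>i<n. simple_tensor (fst (xs ! i)) (fst (snd (xs ! i))) (snd (snd (xs ! i)))) \<in> rank_at_most n"
  by (rule sum_in_rank_at_most) auto

section \<open>Curves of rank 2 and of rank 6\<close>

definition W_error ::
    "(nat \<Rightarrow> complex) \<Rightarrow> (nat \<Rightarrow> complex) \<Rightarrow> (nat \<Rightarrow> complex) \<Rightarrow> complex \<Rightarrow> complex" where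
  "W_error x y z s = x 1 * y 2 * z 2 + x 2 * y 1 * z 2 + x 2 * y 2 * z 1 + s * (x 2 * y 2 * z 2)"

text \<open>The difference quotient of the cubes of a_1 + s a_2 and a_1 (likewise for b, c),
  expanded so that no division by \<open>s\<close> remains and \<open>s = 0\<close> gives
  \<open>W\<close>.\<close>

definition W_curve :: "(nat \<Rightarrow> complex^2) \<Rightarrow> (nat \<Rightarrow> complex^2) \<Rightarrow> (nat \<Rightarrow> complex^2) \<Rightarrow> complex \<Rightarrow> (2, 2, 2) tensor3" where
  "W_curve a b c s = (\<chi> i j k. W_tensor a b c $ i $ j $ k
     + s * W_error (\<lambda>n. a n $ i) (\<lambda>n. b n $ j) (\<lambda>n. c n $ k) s)"

lemma W_curve_rank:
  assumes "s \<noteq> 0"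
  shows "W_curve a b c s \<in> rank_at_most 2"
proof (rule scale3_rank)
  let ?s = s
  let ?xs = "[(a 1 + s *s a 2, b 1 + s *s b 2, c 1 + s *s c 2), (- a 1, b 1, c 1)]"
  have "scale3 ?s (W_curve a b c s)
      = (\<Sum>i<2. simple_tensor (fst (?xs ! i)) (fst (snd (?xs ! i))) (snd (snd (?xs ! i))))"
    by (simp add: vec_eq_iff scale3_def W_curve_def W_error_def W_tensor_def eval_nat_numeral algebra_simps)
  also have "\<dots> \<in> rank_at_most 2" by (rule sum_list_rank) simp
  finally show "scale3 ?s (W_curve a b c s) \<in> rank_at_most 2" .
qed (use assms in simp)

text \<open>
  The six points lie near the four corners of the block of \<open>b\<^sub>1, b\<^sub>2\<close> against \<open>c\<^sub>4, c\<^sub>5\<close> and two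
  further points there.  The linear relation \<open>p\<^sub>1 + p\<^sub>2 - p\<^sub>3 = 0\<close> of their limits produces, to first
  order, the slice of \<open>a\<^sub>2\<close>; the relation \<open>p\<^sub>6 - p\<^sub>1 - p\<^sub>2 - p\<^sub>4 - p\<^sub>5 = 0\<close> holds to first order
  and produces, to second order, the identity slice of \<open>a\<^sub>1\<close>.
\<close>

definition leit_points ::
    "(nat \<Rightarrow> complex^5) \<Rightarrow> (nat \<Rightarrow> complex^5) \<Rightarrow> (nat \<Rightarrow> complex^5) \<Rightarrow> complex \<Rightarrow> ((complex^5) \<times> (complex^5) \<times> (complex^5)) list" where
  "leit_points a b c s =
    [(s *s a 2 + (s^2) *s a 3 - a 1, b 1, c 4 - (s^2) *s c 1),
     (s *s a 2 - a 1, b 1 + s *s b 3, c 5),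
     (- (s *s a 2), b 1, c 4 + c 5 - s *s c 3),
     ((s^2) *s a 4 - a 1, b 2 - (s^2) *s b 4,
        c 4 - s *s c 3 - (s^2) *s c 2),
     ((s^2) *s a 5 - a 1, b 2 - s *s b 3 - (s^2) *s b 5,
        c 5 + s *s c 3),
     (a 1, b 1 + b 2, c 4 + c 5)]"

text \<open>The sum of the six points of \<open>leit_points\<close>, divided by \<open>s^2\<close>,
  is the tensor plus \<open>s\<close> times this remainder; being polynomial in \<open>s\<close>, it
  keeps the curve continuous at 0.\<close>

definition leit_error ::
    "(nat \<Rightarrow> complex) \<Rightarrow> (nat \<Rightarrow> complex) \<Rightarrow> (nat \<Rightarrow> complex) \<Rightarrow> complex \<Rightarrow> complex" where
  "leit_error x y z s =
     x 1 * (y 5 * z 3 - y 4 * z 3 - s * (y 4 * z 2)) - x 2 * (y 1 * z 1) - s * (x 3 * (y 1 * z 1))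
     + x 4 * (s^2 * (y 4 * z 3) + s^3 * (y 4 * z 2) - y 2 * z 3 - s * (y 2 * z 2) - s * (y 4 * z 4))
     + x 5 * (y 2 * z 3 - y 3 * z 5 - s * (y 3 * z 3) - s * (y 5 * z 5) - s^2 * (y 5 * z 3))"

definition leit_curve ::
    "(nat \<Rightarrow> complex^5) \<Rightarrow> (nat \<Rightarrow> complex^5) \<Rightarrow> (nat \<Rightarrow> complex^5) \<Rightarrow> complex \<Rightarrow> (5, 5, 5) tensor3" where
  "leit_curve a b c s = (\<chi> i j k. T_Leit5 a b c $ i $ j $ k
     + s * leit_error (\<lambda>n. a n $ i) (\<lambda>n. b n $ j) (\<lambda>n. c n $ k) s)"

lemma leit_curve_rank:
  assumes "s \<noteq> 0"
  shows "leit_curve a b c s \<in> rank_at_most 6"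
proof (rule scale3_rank)
  let ?s = s
  let ?xs = "leit_points a b c ?s"
  have five: "{1..5} = {1, 2, 3, 4, 5 :: nat}" by auto
  have six: "{..<6} = {0, 1, 2, 3, 4, 5 :: nat}" by auto
  have "scale3 (?s\<^sup>2) (leit_curve a b c s)
      = (\<Sum>i<6. simple_tensor (fst (?xs ! i)) (fst (snd (?xs ! i))) (snd (snd (?xs ! i))))"
    unfolding vec_eq_iff
  proof (intro allI)
    fix i j k
    show "scale3 (?s\<^sup>2) (leit_curve a b c s) $ i $ j $ k
      = (\<Sum>i<6. simple_tensor (fst (?xs ! i)) (fst (snd (?xs ! i))) (snd (snd (?xs ! i)))) $ i $ j $ k"
      by (simp add: scale3_def leit_curve_def T_Leit5_def leit_error_def five six leit_points_def)
        (simp add: algebra_simps eval_nat_numeral)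
  qed
  also have "\<dots> \<in> rank_at_most 6" by (rule sum_list_rank) (simp add: leit_points_def)
  finally show "scale3 (?s\<^sup>2) (leit_curve a b c s) \<in> rank_at_most 6" .
qed (use assms in simp)

text \<open>Away from 0 the ranks multiply to at most 6 * 2, and both error terms carry a factor
  \<open>s\<close>.\<close>

lemma upper_bound: "T_Leit5 a b c \<boxtimes> W_tensor a' b' c' \<in> zariski_closure (rank_at_most 12)"
proof -
  let ?K = "\<lambda>s. leit_curve a b c s \<boxtimes> W_curve a' b' c' s"
  have "?K 0 \<in> zariski_closure (rank_at_most 12)"
  proof (rule zariski_closure_curve)
    show "isCont (\<lambda>s. ?K s $ i $ j $ k) 0" for i j k
      by (simp add: kronecker_def leit_curve_def leit_error_def W_curve_def W_error_def)
    show "?K s \<in> rank_at_most 12" if "s \<noteq> 0" for s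
      using kronecker_rank[OF leit_curve_rank[OF that] W_curve_rank[OF that]] by simp
  qed
  also have "?K 0 = T_Leit5 a b c \<boxtimes> W_tensor a' b' c'"
    by (simp add: vec_eq_iff kronecker_def leit_curve_def leit_error_def W_curve_def W_error_def)
  finally show ?thesis .
qed

theorem theorem1p3:
  fixes a b c :: "nat \<Rightarrow> complex^5" and a' b' c' :: "nat \<Rightarrow> complex^2"
  assumes "is_basis a" and "is_basis b" and "is_basis c"
    and "is_basis a'" and "is_basis b'" and "is_basis c'"
  shows "border_rank (T_Leit5 a b c \<boxtimes> W_tensor a' b' c') = 12"
  unfolding border_rank_def
  by (rule Least_equality) (rule upper_bound, erule lower_bound[OF assms])

end
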